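(* For any initial states $x,\widehat{x}\in\mathbb{R}^{r_1}$ and any covariance matrix $p\in\mathbb{R}^{r_1\times r_1}$, any time horizon $t\in[0,\infty[$ and any $\delta\ge 0$, the probability of each of the following two events is greater than $1-e^{-\delta}$: $$\Vert \phi_t(x)-\varphi_t(x)\Vert^2\;\le\;\varpi(\delta)\,\frac{\mathrm{tr}(R_1)}{\lambda_A},$$ and $$\Vert \phi_t(x)-\Phi_t(\widehat{x},p)\Vert^2\;\le\;4\,\varpi(\delta)\,\frac{\mathrm{tr}(R_1)}{\lambda_A}\,\sigma^2_{\partial A}+2e^{-\lambda_{\partial A}t}\,\Vert x-\widehat{x}\Vert^2+8\,\varpi(\delta)\,\frac{\vert e^{-\lambda_At}-e^{-\lambda_{\partial A}t}\vert}{\vert\lambda_A-\lambda_{\partial A}\vert}\,\rho(S)\,\mathrm{tr}(p)^2 .$$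
   Context: Model. Consider the nonlinear filtering problem $$dX_t=A(X_t)\,dt+R_1^{1/2}\,dW_t,\qquad dY_t=BX_t\,dt+R_2^{1/2}\,dV_t,\quad Y_0=0,$$ where $(W_t,V_t)$ is an $(r_1+r_2)$-dimensional Brownian motion, $R_1^{1/2}$ and $R_2^{1/2}$ are symmetric invertible matrices, $B$ is an $(r_2\times r_1)$-matrix, and $A:\mathbb{R}^{r_1}\to\mathbb{R}^{r_1}$ is differentiable with Jacobian $\partial A:\mathbb{R}^{r_1}\to\mathbb{R}^{r_1\times r_1}$. Put $S:=B'R_2^{-1}B$ ($B'$ is the transpose). Notation. $\rho(P)$ is the maximal eigenvalue of a symmetric matrix $P$; $\Vert\cdot\Vert$ is the Euclidean norm of vectors and the $\mathbb{L}_2$-operator norm of matrices; $\mathrm{tr}$ is the trace. Standing assumptions. (i) $-\lambda_{\partial A}:=\sup_{x\in\mathbb{R}^{r_1}}\rho(\partial A(x)+\partial A(x)')<0$ and $\Vert\partial A(x)-\partial A(y)\Vert\le\kappa_{\partial A}\Vert x-y\Vert$ for all $x,y$, for some $\kappa_{\partial A}<\infty$. (ii) $\lambda_A$ is a constant with $\lambda_A\ge\lambda_{\partial A}/2>0$ such that $\langle x-y,A(x)-A(y)\rangle\le-\lambda_A\Vert x-y\Vert^2$ for all $x,y\in\mathbb{R}^{r_1}$ (such a constant exists by (i)). (iii) $S=\rho(S)\,Id$ with $\rho(S)>0$. Flows. $\phi_t(x)=X_t$ is the solution of the signal equation started at $X_0=x$; $\varphi_t(x)=x_t$ is the solution of $\partial_tx_t=A(x_t)$,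 $x_0=x$. $\Phi_t(\widehat{x},p)=\widehat{X}_t$ is the first component of the solution $(\widehat{X}_t,P_t)$ of the Extended Kalman-Bucy filter equations $$d\widehat{X}_t=A(\widehat{X}_t)\,dt+P_tB'R_2^{-1}[dY_t-B\widehat{X}_t\,dt],\qquad \partial_tP_t=\partial A(\widehat{X}_t)P_t+P_t\,\partial A(\widehat{X}_t)'+R_1-P_tSP_t,$$ started at $(\widehat{X}_0,P_0)=(\widehat{x},p)$, where $Y$ is the observation process of the signal $X_t=\phi_t(x)$. Constants. $$\varpi(\delta):=\frac{e^2}{\sqrt2}\left[\frac12+\left(\delta+\sqrt\delta\right)\right],\qquad \sigma^2_{\partial A}:=1+2\pi_{\partial A},\qquad \pi_{\partial A}:=\frac{\rho(S)}{\lambda_{\partial A}}\,\frac{\mathrm{tr}(R_1)}{\lambda_{\partial A}}.$$ If $\lambda_A=\lambda_{\partial A}$, the quotient $\vert e^{-\lambda_At}-e^{-\lambda_{\partial A}t}\vert/\vert\lambda_A-\lambda_{\partial A}\vert$ is understood as its limit $t\,e^{-\lambda_At}$. *)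

theory Defs
  imports "HOL-Probability.Probability"
begin

section \<open>Matrices\<close>

definition eigenvalues :: "real^'n^'n \<Rightarrow> real set" where
  "eigenvalues P = {l. \<exists>v. v \<noteq> 0 \<and> P *v v = l *\<^sub>R v}"

text \<open>Only used for symmetric matrices, whose set of real eigenvalues is finite and nonempty.\<close>

definition max_eigenvalue :: "real^'n^'n \<Rightarrow> real" where
  "max_eigenvalue P = Max (eigenvalues P)"

definition op_norm :: "real^'n^'m \<Rightarrow> real" where
  "op_norm P = onorm ((*v) P)"

definition symmetric_matrix :: "real^'n^'n \<Rightarrow> bool" where
  "symmetric_matrix P \<longleftrightarrow> transpose P = P"

definition covariance_matrix :: "real^'n^'n \<Rightarrow> bool" where
  "covariance_matrix P \<longleftrightarrow> symmetric_matrix P \<and> (\<forall>v. 0 \<le> v \<bullet> (P *v v))"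


section \<open>Continuous-time processes\<close>

text \<open>
  Processes are indexed by the reals, and only their values at times in \<open>{0..}\<close> matter.
  A filtration on \<open>{0..}\<close> extends to the reals by \<open>F t = F 0\<close> for negative \<open>t\<close>.
\<close>

definition filtered_prob_space :: "'w measure \<Rightarrow> (real \<Rightarrow> 'w measure) \<Rightarrow> bool" where
  "filtered_prob_space M F \<longleftrightarrow>
     prob_space M \<and> filtration (space M) F \<and> (\<forall>t. subalgebra M (F t))"

definition continuous_adapted ::
  "'w measure \<Rightarrow> (real \<Rightarrow> 'w measure) \<Rightarrow> (real \<Rightarrow> 'w \<Rightarrow> 'b::topological_space) \<Rightarrow> bool" where
  "continuous_adapted M F X \<longleftrightarrow>
     (\<forall>t\<ge>0. X t \<in> borel_measurable (F t)) \<and>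
     (\<forall>\<omega>\<in>space M. continuous_on {0..} (\<lambda>t. X t \<omega>))"

text \<open>
  Standard Brownian motion in a Euclidean space: the increment over \<open>[s, t]\<close> is independent of
  \<open>F s\<close> and centred Gaussian with covariance \<open>(t - s) Id\<close>.
\<close>

definition brownian_motion ::
  "'w measure \<Rightarrow> (real \<Rightarrow> 'w measure) \<Rightarrow> (real \<Rightarrow> 'w \<Rightarrow> 'b::euclidean_space) \<Rightarrow> bool" where
  "brownian_motion M F W \<longleftrightarrow>
     continuous_adapted M F W \<and>
     (AE \<omega> in M. W 0 \<omega> = 0) \<and>
     (\<forall>s t. 0 \<le> s \<and> s < t \<longrightarrow>
        distributed M lborel (\<lambda>\<omega>. W t \<omega> - W s \<omega>)
          (\<lambda>x. ennreal (\<Prod>b\<in>Basis. normal_density 0 (sqrt (t - s)) (x \<bullet> b))) \<and>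
        prob_space.indep_set M (sets (F s))
          (sets (vimage_algebra (space M) (\<lambda>\<omega>. W t \<omega> - W s \<omega>) borel)))"

definition converges_in_probability ::
  "'w measure \<Rightarrow> (nat \<Rightarrow> 'w \<Rightarrow> 'b::euclidean_space) \<Rightarrow> ('w \<Rightarrow> 'b) \<Rightarrow> bool" where
  "converges_in_probability M X L \<longleftrightarrow>
     (\<forall>n. X n \<in> borel_measurable M) \<and> L \<in> borel_measurable M \<and>
     (\<forall>\<epsilon>>0. (\<lambda>n. measure M {\<omega>\<in>space M. norm (X n \<omega> - L \<omega>) > \<epsilon>}) \<longlonglongrightarrow> 0)"

text \<open>
  A sequence of partitions \<open>0 = \<tau> n 0 \<le> \<dots> \<le> \<tau> n (N n) = t\<close> with mesh tending to \<open>0\<close>.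
\<close>

definition partition_sequence :: "real \<Rightarrow> (nat \<Rightarrow> nat) \<Rightarrow> (nat \<Rightarrow> nat \<Rightarrow> real) \<Rightarrow> bool" where
  "partition_sequence t N \<tau> \<longleftrightarrow>
     (\<forall>n. \<tau> n 0 = 0 \<and> \<tau> n (N n) = t \<and> (\<forall>k<N n. \<tau> n k \<le> \<tau> n (Suc k))) \<and>
     (\<forall>\<epsilon>>0. \<forall>\<^sub>F n in sequentially. \<forall>k<N n. \<tau> n (Suc k) - \<tau> n k < \<epsilon>)"

text \<open>
  The Ito integral process \<open>I t = \<integral>\<^sub>0\<^sup>t H dZ\<close> of a continuous adapted (matrix-valued) integrand
  against a continuous semimartingale: for such integrands it is the limit in probability of the
  left-point Riemann sums along partitions with vanishing mesh.
\<close>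

definition has_ito_integral ::
  "'w measure \<Rightarrow> (real \<Rightarrow> 'w measure) \<Rightarrow> (real \<Rightarrow> 'w \<Rightarrow> real^'n^'m) \<Rightarrow> (real \<Rightarrow> 'w \<Rightarrow> real^'n)
    \<Rightarrow> (real \<Rightarrow> 'w \<Rightarrow> real^'m) \<Rightarrow> bool" where
  "has_ito_integral M F H Z I \<longleftrightarrow>
     continuous_adapted M F H \<and> continuous_adapted M F Z \<and> continuous_adapted M F I \<and>
     (\<forall>t\<ge>0. \<forall>N \<tau>. partition_sequence t N \<tau> \<longrightarrow>
        converges_in_probability M
          (\<lambda>n \<omega>. \<Sum>k<N n. H (\<tau> n k) \<omega> *v (Z (\<tau> n (Suc k)) \<omega> - Z (\<tau> n k) \<omega>))
          (I t))"


section \<open>Signal, observation and filter equations\<close>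

text \<open>
  \<open>Q\<^sub>1 = R\<^sub>1\<^sup>1\<^sup>/\<^sup>2\<close> and \<open>Q\<^sub>2 = R\<^sub>2\<^sup>1\<^sup>/\<^sup>2\<close> below; as these are constant, their integrals
  against Brownian motion are \<open>Q\<^sub>1 W\<^sub>t\<close> and \<open>Q\<^sub>2 V\<^sub>t\<close>.
\<close>

definition signal_solution ::
  "'w measure \<Rightarrow> (real \<Rightarrow> 'w measure) \<Rightarrow> (real^'m \<Rightarrow> real^'m) \<Rightarrow> real^'m^'m
    \<Rightarrow> (real \<Rightarrow> 'w \<Rightarrow> real^'m) \<Rightarrow> real^'m \<Rightarrow> (real \<Rightarrow> 'w \<Rightarrow> real^'m) \<Rightarrow> bool" where
  "signal_solution M F A Q1 W x X \<longleftrightarrow>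
     continuous_adapted M F X \<and>
     (AE \<omega> in M. \<forall>t\<ge>0. X t \<omega> = x + integral {0..t} (\<lambda>s. A (X s \<omega>)) + Q1 *v W t \<omega>)"

definition observation_process ::
  "'w measure \<Rightarrow> (real \<Rightarrow> 'w measure) \<Rightarrow> real^'m^'n \<Rightarrow> real^'n^'n
    \<Rightarrow> (real \<Rightarrow> 'w \<Rightarrow> real^'n) \<Rightarrow> (real \<Rightarrow> 'w \<Rightarrow> real^'m) \<Rightarrow> (real \<Rightarrow> 'w \<Rightarrow> real^'n) \<Rightarrow> bool" where
  "observation_process M F B Q2 V X Y \<longleftrightarrow>
     continuous_adapted M F Y \<and>
     (AE \<omega> in M. \<forall>t\<ge>0. Y t \<omega> = integral {0..t} (\<lambda>s. B *v X s \<omega>) + Q2 *v V t \<omega>)"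

definition ode_solution ::
  "(real^'m \<Rightarrow> real^'m) \<Rightarrow> real^'m \<Rightarrow> (real \<Rightarrow> real^'m) \<Rightarrow> bool" where
  "ode_solution A x y \<longleftrightarrow>
     y 0 = x \<and> (\<forall>t\<ge>0. (y has_vector_derivative A (y t)) (at t within {0..}))"

definition obs_information :: "real^'m^'n \<Rightarrow> real^'n^'n \<Rightarrow> real^'m^'m" where
  "obs_information B R2 = transpose B ** matrix_inv R2 ** B"

text \<open>
  Integral form of the Extended Kalman-Bucy filter equations; the stochastic integral is taken
  against the process \<open>Y\<^sub>t - \<integral>\<^sub>0\<^sup>t B Xh\<^sub>s ds\<close>.
\<close>

definition ekf_solution ::
  "'w measure \<Rightarrow> (real \<Rightarrow> 'w measure) \<Rightarrow> (real^'m \<Rightarrow> real^'m) \<Rightarrow> (real^'m \<Rightarrow> real^'m^'m)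
    \<Rightarrow> real^'m^'n \<Rightarrow> real^'m^'m \<Rightarrow> real^'n^'n \<Rightarrow> (real \<Rightarrow> 'w \<Rightarrow> real^'n)
    \<Rightarrow> real^'m \<Rightarrow> real^'m^'m
    \<Rightarrow> (real \<Rightarrow> 'w \<Rightarrow> real^'m) \<Rightarrow> (real \<Rightarrow> 'w \<Rightarrow> real^'m^'m) \<Rightarrow> bool" where
  "ekf_solution M F A dA B R1 R2 Y xh p Xh P \<longleftrightarrow>
     continuous_adapted M F Xh \<and> continuous_adapted M F P \<and>
     (\<exists>I. has_ito_integral M F
            (\<lambda>t \<omega>. P t \<omega> ** transpose B ** matrix_inv R2)
            (\<lambda>t \<omega>. Y t \<omega> - integral {0..t} (\<lambda>s. B *v Xh s \<omega>)) I \<and>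
          (AE \<omega> in M. \<forall>t\<ge>0. Xh t \<omega> = xh + integral {0..t} (\<lambda>s. A (Xh s \<omega>)) + I t \<omega>)) \<and>
     (AE \<omega> in M. P 0 \<omega> = p \<and>
        (\<forall>t\<ge>0. ((\<lambda>s. P s \<omega>) has_vector_derivative
            (dA (Xh t \<omega>) ** P t \<omega> + P t \<omega> ** transpose (dA (Xh t \<omega>)) + R1
               - P t \<omega> ** obs_information B R2 ** P t \<omega>)) (at t within {0..})))"


section \<open>Constants\<close>

definition varpi :: "real \<Rightarrow> real" where
  "varpi \<delta> = exp 2 / sqrt 2 * (1 / 2 + (\<delta> + sqrt \<delta>))"

definition pi_const :: "real^'m^'m \<Rightarrow> real^'m^'m \<Rightarrow> real \<Rightarrow> real" where
  "pi_const S R1 ldA = (max_eigenvalue S / ldA) * (trace R1 / ldA)"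

definition sigma2_const :: "real^'m^'m \<Rightarrow> real^'m^'m \<Rightarrow> real \<Rightarrow> real" where
  "sigma2_const S R1 ldA = 1 + 2 * pi_const S R1 ldA"

definition exp_quotient :: "real \<Rightarrow> real \<Rightarrow> real \<Rightarrow> real" where
  "exp_quotient a b t =
     (if a = b then t * exp (- a * t) else \<bar>exp (- a * t) - exp (- b * t)\<bar> / \<bar>a - b\<bar>)"

end

theory Submission
  imports Defs
begin

text \<open>
  Both errors \<open>Z\<close> solve an equation \<open>dZ = b dt + dN\<close> with \<open>\<langle>Z, b\<rangle> \<le> - \<lambda>\<^sub>A |Z|\<^sup>2\<close>, where the trace of the
  quadratic variation of the martingale \<open>N\<close> grows at a rate bounded by a deterministic function
  \<open>q\<close>: for the filter, the Riccati equation gives \<open>P \<ge> 0\<close> and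
  \<open>tr P\<^sub>t \<le> exp (- \<lambda> t) tr p + tr R\<^sub>1 / \<lambda>\<close>, where \<open>\<lambda>\<close> is the constant of assumption (i).
  If \<open>c\<close> solves \<open>c' = 2 \<lambda>\<^sub>A c - 2 c\<^sup>2 q\<close>, then \<open>c |Z|\<^sup>2 - \<integral> c q\<close> is at most the logarithm of an exponential
  supermartingale, so that Markov's inequality bounds the upper tail of \<open>c\<^sub>t |Z\<^sub>t|\<^sup>2\<close>. The solution
  \<open>c\<^sub>s = exp (2 \<lambda>\<^sub>A s) / (u + G\<^sub>s)\<close> with \<open>G\<^sub>s = 2 \<integral>\<^sub>0\<^sup>s exp (2 \<lambda>\<^sub>A r) q\<^sub>r dr\<close> and
  \<open>G\<^sub>t \<le> u\<close> costs only \<open>\<integral> c q \<le> ln 2 / 2\<close>.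

  No stochastic calculus is needed: as \<open>P\<close> is continuously differentiable, the Ito integral is
  pathwise, and Ito's formula is replaced by a Taylor expansion along partitions, whose remainder
  tends to \<open>0\<close> pathwise, apart from a quadratic variation error that tends to \<open>0\<close> in \<open>L\<^sup>2\<close>.
\<close>

section \<open>Matrices\<close>

text \<open>The equation for \<open>c\<close> comes from exponential compensation. If the noise is
  \<open>K dU\<close>, then \<open>c |Z|^2\<close> has the martingale part
  \<open>2 c <Z, K dU>\<close>, whose exponential needs the compensator
  \<open>2 c^2 |K^T Z|^2 \<le> 2 c^2 q |Z|^2\<close>. Added to \<open>c' |Z|^2\<close> and the
  dissipative drift, this is at most a multiple of \<open>|Z|^2\<close> that the equation makes
  zero, so that only \<open>c q\<close>, from the second-order term, survives.

  Localisation is avoided by working on partitions. There the product of conditionally Gaussian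
  exponentials has expectation exactly 1 for arbitrary adapted coefficients, while the deterministic
  \<open>q\<close> bounds the quadratic variation error uniformly in the path. The passage to the
  limit is made only in probabilities, at the price of an arbitrarily small
  \<open>\<epsilon>\<close>. The strict inequality of the result is recovered at the end, because
  \<open>varpi \<delta> / 2\<close> strictly exceeds the required
  \<open>\<delta> + ln 2 / 2\<close>.\<close>

lemma inner_matrix_transpose:
  fixes K :: "real^'n^'m"
  shows "v \<bullet> (K *v w) = (transpose K *v v) \<bullet> w"
  by (simp add: dot_lmul_matrix)

lemma norm_matrix_rows:
  fixes K :: "real^'n^'m"
  shows "(norm K)\<^sup>2 = (\<Sum>i\<in>UNIV. (norm (K $ i))\<^sup>2)"
  unfolding power2_norm_eq_inner by (simp add: inner_vec_def[of K])

lemma norm_matrix_vector_le: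
  fixes K :: "real^'n^'m"
  shows "norm (K *v u) \<le> norm K * norm u"
proof -
  have "(norm (K *v u))\<^sup>2 = (\<Sum>i\<in>UNIV. (K $ i \<bullet> u)\<^sup>2)"
    unfolding power2_norm_eq_inner by (simp add: inner_vec_def matrix_vector_mult_def power2_eq_square)
  also have "\<dots> \<le> (\<Sum>i\<in>UNIV. (norm (K $ i))\<^sup>2 * (norm u)\<^sup>2)"
    by (intro sum_mono) (metis Cauchy_Schwarz_ineq power2_norm_eq_inner)
  also have "\<dots> = (norm K * norm u)\<^sup>2"
    by (simp add: power_mult_distrib norm_matrix_rows[of K] sum_distrib_right)
  finally show ?thesis
    by (rule power2_le_imp_le) simp
qed

text \<open>The norm of the Euclidean space of matrices is the Frobenius norm. For a diffusion
  coefficient its square is therefore the trace of the covariance rate, the quantity that the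
  argument has to bound.\<close>

lemma norm_matrix_eq_trace:
  fixes K :: "real^'n^'m"
  shows "(norm K)\<^sup>2 = trace (K ** transpose K)"
  by (simp add: power2_norm_eq_inner inner_vec_def trace_def matrix_matrix_mult_def transpose_def)

lemma norm_transpose [simp]:
  fixes K :: "real^'n^'m"
  shows "norm (transpose K) = norm K"
proof -
  have "(norm (transpose K))\<^sup>2 = (norm K)\<^sup>2"
    unfolding power2_norm_eq_inner inner_vec_def transpose_def by simp (rule sum.swap)
  then show ?thesis by simp
qed

lemma norm_matrix_mult_le:
  fixes K :: "real^'n^'m" and L :: "real^'l^'n"
  shows "norm (K ** L) \<le> norm K * norm L"
proof -
  have row: "(K ** L) $ i = transpose L *v (K $ i)" for i
    by (simp add: vec_eq_iff matrix_matrix_mult_def matrix_vector_mult_def transpose_def mult.commute)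
  have "(norm (K ** L))\<^sup>2 = (\<Sum>i\<in>UNIV. (norm (transpose L *v (K $ i)))\<^sup>2)"
    by (simp add: norm_matrix_rows[of "K ** L"] row del: transpose_matrix_vector)
  also have "\<dots> \<le> (\<Sum>i\<in>UNIV. (norm L * norm (K $ i))\<^sup>2)"
    by (intro sum_mono power_mono) (use norm_matrix_vector_le[of "transpose L"] in auto)
  also have "\<dots> = (norm K * norm L)\<^sup>2"
    by (simp add: power_mult_distrib norm_matrix_rows[of K] sum_distrib_left mult.commute)
  finally show ?thesis
    by (rule power2_le_imp_le) simp
qed

text \<open>Gives continuity, the product rule and the calculus of \<open>Zfun\<close> and
  \<open>Bfun\<close> for matrix products at one stroke.\<close>

lemma bounded_bilinear_matrix_matrix_mult:
  "bounded_bilinear ((**) :: real^'n^'m \<Rightarrow> real^'l^'n \<Rightarrow> real^'l^'m)"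
proof
  fix K K' :: "real^'n^'m" and L L' :: "real^'l^'n" and r :: real
  show "(K + K') ** L = K ** L + K' ** L"
    by (simp add: matrix_matrix_mult_def vec_eq_iff sum.distrib distrib_right)
  show "K ** (L + L') = K ** L + K ** L'" by (rule matrix_add_ldistrib)
  show "(r *\<^sub>R K) ** L = r *\<^sub>R (K ** L)"
    by (simp add: matrix_matrix_mult_def vec_eq_iff sum_distrib_left mult.assoc)
  show "K ** (r *\<^sub>R L) = r *\<^sub>R (K ** L)"
    by (simp add: matrix_matrix_mult_def vec_eq_iff sum_distrib_left mult.left_commute)
  show "\<exists>C. \<forall>(K::real^'n^'m) (L::real^'l^'n). norm (K ** L) \<le> norm K * norm L * C"
    by (intro exI[of _ 1]) (simp add: norm_matrix_mult_le)
qed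

interpretation mm: bounded_bilinear "(**) :: real^'n^'m \<Rightarrow> real^'l^'n \<Rightarrow> real^'l^'m"
  by (rule bounded_bilinear_matrix_matrix_mult)

lemma bounded_bilinear_matrix_vector_mult:
  "bounded_bilinear ((*v) :: real^'n^'m \<Rightarrow> real^'n \<Rightarrow> real^'m)"
proof
  fix K K' :: "real^'n^'m" and u v :: "real^'n" and r :: real
  show "(K + K') *v u = K *v u + K' *v u" by (rule matrix_vector_mult_add_rdistrib)
  show "K *v (u + v) = K *v u + K *v v" by (rule matrix_vector_right_distrib)
  show "(r *\<^sub>R K) *v u = r *\<^sub>R (K *v u)" by (simp add: scaleR_matrix_vector_assoc)
  show "K *v (r *\<^sub>R u) = r *\<^sub>R (K *v u)" by (rule matrix_vector_mult_scaleR)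
  show "\<exists>C. \<forall>(K::real^'n^'m) (u::real^'n). norm (K *v u) \<le> norm K * norm u * C"
    by (intro exI[of _ 1]) (simp add: norm_matrix_vector_le)
qed

lemma bounded_linear_transpose: "bounded_linear (transpose :: real^'n^'m \<Rightarrow> real^'m^'n)"
  by (intro linear_conv_bounded_linear[THEN iffD1] linearI)
     (simp_all add: transpose_def vec_eq_iff)

lemma bounded_linear_trace: "bounded_linear (trace :: real^'n^'n \<Rightarrow> real)"
  by (intro linear_conv_bounded_linear[THEN iffD1] linearI)
     (simp_all add: trace_def sum.distrib sum_distrib_left)

section \<open>Semidefinite quadratic forms\<close>

lemma covariance_matrix_Cauchy_Schwarz:
  assumes P: "covariance_matrix P"
  shows "(v \<bullet> (P *v w))\<^sup>2 \<le> (v \<bullet> (P *v v)) * (w \<bullet> (P *v w))"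
proof -
  define a b c where "a = v \<bullet> (P *v v)" and "b = v \<bullet> (P *v w)" and "c = w \<bullet> (P *v w)"
  have sym: "w \<bullet> (P *v v) = b"
    using P unfolding b_def covariance_matrix_def symmetric_matrix_def
    by (metis inner_matrix_transpose inner_commute)
  have nonneg: "0 \<le> a + 2 * s * b + s\<^sup>2 * c" for s
  proof -
    have "0 \<le> (v + s *\<^sub>R w) \<bullet> (P *v (v + s *\<^sub>R w))"
      using P by (simp add: covariance_matrix_def)
    also have "\<dots> = a + 2 * s * b + s\<^sup>2 * c"
      using sym
      by (simp add: matrix_vector_right_distrib matrix_vector_mult_scaleR inner_add_left inner_add_right
          a_def b_def c_def power2_eq_square algebra_simps)
    finally show ?thesis .
  qed
  have "b\<^sup>2 \<le> a * c"
  proof (cases "c = 0")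
    case True
    have "b = 0"
    proof (rule ccontr)
      assume "b \<noteq> 0"
      \<comment> \<open>For \<open>c = 0\<close> the form is affine in \<open>s\<close>, and this
        \<open>s\<close> gives it the value -1.\<close>
      then show False using nonneg[of "- (a + 1) / (2 * b)"] True by (simp add: field_simps)
    qed
    then show ?thesis using True by simp
  next
    case False
    have "c \<ge> 0" using P by (simp add: c_def covariance_matrix_def)
    with False have "c > 0" by simp
    \<comment> \<open>The minimiser of the parabola in \<open>s\<close>.\<close>
    then show ?thesis using nonneg[of "- b / c"]
      by (simp add: field_simps power2_eq_square)
  qed
  then show ?thesis by (simp add: a_def b_def c_def)
qed

text \<open>Cauchy-Schwarz with \<open>P *v v\<close> in the other slot. It stands in for
  diagonalisation: wherever a semidefinite form touches zero, it produces a null vector.\<close>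

lemma covariance_matrix_kernel:
  assumes "covariance_matrix P" "v \<bullet> (P *v v) = 0"
  shows "P *v v = 0"
  using covariance_matrix_Cauchy_Schwarz[OF assms(1), of "P *v v" v] assms(2) by simp

lemma covariance_matrix_diag_nonneg: "covariance_matrix P \<Longrightarrow> P $ i $ i \<ge> 0"
  using spec[of "\<lambda>v. 0 \<le> v \<bullet> (P *v v)" "axis i 1"]
  by (simp add: covariance_matrix_def inner_axis' matrix_vector_mult_basis column_def)

lemma covariance_matrix_trace_nonneg: "covariance_matrix P \<Longrightarrow> trace P \<ge> 0"
  by (simp add: trace_def sum_nonneg covariance_matrix_diag_nonneg)

text \<open>Cauchy-Schwarz on basis vectors bounds a squared entry by the product of two diagonal
  entries. Thus the trace, which obeys a scalar differential inequality, controls the whole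
  matrix.\<close>

lemma covariance_matrix_norm_le_trace:
  assumes P: "covariance_matrix P"
  shows "norm P \<le> trace P"
proof -
  have e: "P $ i $ j = axis i 1 \<bullet> (P *v axis j 1)" for i j
    by (simp add: inner_axis' matrix_vector_mult_basis column_def)
  have "(norm P)\<^sup>2 = (\<Sum>i\<in>UNIV. \<Sum>j\<in>UNIV. (P $ i $ j)\<^sup>2)"
    unfolding power2_norm_eq_inner by (simp add: inner_vec_def power2_eq_square)
  also have "\<dots> \<le> (\<Sum>i\<in>UNIV. \<Sum>j\<in>UNIV. P $ i $ i * P $ j $ j)"
    unfolding e by (intro sum_mono covariance_matrix_Cauchy_Schwarz P)
  also have "\<dots> = (trace P)\<^sup>2"
    by (simp add: trace_def power2_eq_square sum_product)
  finally show ?thesis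
    by (rule power2_le_imp_le) (rule covariance_matrix_trace_nonneg[OF P])
qed

text \<open>
  Without a spectral theorem: each step of Gaussian elimination on \<open>P\<close> splits off a rank-one
  summand \<open>w w\<^sup>T\<close>, which contributes \<open>w \<bullet> N w\<close> to the trace.
\<close>

lemma trace_mult_covariance_nonneg:
  fixes N P :: "real^'n^'n"
  assumes N: "\<And>v. 0 \<le> v \<bullet> (N *v v)" and P: "covariance_matrix P"
  shows "0 \<le> trace (N ** P)"
  using P
\<comment> \<open>The measure counts nonzero columns: elimination clears the pivot column and keeps
  zero columns zero.\<close>
proof (induction "card {i. P *v axis i 1 \<noteq> 0}" arbitrary: P rule: less_induct)
  case less
  show ?case
  proof (cases "\<exists>i. P *v axis i 1 \<noteq> 0")
    case False
    then have "P *v axis i 1 = 0" for i by blast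
    then have "P = 0"
      by (simp add: vec_eq_iff matrix_vector_mult_basis column_def)
    then show ?thesis by (simp add: trace_def)
  next
    case True
    then obtain i where i: "P *v axis i 1 \<noteq> 0" by blast
    define w d where "w = P *v axis i 1" and "d = axis i 1 \<bullet> (P *v axis i 1)"
    have sym: "v \<bullet> (P *v u) = u \<bullet> (P *v v)" for u v
      using less.prems unfolding covariance_matrix_def symmetric_matrix_def
      by (metis inner_matrix_transpose inner_commute)
    \<comment> \<open>A zero pivot would make its whole column vanish, as isotropic vectors lie in
      the kernel.\<close>
    have d: "d > 0"
      using covariance_matrix_kernel[OF less.prems, of "axis i 1"] i less.prems
      by (auto simp: d_def covariance_matrix_def less_le)
    define R where "R = (\<chi> k l. w $ k * w $ l)"
    define P' where "P' = P - (1 / d) *\<^sub>R R"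
    have R: "R *v v = (w \<bullet> v) *\<^sub>R w" for v
      by (simp add: R_def vec_eq_iff matrix_vector_mult_def inner_vec_def sum_distrib_right sum_distrib_left mult_ac)
    have P'v: "P' *v v = P *v v - ((w \<bullet> v) / d) *\<^sub>R w" for v
      by (simp add: P'_def matrix_vector_mult_diff_rdistrib R flip: scaleR_matrix_vector_assoc)
    have cov: "covariance_matrix P'"
      unfolding covariance_matrix_def symmetric_matrix_def
    proof
      show "transpose P' = P'"
        using less.prems
        by (simp add: P'_def R_def transpose_def covariance_matrix_def symmetric_matrix_def vec_eq_iff mult.commute)
      have "0 \<le> v \<bullet> (P' *v v)" for v
      proof -
        have "v \<bullet> (P *v axis i 1) = w \<bullet> v" by (simp add: w_def inner_commute)
        then have "(w \<bullet> v)\<^sup>2 \<le> (v \<bullet> (P *v v)) * d"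
          using covariance_matrix_Cauchy_Schwarz[OF less.prems, of v "axis i 1"] by (simp add: d_def)
        then show ?thesis using d
          by (simp add: P'v inner_diff_right field_simps power2_eq_square inner_commute)
      qed
      then show "\<forall>v. 0 \<le> v \<bullet> (P' *v v)" by blast
    qed
    have zero: "P' *v axis i 1 = 0"
      using d by (simp add: P'v d_def w_def inner_commute)
    have "{j. P' *v axis j 1 \<noteq> 0} \<subset> {j. P *v axis j 1 \<noteq> 0}"
    proof -
      have "P' *v axis j 1 = 0" if "P *v axis j 1 = 0" for j
      proof -
        have "w \<bullet> axis j 1 = 0" using that sym[of "axis j 1" "axis i 1"] by (simp add: w_def inner_commute)
        then show ?thesis by (simp add: P'v that)
      qed
      then show ?thesis using i zero by blast
    qed
    then have "0 \<le> trace (N ** P')"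
      by (intro less.hyps cov psubset_card_mono) auto
    moreover have "trace (N ** R) = w \<bullet> (N *v w)"
      by (simp add: trace_def matrix_matrix_mult_def R_def inner_vec_def matrix_vector_mult_def sum_distrib_left mult_ac)
    moreover have "N ** P = N ** P' + (1 / d) *\<^sub>R (N ** R)"
    proof -
      have "P = P' + (1 / d) *\<^sub>R R" by (simp add: P'_def)
      then show ?thesis
        by (metis bounded_bilinear.add_right bounded_bilinear.scaleR_right bounded_bilinear_matrix_matrix_mult)
    qed
    ultimately show ?thesis using d N[of w]
      by (simp add: linear_add[OF bounded_linear.linear[OF bounded_linear_trace]]
          linear_scale[OF bounded_linear.linear[OF bounded_linear_trace]])
  qed
qed

section \<open>The largest eigenvalue of a symmetric matrix\<close>

text \<open>Eigenvectors of distinct eigenvalues are orthogonal, hence independent. Finiteness is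
  what gives \<open>Max\<close> in \<open>max_eigenvalue\<close> its meaning.\<close>

lemma finite_eigenvalues_symmetric:
  fixes T :: "real^'n^'n"
  assumes T: "symmetric_matrix T"
  shows "finite (eigenvalues T)"
proof -
  have "\<forall>l\<in>eigenvalues T. \<exists>v. v \<noteq> 0 \<and> T *v v = l *\<^sub>R v"
    by (simp add: eigenvalues_def)
  then obtain f where f: "\<And>l. l \<in> eigenvalues T \<Longrightarrow> f l \<noteq> 0 \<and> T *v f l = l *\<^sub>R f l"
    unfolding Ball_def choice_iff' by blast
  have orth: "f k \<bullet> f l = 0" if "k \<in> eigenvalues T" "l \<in> eigenvalues T" "k \<noteq> l" for k l
  proof -
    have "f k \<bullet> (T *v f l) = (T *v f k) \<bullet> f l"
      using T by (simp add: inner_matrix_transpose symmetric_matrix_def)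
    then show ?thesis using f[OF that(1)] f[OF that(2)] that(3) by simp
  qed
  have inj: "inj_on f (eigenvalues T)"
    using f orth by (metis inj_onI inner_eq_zero_iff)
  have "pairwise orthogonal (f ` eigenvalues T)"
    using orth by (auto simp: pairwise_def orthogonal_def)
  moreover have "0 \<notin> f ` eigenvalues T" using f by auto
  ultimately have "finite (f ` eigenvalues T)"
    using pairwise_orthogonal_independent finiteI_independent by blast
  then show ?thesis using inj finite_imageD by blast
qed

text \<open>Let \<mu> be the maximum of the form on the unit sphere, attained at \<open>u\<close>.
  Then \<mu> times the identity minus \<open>T\<close> is semidefinite and vanishes at
  \<open>u\<close>, so \<open>u\<close> lies in its kernel and \<mu> is an eigenvalue.\<close>

lemma inner_symmetric_le_max_eigenvalue:
  fixes T :: "real^'n^'n"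
  assumes T: "symmetric_matrix T"
  shows "v \<bullet> (T *v v) \<le> max_eigenvalue T * (norm v)\<^sup>2"
proof -
  have "continuous_on (sphere 0 1) (\<lambda>v. v \<bullet> (T *v v))"
    by (intro continuous_intros bounded_linear.continuous_on[OF matrix_vector_mul_bounded_linear])
  moreover have "sphere (0::real^'n) 1 \<noteq> {}" by simp
  ultimately obtain u :: "real^'n" where u: "norm u = 1"
    and max: "\<And>v. norm v = 1 \<Longrightarrow> v \<bullet> (T *v v) \<le> u \<bullet> (T *v u)"
    using continuous_attains_sup[of "sphere (0::real^'n) 1" "\<lambda>v. v \<bullet> (T *v v)"] by auto
  define \<mu> where "\<mu> = u \<bullet> (T *v u)"
  have le: "v \<bullet> (T *v v) \<le> \<mu> * (norm v)\<^sup>2" for v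
  proof (cases "v = 0")
    case False
    then show ?thesis
      using max[of "(1 / norm v) *\<^sub>R v"]
      by (simp add: \<mu>_def matrix_vector_mult_scaleR field_simps power2_eq_square)
  qed simp
  define N where "N = \<mu> *\<^sub>R mat 1 - T"
  have Nv: "N *v v = \<mu> *\<^sub>R v - T *v v" for v
    by (simp add: N_def matrix_vector_mult_diff_rdistrib flip: scaleR_matrix_vector_assoc)
  have "covariance_matrix N"
    unfolding covariance_matrix_def
  proof
    show "symmetric_matrix N"
      using T by (auto simp: symmetric_matrix_def N_def transpose_def vec_eq_iff mat_def)
    show "\<forall>v. 0 \<le> v \<bullet> (N *v v)"
      using le by (simp add: Nv inner_diff_right power2_norm_eq_inner)
  qed
  moreover have "u \<bullet> (N *v u) = 0"
    using u by (simp add: Nv inner_diff_right \<mu>_def norm_eq_1)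
  ultimately have "N *v u = 0" by (rule covariance_matrix_kernel)
  then have "\<mu> \<in> eigenvalues T"
    using u by (auto simp: eigenvalues_def Nv intro!: exI[of _ u])
  then have "\<mu> \<le> max_eigenvalue T"
    unfolding max_eigenvalue_def by (intro Max_ge finite_eigenvalues_symmetric T)
  then show ?thesis using le[of v] mult_right_mono[of \<mu> "max_eigenvalue T" "(norm v)\<^sup>2"] by simp
qed

lemma norm_vector_matrix_le:
  fixes K :: "real^'n^'m"
  shows "norm (z v* K) \<le> norm K * norm z"
proof -
  have "norm (z v* K) ^ 2 = (z v* K) \<bullet> (z v* K)" by (simp add: power2_norm_eq_inner)
  also have "\<dots> = z \<bullet> (K *v (z v* K))" by (rule dot_lmul_matrix)
  also have "\<dots> \<le> norm z * (norm K * norm (z v* K))"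
    by (meson norm_cauchy_schwarz norm_matrix_vector_le mult_left_mono norm_ge_zero order_trans)
  finally show ?thesis
    by (cases "norm (z v* K) = 0") (auto simp: power2_eq_square mult_ac)
qed

section \<open>Inverses and comparison of matrix norms\<close>

lemma
  fixes N :: "real^'n^'n"
  assumes "invertible N"
  shows matrix_mult_matrix_inv: "N ** matrix_inv N = mat 1"
    and matrix_inv_mult_matrix: "matrix_inv N ** N = mat 1"
  using someI_ex[OF assms[unfolded invertible_def]] unfolding matrix_inv_def by auto

lemma transpose_matrix_inv_symmetric:
  fixes N :: "real^'n^'n"
  assumes "invertible N" "symmetric_matrix N"
  shows "transpose (matrix_inv N) = matrix_inv N"
proof -
  note 1 = matrix_mult_matrix_inv[OF assms(1)] matrix_inv_mult_matrix[OF assms(1)]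
  have "transpose (matrix_inv N) = transpose (matrix_inv N) ** (N ** matrix_inv N)" using 1 by simp
  also have "\<dots> = transpose (N ** matrix_inv N) ** matrix_inv N"
    using assms(2) by (simp add: matrix_mul_assoc matrix_transpose_mul symmetric_matrix_def)
  finally show ?thesis using 1 by simp
qed

lemma norm_le_op_norm:
  fixes N :: "real^'n^'m"
  shows "norm N \<le> real CARD('m) * (real CARD('n) * op_norm N)"
proof -
  have e: "\<bar>N $ i $ j\<bar> \<le> op_norm N" for i j
  proof -
    have "\<bar>N $ i $ j\<bar> = \<bar>(N *v axis j 1) $ i\<bar>" by (simp add: matrix_vector_mult_basis column_def)
    also have "\<dots> \<le> norm (N *v axis j 1)" by (rule component_le_norm_cart)
    also have "\<dots> \<le> op_norm N * norm (axis j (1::real) :: real^'n)"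
      unfolding op_norm_def by (rule onorm[OF matrix_vector_mul_bounded_linear])
    finally show ?thesis by simp
  qed
  have "norm N \<le> (\<Sum>i\<in>UNIV. norm (N $ i))" unfolding norm_vec_def by (rule L2_set_le_sum) auto
  also have "\<dots> \<le> (\<Sum>i\<in>(UNIV::'m set). \<Sum>j\<in>UNIV. \<bar>N $ i $ j\<bar>)" by (intro sum_mono norm_le_l1_cart)
  also have "\<dots> \<le> (\<Sum>i\<in>(UNIV::'m set). \<Sum>j\<in>(UNIV::'n set). op_norm N)" by (intro sum_mono e)
  finally show ?thesis by simp
qed

text \<open>All norms being equivalent, a crude dimension-dependent constant is enough for
  continuity. The absolute value allows for a constant \<kappa> of unspecified sign.\<close>

lemma continuous_on_op_norm_lipschitz:
  fixes f :: "real^'l \<Rightarrow> real^'n^'m"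
  assumes "\<And>y z. op_norm (f y - f z) \<le> \<kappa> * norm (y - z)"
  shows "continuous_on UNIV f"
proof -
  have "(real CARD('m) * (real CARD('n) * \<bar>\<kappa>\<bar>))-lipschitz_on UNIV f"
  proof (rule lipschitz_onI)
    fix y z :: "real^'l"
    have "norm (f y - f z) \<le> real CARD('m) * (real CARD('n) * op_norm (f y - f z))" by (rule norm_le_op_norm)
    also have "\<dots> \<le> real CARD('m) * (real CARD('n) * (\<bar>\<kappa>\<bar> * norm (y - z)))"
      using order_trans[OF assms mult_right_mono[OF abs_ge_self norm_ge_zero]] by (intro mult_left_mono) auto
    finally show "dist (f y) (f z) \<le> (real CARD('m) * (real CARD('n) * \<bar>\<kappa>\<bar>)) * dist y z"
      by (simp add: dist_norm mult.assoc)
  qed simp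
  then show ?thesis by (rule lipschitz_on_continuous_on)
qed

section \<open>Gaussian increments\<close>

lemma
  fixes f :: "'a::euclidean_space \<Rightarrow> real \<Rightarrow> real"
  assumes "\<And>b. b \<in> Basis \<Longrightarrow> integrable lborel (f b)"
  shows integrable_lborel_prod: "integrable lborel (\<lambda>x. \<Prod>b\<in>Basis. f b (x \<bullet> b))"
    and integral_lborel_prod:
      "(\<integral>x. (\<Prod>b\<in>Basis. f b (x \<bullet> b)) \<partial>lborel) = (\<Prod>b\<in>Basis. \<integral>y. f b y \<partial>lborel)"
proof -
  interpret finite_product_sigma_finite "\<lambda>_. lborel :: real measure" "Basis :: 'a set"
    by standard simp
  have f: "f b \<in> borel_measurable borel" if "b \<in> Basis" for b
    using assms[OF that] by (auto dest: borel_measurable_integrable)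
  have meas: "(\<lambda>x. \<Prod>b\<in>Basis. f b (x \<bullet> b)) \<in> borel_measurable borel"
    by (intro borel_measurable_prod measurable_compose[OF _ f]) auto
  have T: "(\<lambda>f. \<Sum>b\<in>Basis. f b *\<^sub>R b) \<in> (\<Pi>\<^sub>M b\<in>Basis. lborel) \<rightarrow>\<^sub>M (borel :: 'a measure)"
    by measurable
  have eq: "(\<Prod>b\<in>Basis. f b ((\<Sum>c\<in>Basis. x c *\<^sub>R c) \<bullet> b)) = (\<Prod>b\<in>Basis. f b (x b))" for x
    by (intro prod.cong) simp_all
  show "integrable lborel (\<lambda>x. \<Prod>b\<in>Basis. f b (x \<bullet> b))"
    unfolding lborel_eq[where 'a='a] integrable_distr_eq[OF T meas] eq
    by (intro product_integrable_prod assms) auto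
  show "(\<integral>x. (\<Prod>b\<in>Basis. f b (x \<bullet> b)) \<partial>lborel) = (\<Prod>b\<in>Basis. \<integral>y. f b y \<partial>lborel)"
    unfolding lborel_eq[where 'a='a] integral_distr[OF T meas] eq
    by (intro product_integral_prod assms) auto
qed

abbreviation gaussian :: "real \<Rightarrow> 'b::euclidean_space \<Rightarrow> real" where
  "gaussian \<sigma> x \<equiv> (\<Prod>b\<in>Basis. normal_density 0 \<sigma> (x \<bullet> b))"

text \<open>Completing the square: in each coordinate the tilted density is again a normal density,
  with mean shifted to \<sigma> squared times the coordinate of \<theta>, so its mass is 1. As a
  nonnegative integral the identity can be used without checking integrability.\<close>

lemma gaussian_exp_moment:
  fixes \<theta> :: "'b::euclidean_space"
  assumes D: "distributed M lborel U (gaussian \<sigma>)" and \<sigma>: "\<sigma> > 0"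
  shows "(\<integral>\<^sup>+\<omega>. ennreal (exp (\<theta> \<bullet> U \<omega> - (norm \<theta>)\<^sup>2 * \<sigma>\<^sup>2 / 2)) \<partial>M) = 1"
proof -
  have 1: "normal_density 0 \<sigma> y * exp (a * y - a\<^sup>2 * \<sigma>\<^sup>2 / 2) = normal_density (\<sigma>\<^sup>2 * a) \<sigma> y" for a y
    using \<sigma> by (simp add: normal_density_def field_simps power2_eq_square flip: exp_add)
  have "exp (\<theta> \<bullet> x - (norm \<theta>)\<^sup>2 * \<sigma>\<^sup>2 / 2) =
      (\<Prod>b\<in>Basis. exp ((\<theta> \<bullet> b) * (x \<bullet> b) - (\<theta> \<bullet> b)\<^sup>2 * \<sigma>\<^sup>2 / 2))" for x :: 'b
  proof -
    have "(norm \<theta>)\<^sup>2 = (\<Sum>b\<in>Basis. (\<theta> \<bullet> b)\<^sup>2)"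
      unfolding power2_norm_eq_inner by (subst euclidean_inner) (simp add: power2_eq_square)
    then show ?thesis
      by (simp add: euclidean_inner[of \<theta> x] sum_subtractf sum_distrib_right sum_divide_distrib flip: exp_sum)
  qed
  then have "gaussian \<sigma> x * exp (\<theta> \<bullet> x - (norm \<theta>)\<^sup>2 * \<sigma>\<^sup>2 / 2) =
      (\<Prod>b\<in>Basis. normal_density (\<sigma>\<^sup>2 * (\<theta> \<bullet> b)) \<sigma> (x \<bullet> b))" for x
    unfolding 1[symmetric] prod.distrib by simp
  then have 2: "ennreal (gaussian \<sigma> x) * ennreal (exp (\<theta> \<bullet> x - (norm \<theta>)\<^sup>2 * \<sigma>\<^sup>2 / 2)) =
      (\<Prod>b\<in>Basis. ennreal (normal_density (\<sigma>\<^sup>2 * (\<theta> \<bullet> b)) \<sigma> (x \<bullet> b)))" for x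
    by (simp add: prod_ennreal prod_nonneg flip: ennreal_mult')
  have "(\<integral>\<^sup>+\<omega>. ennreal (exp (\<theta> \<bullet> U \<omega> - (norm \<theta>)\<^sup>2 * \<sigma>\<^sup>2 / 2)) \<partial>M)
      = (\<integral>\<^sup>+x. ennreal (gaussian \<sigma> x) * ennreal (exp (\<theta> \<bullet> x - (norm \<theta>)\<^sup>2 * \<sigma>\<^sup>2 / 2)) \<partial>lborel)"
    by (rule distributed_nn_integral[OF D, symmetric]) measurable
  also have "\<dots> = (\<Prod>b\<in>Basis. \<integral>\<^sup>+y. ennreal (normal_density (\<sigma>\<^sup>2 * (\<theta> \<bullet> b)) \<sigma> y) \<partial>lborel)"
    unfolding 2 by (rule nn_integral_lborel_prod) auto
  also have "\<dots> = 1"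
    using \<sigma> by (simp add: nn_integral_eq_integral integrable_normal_density integral_normal_density)
  finally show ?thesis .
qed

lemma
  fixes U :: "'w \<Rightarrow> 'b::euclidean_space" and a :: "'b \<Rightarrow> nat"
  assumes D: "distributed M lborel U (gaussian \<sigma>)" and \<sigma>: "\<sigma> > 0"
  shows integrable_gaussian_moment: "integrable M (\<lambda>\<omega>. \<Prod>b\<in>Basis. (U \<omega> \<bullet> b) ^ a b)"
    and integral_gaussian_moment: "(\<integral>\<omega>. (\<Prod>b\<in>Basis. (U \<omega> \<bullet> b) ^ a b) \<partial>M) =
      (\<Prod>b\<in>Basis. \<integral>y. normal_density 0 \<sigma> y * y ^ a b \<partial>lborel)"
proof -
  have int: "integrable lborel (\<lambda>y. normal_density 0 \<sigma> y * y ^ a b)" for b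
    using integrable_normal_moment[OF \<sigma>, of 0 "a b"] by simp
  have eq: "gaussian \<sigma> x * (\<Prod>b\<in>Basis. (x \<bullet> b) ^ a b) =
      (\<Prod>b\<in>Basis. normal_density 0 \<sigma> (x \<bullet> b) * (x \<bullet> b) ^ a b)" for x :: 'b
    by (simp add: prod.distrib)
  have nn: "AE x in lborel. 0 \<le> gaussian \<sigma> x" by (simp add: prod_nonneg)
  show "integrable M (\<lambda>\<omega>. \<Prod>b\<in>Basis. (U \<omega> \<bullet> b) ^ a b)"
    using integrable_lborel_prod[of "\<lambda>b y. normal_density 0 \<sigma> y * y ^ a b", OF int]
    by (subst distributed_integrable[OF D, symmetric]) (auto simp: eq prod_nonneg)
  have "(\<integral>\<omega>. (\<Prod>b\<in>Basis. (U \<omega> \<bullet> b) ^ a b) \<partial>M) =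
      (\<integral>x. gaussian \<sigma> x * (\<Prod>b\<in>Basis. (x \<bullet> b) ^ a b) \<partial>lborel)"
    by (rule distributed_integral[OF D, symmetric]) (auto simp: prod_nonneg)
  then show "(\<integral>\<omega>. (\<Prod>b\<in>Basis. (U \<omega> \<bullet> b) ^ a b) \<partial>M) =
      (\<Prod>b\<in>Basis. \<integral>y. normal_density 0 \<sigma> y * y ^ a b \<partial>lborel)"
    using integral_lborel_prod[of "\<lambda>b y. normal_density 0 \<sigma> y * y ^ a b", OF int] by (simp add: eq)
qed


lemma normal_moments:
  assumes \<sigma>: "\<sigma> > 0"
  shows "(\<integral>y. normal_density 0 \<sigma> y * y \<partial>lborel) = 0"
    and "(\<integral>y. normal_density 0 \<sigma> y * y\<^sup>2 \<partial>lborel) = \<sigma>\<^sup>2"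
    and "(\<integral>y. normal_density 0 \<sigma> y * y ^ 4 \<partial>lborel) = 3 * \<sigma> ^ 4"
proof -
  show "(\<integral>y. normal_density 0 \<sigma> y * y \<partial>lborel) = 0"
    using integral_normal_moment_odd[OF \<sigma>, of 0 0] by simp
  have "fact (2 * 1) / ((2 / \<sigma>\<^sup>2) ^ 1 * fact 1) = \<sigma>\<^sup>2"
    using \<sigma> by (simp add: fact_numeral)
  then show "(\<integral>y. normal_density 0 \<sigma> y * y\<^sup>2 \<partial>lborel) = \<sigma>\<^sup>2"
    using integral_normal_moment_even[OF \<sigma>, of 0 1] by simp
  have "fact (2 * 2) / ((2 / \<sigma>\<^sup>2) ^ 2 * fact 2) = 3 * \<sigma> ^ 4"
    using \<sigma> by (simp add: fact_numeral power_divide)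
  then show "(\<integral>y. normal_density 0 \<sigma> y * y ^ 4 \<partial>lborel) = 3 * \<sigma> ^ 4"
    using integral_normal_moment_even[OF \<sigma>, of 0 2] by simp
qed

lemma
  fixes U :: "'w \<Rightarrow> 'b::euclidean_space"
  assumes D: "distributed M lborel U (gaussian \<sigma>)" and \<sigma>: "\<sigma> > 0"
    and i: "i \<in> Basis" and j: "j \<in> Basis"
  shows integrable_gaussian_cov: "integrable M (\<lambda>\<omega>. (U \<omega> \<bullet> i) * (U \<omega> \<bullet> j))"
    and integral_gaussian_cov: "(\<integral>\<omega>. (U \<omega> \<bullet> i) * (U \<omega> \<bullet> j) \<partial>M) = (if i = j then \<sigma>\<^sup>2 else 0)"
    and integrable_gaussian_4: "integrable M (\<lambda>\<omega>. (U \<omega> \<bullet> i) ^ 4)"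
    and integral_gaussian_4: "(\<integral>\<omega>. (U \<omega> \<bullet> i) ^ 4 \<partial>M) = 3 * \<sigma> ^ 4"
proof -
  have pd: "(\<Prod>b\<in>Basis. f b ^ (if b = k then n else 0)) = f k ^ n"
    if "k \<in> Basis" for f :: "'b \<Rightarrow> real" and k n
  proof -
    have "(\<Prod>b\<in>Basis. f b ^ (if b = k then n else 0)) = (\<Prod>b\<in>Basis. if b = k then f k ^ n else 1)"
      by (intro prod.cong) auto
    then show ?thesis using that by simp
  qed
  \<comment> \<open>Adding two indicator exponents gives degree 2 at \<open>i\<close> if
    \<open>i = j\<close>, so variances and covariances are instances of one moment formula.\<close>
  have e: "(\<Prod>b\<in>Basis. (x \<bullet> b) ^ ((if b = i then 1 else 0) + (if b = j then 1 else 0))) = (x \<bullet> i) * (x \<bullet> j)" for x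
    unfolding power_add prod.distrib by (simp only: pd[OF i] pd[OF j]) simp
  note * = integrable_gaussian_moment[OF D \<sigma>, of "\<lambda>b. (if b = i then 1 else 0) + (if b = j then 1 else 0)"]
    integral_gaussian_moment[OF D \<sigma>, of "\<lambda>b. (if b = i then 1 else 0) + (if b = j then 1 else 0)"]
  show "integrable M (\<lambda>\<omega>. (U \<omega> \<bullet> i) * (U \<omega> \<bullet> j))" using *(1) unfolding e .
  have "(\<Prod>b\<in>Basis. \<integral>y. normal_density 0 \<sigma> y * y ^ ((if b = i then 1 else 0) + (if b = j then 1 else 0)) \<partial>lborel)
      = (if i = j then \<sigma>\<^sup>2 else 0)"
  proof (cases "i = j")
    case True
    have "(\<Prod>b\<in>Basis. \<integral>y. normal_density 0 \<sigma> y * y ^ ((if b = i then 1 else 0) + (if b = j then 1 else 0)) \<partial>lborel)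
        = (\<Prod>b\<in>Basis. if b = i then \<sigma>\<^sup>2 else 1)"
      using True \<sigma> by (intro prod.cong) (auto simp: normal_moments(2)[OF \<sigma>, unfolded power2_eq_square] power2_eq_square)
    then show ?thesis using True i by simp
  next
    case False
    then show ?thesis using normal_moments(1)[OF \<sigma>] i by (auto intro!: prod_zero bexI[of _ i])
  qed
  then show "(\<integral>\<omega>. (U \<omega> \<bullet> i) * (U \<omega> \<bullet> j) \<partial>M) = (if i = j then \<sigma>\<^sup>2 else 0)"
    using *(2) unfolding e by simp
  note ** = integrable_gaussian_moment[OF D \<sigma>, of "\<lambda>b. (if b = i then 4 else 0)"]
    integral_gaussian_moment[OF D \<sigma>, of "\<lambda>b. (if b = i then 4 else 0)"]
  show "integrable M (\<lambda>\<omega>. (U \<omega> \<bullet> i) ^ 4)" using **(1) unfolding pd[OF i] .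
  have "(\<Prod>b\<in>Basis. \<integral>y. normal_density 0 \<sigma> y * y ^ (if b = i then 4 else 0) \<partial>lborel)
        = (\<Prod>b\<in>Basis. if b = i then 3 * \<sigma> ^ 4 else 1)"
    using \<sigma> by (intro prod.cong) (auto simp: normal_moments(3)[OF \<sigma>])
  then show "(\<integral>\<omega>. (U \<omega> \<bullet> i) ^ 4 \<partial>M) = 3 * \<sigma> ^ 4"
    using **(2) i unfolding pd[OF i] by simp
qed

lemma (in prob_space)
  fixes U :: "'a \<Rightarrow> 'b::euclidean_space"
  assumes D: "distributed M lborel U (gaussian \<sigma>)" and \<sigma>: "\<sigma> > 0"
    and i: "i \<in> Basis" and j: "j \<in> Basis"
  defines "\<xi> \<equiv> \<lambda>\<omega>. (U \<omega> \<bullet> i) * (U \<omega> \<bullet> j) - (if i = j then \<sigma>\<^sup>2 else 0)"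
  shows integrable_gaussian_fluctuation: "integrable M \<xi>"
    and expectation_gaussian_fluctuation: "expectation \<xi> = 0"
    and integrable_gaussian_fluctuation_sq: "integrable M (\<lambda>\<omega>. (\<xi> \<omega>)\<^sup>2)"
    and expectation_gaussian_fluctuation_sq: "expectation (\<lambda>\<omega>. (\<xi> \<omega>)\<^sup>2) \<le> 8 * \<sigma> ^ 4"
proof -
  note cov = integrable_gaussian_cov[OF D \<sigma> i j] integral_gaussian_cov[OF D \<sigma> i j]
  show 1: "integrable M \<xi>" unfolding \<xi>_def using cov(1) by auto
  show "expectation \<xi> = 0" unfolding \<xi>_def using cov by (simp add: prob_space)
  have [measurable]: "\<xi> \<in> borel_measurable M" using 1 by auto
  note four = integrable_gaussian_4[OF D \<sigma> i j] integrable_gaussian_4[OF D \<sigma> j i]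
  \<comment> \<open>Source of the constant 8: each of the two fourth moments contributes 3, the
    squared mean contributes 2.\<close>
  have le: "(\<xi> \<omega>)\<^sup>2 \<le> (U \<omega> \<bullet> i) ^ 4 + (U \<omega> \<bullet> j) ^ 4 + 2 * \<sigma> ^ 4" for \<omega>
  proof -
    define a b d where "a = U \<omega> \<bullet> i" and "b = U \<omega> \<bullet> j" and "d = (if i = j then \<sigma>\<^sup>2 else 0)"
    have "(a * b - d)\<^sup>2 \<le> 2 * (a * b)\<^sup>2 + 2 * d\<^sup>2"
      using zero_le_power2[of "a * b + d"] by (simp add: power2_eq_square algebra_simps)
    moreover have "2 * (a * b)\<^sup>2 \<le> a ^ 4 + b ^ 4"
      using zero_le_power2[of "a\<^sup>2 - b\<^sup>2"] by (simp add: power2_eq_square power4_eq_xxxx algebra_simps)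
    moreover have "d\<^sup>2 \<le> \<sigma> ^ 4"
      by (simp add: d_def flip: power_mult)
    ultimately show ?thesis by (simp add: \<xi>_def a_def b_def d_def)
  qed
  have int: "integrable M (\<lambda>\<omega>. (U \<omega> \<bullet> i) ^ 4 + (U \<omega> \<bullet> j) ^ 4 + 2 * \<sigma> ^ 4)"
    using four by auto
  show 2: "integrable M (\<lambda>\<omega>. (\<xi> \<omega>)\<^sup>2)"
    by (rule Bochner_Integration.integrable_bound[OF int]) (use le in \<open>auto intro!: AE_I2\<close>)
  have "expectation (\<lambda>\<omega>. (\<xi> \<omega>)\<^sup>2) \<le> expectation (\<lambda>\<omega>. (U \<omega> \<bullet> i) ^ 4 + (U \<omega> \<bullet> j) ^ 4 + 2 * \<sigma> ^ 4)"
    by (intro integral_mono 2 int le)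
  also have "\<dots> = 8 * \<sigma> ^ 4"
    using four integral_gaussian_4[OF D \<sigma> i j] integral_gaussian_4[OF D \<sigma> j i] by (simp add: prob_space)
  finally show "expectation (\<lambda>\<omega>. (\<xi> \<omega>)\<^sup>2) \<le> 8 * \<sigma> ^ 4" .
qed

section \<open>Sums of Gaussian increments with adapted coefficients\<close>

text \<open>Brownian motion seen along one partition: \<open>G k\<close> is the information at the
  k-th point and \<open>U k\<close> the increment over the following step. A single \<sigma>
  suffices because only equidistant partitions are used.\<close>

locale gaussian_increments = prob_space M for M :: "'a measure" +
  fixes G :: "nat \<Rightarrow> 'a measure" and U :: "nat \<Rightarrow> 'a \<Rightarrow> 'b::euclidean_space" and \<sigma> :: real
  assumes subalgebra: "subalgebra M (G k)"
    and sets_mono: "sets (G k) \<subseteq> sets (G (Suc k))"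
    and increment_measurable: "U k \<in> borel_measurable (G (Suc k))"
    and indep_increment: "indep_set (sets (G k)) (sets (vimage_algebra (space M) (U k) borel))"
    and gaussian_increment: "distributed M lborel (U k) (gaussian \<sigma>)"
    and \<sigma>_pos: "\<sigma> > 0"
begin

lemma space_G: "space (G k) = space M"
  using subalgebra by (simp add: subalgebra_def)

lemma measurable_G: "X \<in> measurable (G k) N \<Longrightarrow> X \<in> measurable M N"
  by (rule measurable_from_subalg[OF subalgebra])

lemma measurable_G_Suc: "X \<in> measurable (G k) N \<Longrightarrow> X \<in> measurable (G (Suc k)) N"
  by (rule measurable_from_subalg[of _ "G k"]) (use space_G sets_mono in \<open>auto simp: subalgebra_def\<close>)

lemma increment_measurable_M: "U k \<in> borel_measurable M"
  by (rule measurable_G[OF increment_measurable])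

lemma indep_var_increment:
  assumes X: "X \<in> measurable (G k) N" and f: "f \<in> measurable borel N'"
  shows "indep_var N X N' (\<lambda>\<omega>. f (U k \<omega>))"
  unfolding indep_var_eq
proof (intro conjI measurable_G[OF X] measurable_compose[OF increment_measurable_M f])
  have "sigma_sets (space M) {X -` A \<inter> space M |A. A \<in> sets N} \<subseteq> sets (G k)"
    using measurable_sets[OF X] sets.top[of "G k"] unfolding space_G
    by (intro sets.sigma_sets_subset') auto
  moreover have "sigma_sets (space M) {(\<lambda>\<omega>. f (U k \<omega>)) -` A \<inter> space M |A. A \<in> sets N'} \<subseteq>
      sets (vimage_algebra (space M) (U k) borel)"
  proof -
    have "(\<lambda>\<omega>. f (U k \<omega>)) -` A \<inter> space M = U k -` (f -` A) \<inter> space M" for A by auto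
    moreover have "f -` A \<in> sets borel" if "A \<in> sets N'" for A
      using measurable_sets[OF f that] by simp
    ultimately have "{(\<lambda>\<omega>. f (U k \<omega>)) -` A \<inter> space M |A. A \<in> sets N'} \<subseteq>
        {U k -` A \<inter> space M |A. A \<in> sets borel}"
      by blast
    then show ?thesis
      unfolding sets_vimage_algebra by (rule sigma_sets_mono')
  qed
  ultimately show "indep_set (sigma_sets (space M) {X -` A \<inter> space M |A. A \<in> sets N})
      (sigma_sets (space M) {(\<lambda>\<omega>. f (U k \<omega>)) -` A \<inter> space M |A. A \<in> sets N'})"
    using indep_increment[of k] unfolding indep_set_def
    by (elim indep_sets_mono_sets) (auto split: bool.split)
qed

text \<open>The substitute for conditional expectation: with a product law, Fubini allows
  integrating over the increment while everything known at step \<open>k\<close> is frozen.\<close>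

lemma distr_increment:
  assumes X: "X \<in> measurable (G k) N"
  shows "distr M (N \<Otimes>\<^sub>M borel) (\<lambda>\<omega>. (X \<omega>, U k \<omega>)) = distr M N X \<Otimes>\<^sub>M distr M borel (U k)"
proof -
  note [measurable] = measurable_G[OF X] increment_measurable_M[of k]
  interpret X: prob_space "distr M N X" by (rule prob_space_distr) measurable
  interpret U: prob_space "distr M borel (U k)" by (rule prob_space_distr) measurable
  show ?thesis
  proof (rule pair_measure_eqI[symmetric])
    fix A B assume A: "A \<in> sets (distr M N X)" and B: "B \<in> sets (distr M borel (U k))"
    have "X -` A \<inter> space M \<in> sets (G k)" using measurable_sets[OF X] A space_G by auto
    moreover have "U k -` B \<inter> space M \<in> sets (vimage_algebra (space M) (U k) borel)"
      using B by (auto intro!: in_vimage_algebra)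
    ultimately have "prob ((X -` A \<inter> space M) \<inter> (U k -` B \<inter> space M)) =
        prob (X -` A \<inter> space M) * prob (U k -` B \<inter> space M)"
      by (rule indep_setD[OF indep_increment])
    moreover have "(\<lambda>\<omega>. (X \<omega>, U k \<omega>)) -` (A \<times> B) \<inter> space M = (X -` A \<inter> space M) \<inter> (U k -` B \<inter> space M)"
      by auto
    ultimately show "emeasure (distr M N X) A * emeasure (distr M borel (U k)) B =
        emeasure (distr M (N \<Otimes>\<^sub>M borel) (\<lambda>\<omega>. (X \<omega>, U k \<omega>))) (A \<times> B)"
      using A B by (simp add: emeasure_distr emeasure_eq_measure ennreal_mult')
  qed (simp_all add: X.sigma_finite_measure_axioms U.sigma_finite_measure_axioms cong: sets_pair_measure_cong)
qed

text \<open>The exponential martingale in discrete time. With the past frozen, the last factor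
  integrates to 1 by the Gaussian exponential moment, whatever the size of the coefficient; this is
  why no bound on \<theta> is imposed.\<close>

lemma nn_integral_exp_sum:
  assumes \<theta>: "\<And>k. \<theta> k \<in> borel_measurable (G k)"
  defines "E \<equiv> \<lambda>n \<omega>. \<Sum>k<n. \<theta> k \<omega> \<bullet> U k \<omega> - (norm (\<theta> k \<omega>))\<^sup>2 * \<sigma>\<^sup>2 / 2"
  shows "E n \<in> borel_measurable (G n) \<and> (\<integral>\<^sup>+\<omega>. ennreal (exp (E n \<omega>)) \<partial>M) = 1"
proof (induction n)
  case 0
  then show ?case by (simp add: E_def emeasure_space_1)
next
  case (Suc n)
  note \<theta>[measurable] and [measurable] = conjunct1[OF Suc]
  \<comment> \<open>Everything from the past that enters the next exponential, as one variable
    measurable at step \<open>n\<close>.\<close>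
  define X where "X = (\<lambda>\<omega>. (exp (E n \<omega>), \<theta> n \<omega>))"
  define g where "g = (\<lambda>(x, u). ennreal (fst x * exp (snd x \<bullet> u - (norm (snd x :: 'b))\<^sup>2 * \<sigma>\<^sup>2 / 2)))"
  have X: "X \<in> measurable (G n) (borel \<Otimes>\<^sub>M borel)" unfolding X_def by measurable
  have g[measurable]: "g \<in> borel_measurable ((borel \<Otimes>\<^sub>M borel) \<Otimes>\<^sub>M borel)"
    unfolding g_def by measurable
  note XM[measurable] = measurable_G[OF X] and [measurable] = increment_measurable_M[of n]
  interpret U: prob_space "distr M borel (U n)" by (rule prob_space_distr) measurable
  have "(\<integral>\<^sup>+\<omega>. ennreal (exp (E (Suc n) \<omega>)) \<partial>M) = (\<integral>\<^sup>+\<omega>. g (X \<omega>, U n \<omega>) \<partial>M)"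
    by (simp add: E_def X_def g_def exp_add)
  also have "\<dots> = integral\<^sup>N (distr M ((borel \<Otimes>\<^sub>M borel) \<Otimes>\<^sub>M borel) (\<lambda>\<omega>. (X \<omega>, U n \<omega>))) g"
    by (rule nn_integral_distr[symmetric]) measurable
  also have "\<dots> = integral\<^sup>N (distr M (borel \<Otimes>\<^sub>M borel) X \<Otimes>\<^sub>M distr M borel (U n)) g"
    unfolding distr_increment[OF X] ..
  also have "\<dots> = (\<integral>\<^sup>+x. \<integral>\<^sup>+u. g (x, u) \<partial>distr M borel (U n) \<partial>distr M (borel \<Otimes>\<^sub>M borel) X)"
    by (rule U.nn_integral_fst[symmetric]) (simp cong: measurable_cong_sets)
  also have "\<dots> = (\<integral>\<^sup>+\<omega>. \<integral>\<^sup>+\<omega>'. g (X \<omega>, U n \<omega>') \<partial>M \<partial>M)"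
  proof -
    have "(\<lambda>x. \<integral>\<^sup>+u. g (x, u) \<partial>distr M borel (U n)) \<in> borel_measurable (borel \<Otimes>\<^sub>M borel)"
      by (rule U.borel_measurable_nn_integral_fst) (simp cong: measurable_cong_sets)
    moreover have "(\<integral>\<^sup>+u. g (x, u) \<partial>distr M borel (U n)) = (\<integral>\<^sup>+\<omega>'. g (x, U n \<omega>') \<partial>M)" for x
      by (rule nn_integral_distr) (auto intro!: measurable_compose[OF measurable_Pair1' g] simp: space_pair_measure)
    ultimately show ?thesis by (simp add: nn_integral_distr)
  qed
  also have "\<dots> = (\<integral>\<^sup>+\<omega>. ennreal (exp (E n \<omega>)) \<partial>M)"
  proof (rule nn_integral_cong)
    fix \<omega>
    have "(\<integral>\<^sup>+\<omega>'. g (X \<omega>, U n \<omega>') \<partial>M) = (\<integral>\<^sup>+\<omega>'. ennreal (exp (E n \<omega>)) *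
        ennreal (exp (\<theta> n \<omega> \<bullet> U n \<omega>' - (norm (\<theta> n \<omega>))\<^sup>2 * \<sigma>\<^sup>2 / 2)) \<partial>M)"
      by (simp add: g_def X_def ennreal_mult')
    also have "\<dots> = ennreal (exp (E n \<omega>))"
      by (subst nn_integral_cmult) (measurable, simp add: gaussian_exp_moment[OF gaussian_increment \<sigma>_pos])
    finally show "(\<integral>\<^sup>+\<omega>'. g (X \<omega>, U n \<omega>') \<partial>M) = ennreal (exp (E n \<omega>))" .
  qed
  also have "\<dots> = 1" using Suc by simp
  finally have 1: "(\<integral>\<^sup>+\<omega>. ennreal (exp (E (Suc n) \<omega>)) \<partial>M) = 1" .
  have "E (Suc n) = (\<lambda>\<omega>. E n \<omega> + (\<theta> n \<omega> \<bullet> U n \<omega> - (norm (\<theta> n \<omega>))\<^sup>2 * \<sigma>\<^sup>2 / 2))"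
    by (simp add: E_def)
  moreover note measurable_G_Suc[OF \<theta>, measurable] measurable_G_Suc[OF conjunct1[OF Suc], measurable]
    increment_measurable[measurable]
  ultimately show ?case using 1 by simp
qed

text \<open>Markov's inequality for the exponential, whose expectation is 1.\<close>

lemma prob_exp_sum_ge:
  assumes \<theta>: "\<And>k. \<theta> k \<in> borel_measurable (G k)"
  shows "prob {\<omega>\<in>space M. \<eta> \<le> (\<Sum>k<n. \<theta> k \<omega> \<bullet> U k \<omega> - (norm (\<theta> k \<omega>))\<^sup>2 * \<sigma>\<^sup>2 / 2)} \<le> exp (- \<eta>)"
proof -
  define E where "E = (\<lambda>\<omega>. \<Sum>k<n. \<theta> k \<omega> \<bullet> U k \<omega> - (norm (\<theta> k \<omega>))\<^sup>2 * \<sigma>\<^sup>2 / 2)"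
  have E: "E \<in> borel_measurable M" "(\<integral>\<^sup>+\<omega>. ennreal (exp (E \<omega>)) \<partial>M) = 1"
    using nn_integral_exp_sum[OF \<theta>, of n] measurable_G unfolding E_def by auto
  note [measurable] = E(1)
  have "emeasure M {\<omega>\<in>space M. 1 \<le> ennreal (exp (- \<eta>)) * ennreal (exp (E \<omega>))}
      \<le> ennreal (exp (- \<eta>)) * (\<integral>\<^sup>+\<omega>. ennreal (exp (E \<omega>)) * indicator (space M) \<omega> \<partial>M)"
    using nn_integral_Markov_inequality[of "\<lambda>\<omega>. ennreal (exp (E \<omega>))" "space M" M "ennreal (exp (- \<eta>))"]
    by simp
  also have "\<dots> = ennreal (exp (- \<eta>))"
    using E(2) by (simp cong: nn_integral_cong)
  also have "{\<omega>\<in>space M. 1 \<le> ennreal (exp (- \<eta>)) * ennreal (exp (E \<omega>))} = {\<omega>\<in>space M. \<eta> \<le> E \<omega>}"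
    by (simp flip: ennreal_mult' ennreal_1 exp_add)
  finally show ?thesis unfolding E_def by (simp add: emeasure_eq_measure)
qed

text \<open>Orthogonality of martingale increments: the new fluctuation is centred and independent
  of the past, so second moments add up. The bound is linear in \<open>n\<close>, whereas \<sigma>
  to the fourth is of order \<open>1 / n^2\<close> on a partition into \<open>n\<close> steps; hence
  the error disappears in the limit.\<close>

lemma expectation_fluctuation_sum_sq:
  assumes g: "\<And>k. g k \<in> borel_measurable (G k)" and C: "\<And>k. AE \<omega> in M. \<bar>g k \<omega>\<bar> \<le> C"
    and i: "i \<in> Basis" and j: "j \<in> Basis"
  defines "\<xi> \<equiv> \<lambda>k \<omega>. (U k \<omega> \<bullet> i) * (U k \<omega> \<bullet> j) - (if i = j then \<sigma>\<^sup>2 else 0)"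
  defines "S \<equiv> \<lambda>n \<omega>. \<Sum>k<n. g k \<omega> * \<xi> k \<omega>"
  shows "S n \<in> borel_measurable (G n) \<and> integrable M (\<lambda>\<omega>. (S n \<omega>)\<^sup>2) \<and>
    expectation (\<lambda>\<omega>. (S n \<omega>)\<^sup>2) \<le> real n * (C\<^sup>2 * (8 * \<sigma> ^ 4))"
proof (induction n)
  case 0
  then show ?case by (simp add: S_def)
next
  case (Suc n)
  note fl = integrable_gaussian_fluctuation[OF gaussian_increment[of n] \<sigma>_pos i j]
    expectation_gaussian_fluctuation[OF gaussian_increment[of n] \<sigma>_pos i j]
    integrable_gaussian_fluctuation_sq[OF gaussian_increment[of n] \<sigma>_pos i j]
    expectation_gaussian_fluctuation_sq[OF gaussian_increment[of n] \<sigma>_pos i j]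
  have fl: "integrable M (\<xi> n)" "expectation (\<xi> n) = 0"
    "integrable M (\<lambda>\<omega>. (\<xi> n \<omega>)\<^sup>2)" "expectation (\<lambda>\<omega>. (\<xi> n \<omega>)\<^sup>2) \<le> 8 * \<sigma> ^ 4"
    using fl unfolding \<xi>_def by simp_all
  have "AE \<omega> in M. 0 \<le> C" using C[of 0] by eventually_elim simp
  then have C0: "0 \<le> C" by simp
  have xi[measurable]: "\<xi> n \<in> borel_measurable (G (Suc n))"
    unfolding \<xi>_def using increment_measurable[of n] by measurable
  have Seq: "S (Suc n) = (\<lambda>\<omega>. S n \<omega> + g n \<omega> * \<xi> n \<omega>)" by (simp add: S_def)
  have meas: "S (Suc n) \<in> borel_measurable (G (Suc n))"
    unfolding Seq using measurable_G_Suc[OF g[of n]] measurable_G_Suc[OF conjunct1[OF Suc]] by measurable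
  have S2: "integrable M (\<lambda>\<omega>. (S n \<omega>)\<^sup>2)" using Suc by blast
  have [measurable]: "S n \<in> borel_measurable M" "g n \<in> borel_measurable M" "\<xi> n \<in> borel_measurable M"
    using Suc g xi measurable_G by blast+
  have S1: "integrable M (S n)"
    by (rule square_integrable_imp_integrable) (use S2 in auto)
  have Sg: "integrable M (\<lambda>\<omega>. S n \<omega> * g n \<omega>)"
    by (rule Bochner_Integration.integrable_bound[of M "\<lambda>\<omega>. C * S n \<omega>"])
       (use S1 C[of n] C0 in \<open>auto simp: abs_mult mult.commute[of C] intro!: mult_left_mono elim!: eventually_mono\<close>)
  have g2xi: "integrable M (\<lambda>\<omega>. (g n \<omega> * \<xi> n \<omega>)\<^sup>2)"
    and g2: "AE \<omega> in M. (g n \<omega> * \<xi> n \<omega>)\<^sup>2 \<le> C\<^sup>2 * (\<xi> n \<omega>)\<^sup>2"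
  proof -
    show *: "AE \<omega> in M. (g n \<omega> * \<xi> n \<omega>)\<^sup>2 \<le> C\<^sup>2 * (\<xi> n \<omega>)\<^sup>2"
      using C[of n] by eventually_elim
        (auto simp: power_mult_distrib abs_le_square_iff[symmetric] C0 intro!: mult_right_mono)
    show "integrable M (\<lambda>\<omega>. (g n \<omega> * \<xi> n \<omega>)\<^sup>2)"
      by (rule Bochner_Integration.integrable_bound[of M "\<lambda>\<omega>. C\<^sup>2 * (\<xi> n \<omega>)\<^sup>2"])
         (use fl(3) * in auto)
  qed
  have indep: "indep_var borel (\<lambda>\<omega>. S n \<omega> * g n \<omega>) borel (\<xi> n)"
    unfolding \<xi>_def
  proof (rule indep_var_increment)
    show "(\<lambda>\<omega>. S n \<omega> * g n \<omega>) \<in> borel_measurable (G n)"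
      using Suc g[of n] by (intro borel_measurable_times) auto
  qed measurable
  \<comment> \<open>Independence factors the expectation, and the factor of the fluctuation is
    zero.\<close>
  have cross: "integrable M (\<lambda>\<omega>. S n \<omega> * g n \<omega> * \<xi> n \<omega>)" "expectation (\<lambda>\<omega>. S n \<omega> * g n \<omega> * \<xi> n \<omega>) = 0"
    using indep_var_integrable[OF indep Sg fl(1)] indep_var_lebesgue_integral[OF indep Sg fl(1)] fl(2) by auto
  have exp: "(S (Suc n) \<omega>)\<^sup>2 = (S n \<omega>)\<^sup>2 + 2 * (S n \<omega> * g n \<omega> * \<xi> n \<omega>) + (g n \<omega> * \<xi> n \<omega>)\<^sup>2" for \<omega>
    by (simp add: Seq power2_sum algebra_simps)
  have int: "integrable M (\<lambda>\<omega>. (S (Suc n) \<omega>)\<^sup>2)"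
    unfolding exp using S2 cross(1) g2xi by auto
  have "expectation (\<lambda>\<omega>. (S (Suc n) \<omega>)\<^sup>2) = expectation (\<lambda>\<omega>. (S n \<omega>)\<^sup>2) + expectation (\<lambda>\<omega>. (g n \<omega> * \<xi> n \<omega>)\<^sup>2)"
    unfolding exp using S2 cross g2xi by simp
  also have "expectation (\<lambda>\<omega>. (g n \<omega> * \<xi> n \<omega>)\<^sup>2) \<le> expectation (\<lambda>\<omega>. C\<^sup>2 * (\<xi> n \<omega>)\<^sup>2)"
    by (intro integral_mono_AE g2xi g2) (use fl(3) in auto)
  also have "\<dots> \<le> C\<^sup>2 * (8 * \<sigma> ^ 4)"
    using fl(4) by (simp add: mult_left_mono)
  finally have "expectation (\<lambda>\<omega>. (S (Suc n) \<omega>)\<^sup>2) \<le> real (Suc n) * (C\<^sup>2 * (8 * \<sigma> ^ 4))"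
    using Suc by (simp add: algebra_simps)
  with meas int show ?case by blast
qed

text \<open>Chebyshev for the sum over all index pairs. The square of the dimension enters twice:
  from Cauchy-Schwarz over the pairs and from the number of pairs.\<close>

lemma prob_quadratic_fluctuation_ge:
  assumes g: "\<And>k i j. i \<in> Basis \<Longrightarrow> j \<in> Basis \<Longrightarrow> g k i j \<in> borel_measurable (G k)"
    and C: "\<And>k i j. i \<in> Basis \<Longrightarrow> j \<in> Basis \<Longrightarrow> AE \<omega> in M. \<bar>g k i j \<omega>\<bar> \<le> C"
    and \<epsilon>: "\<epsilon> > 0"
  shows "prob {\<omega>\<in>space M. \<epsilon> \<le> (\<Sum>k<n. \<Sum>i\<in>Basis. \<Sum>j\<in>Basis.
      g k i j \<omega> * ((U k \<omega> \<bullet> i) * (U k \<omega> \<bullet> j) - (if i = j then \<sigma>\<^sup>2 else 0)))}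
    \<le> real DIM('b) ^ 4 * real n * (C\<^sup>2 * (8 * \<sigma> ^ 4)) / \<epsilon>\<^sup>2"
proof -
  define S where "S = (\<lambda>p \<omega>. \<Sum>k<n. g k (fst p) (snd p) \<omega> *
    ((U k \<omega> \<bullet> fst p) * (U k \<omega> \<bullet> snd p) - (if fst p = snd p then \<sigma>\<^sup>2 else 0)))"
  define D where "D = (Basis :: 'b set) \<times> (Basis :: 'b set)"
  have S: "S p \<in> borel_measurable M" "integrable M (\<lambda>\<omega>. (S p \<omega>)\<^sup>2)"
    "expectation (\<lambda>\<omega>. (S p \<omega>)\<^sup>2) \<le> real n * (C\<^sup>2 * (8 * \<sigma> ^ 4))" if "p \<in> D" for p
    using expectation_fluctuation_sum_sq[of "\<lambda>k. g k (fst p) (snd p)" C "fst p" "snd p" n]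
      g C that measurable_G unfolding S_def D_def by auto
  have sum: "(\<Sum>k<n. \<Sum>i\<in>Basis. \<Sum>j\<in>Basis.
      g k i j \<omega> * ((U k \<omega> \<bullet> i) * (U k \<omega> \<bullet> j) - (if i = j then \<sigma>\<^sup>2 else 0))) = (\<Sum>p\<in>D. S p \<omega>)" for \<omega>
    unfolding S_def D_def by (subst sum.swap) (simp add: sum.cartesian_product split_beta)
  have sq: "(\<Sum>p\<in>D. S p \<omega>)\<^sup>2 \<le> real (card D) * (\<Sum>p\<in>D. (S p \<omega>)\<^sup>2)" for \<omega>
    using Cauchy_Schwarz_ineq_sum[of "\<lambda>_. 1" "\<lambda>p. S p \<omega>" D] by simp
  have card: "real (card D) = real DIM('b) ^ 2"
    by (simp add: D_def card_cartesian_product power2_eq_square)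
  have [measurable]: "(\<lambda>\<omega>. \<Sum>p\<in>D. S p \<omega>) \<in> borel_measurable M" using S(1) by measurable
  have int: "integrable M (\<lambda>\<omega>. real (card D) * (\<Sum>p\<in>D. (S p \<omega>)\<^sup>2))"
    using S(2) by auto
  have int2: "integrable M (\<lambda>\<omega>. (\<Sum>p\<in>D. S p \<omega>)\<^sup>2)"
    by (rule Bochner_Integration.integrable_bound[OF int]) (use sq in \<open>auto intro!: AE_I2 intro: order_trans[OF _ abs_ge_self]\<close>)
  have "expectation (\<lambda>\<omega>. (\<Sum>p\<in>D. S p \<omega>)\<^sup>2) \<le> expectation (\<lambda>\<omega>. real (card D) * (\<Sum>p\<in>D. (S p \<omega>)\<^sup>2))"
    by (intro integral_mono int int2 sq)
  also have "\<dots> = real (card D) * (\<Sum>p\<in>D. expectation (\<lambda>\<omega>. (S p \<omega>)\<^sup>2))"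
    using S(2) by (simp add: Bochner_Integration.integral_sum)
  also have "\<dots> \<le> real (card D) * (\<Sum>p\<in>D. real n * (C\<^sup>2 * (8 * \<sigma> ^ 4)))"
    by (intro mult_left_mono sum_mono S(3)) auto
  also have "\<dots> = real DIM('b) ^ 4 * real n * (C\<^sup>2 * (8 * \<sigma> ^ 4))"
    by (simp add: card power2_eq_square power4_eq_xxxx)
  finally have E: "expectation (\<lambda>\<omega>. (\<Sum>p\<in>D. S p \<omega>)\<^sup>2) \<le> real DIM('b) ^ 4 * real n * (C\<^sup>2 * (8 * \<sigma> ^ 4))" .
  have "prob {\<omega>\<in>space M. \<epsilon> \<le> (\<Sum>p\<in>D. S p \<omega>)} \<le> prob {\<omega>\<in>space M. \<epsilon>\<^sup>2 \<le> (\<Sum>p\<in>D. S p \<omega>)\<^sup>2}"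
    by (rule finite_measure_mono) (use \<epsilon> in \<open>auto intro: power_mono\<close>)
  also have "\<dots> \<le> expectation (\<lambda>\<omega>. (\<Sum>p\<in>D. S p \<omega>)\<^sup>2) / \<epsilon>\<^sup>2"
    by (rule integral_Markov_inequality_measure[OF int2, of "{}"]) (use \<epsilon> in auto)
  also have "\<dots> \<le> real DIM('b) ^ 4 * real n * (C\<^sup>2 * (8 * \<sigma> ^ 4)) / \<epsilon>\<^sup>2"
    by (intro divide_right_mono E) auto
  finally show ?thesis unfolding sum .
qed

end

section \<open>Limits along partitions\<close>

text \<open>The filter of short subintervals of \<open>[0, t]\<close>. Convergence along it is
  uniform in the position of the interval, and \<open>Zfun\<close> of a quotient by
  \<open>s' - s\<close> expresses a uniform \<open>o(s' - s)\<close>; products of vanishing and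
  bounded terms then replace explicit estimates.\<close>

definition mesh :: "real \<Rightarrow> (real \<times> real) filter" where
  "mesh t = (INF d\<in>{0<..}. principal {(s, s'). 0 \<le> s \<and> s < s' \<and> s' \<le> t \<and> s' - s < d})"

lemma eventually_mesh:
  "eventually P (mesh t) \<longleftrightarrow> (\<exists>d>0. \<forall>s s'. 0 \<le> s \<and> s < s' \<and> s' \<le> t \<and> s' - s < d \<longrightarrow> P (s, s'))"
  unfolding mesh_def
proof (subst eventually_INF_base)
  show "\<exists>x\<in>{0<..}. principal {(s, s'). 0 \<le> s \<and> s < s' \<and> s' \<le> t \<and> s' - s < x}
      \<le> inf (principal {(s, s'). 0 \<le> s \<and> s < s' \<and> s' \<le> t \<and> s' - s < a})
          (principal {(s, s'). 0 \<le> s \<and> s < s' \<and> s' \<le> t \<and> s' - s < b})"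
    if "a \<in> {0<..}" "b \<in> {0<..}" for a b :: real
    using that by (intro bexI[of _ "min a b"]) auto
qed (auto simp: eventually_principal)

lemma eventually_meshI:
  assumes "\<And>s s'. 0 \<le> s \<Longrightarrow> s < s' \<Longrightarrow> s' \<le> t \<Longrightarrow> P (s, s')"
  shows "eventually P (mesh t)"
  unfolding eventually_mesh using assms by (intro exI[of _ 1]) auto

lemma Zfun_mesh_increment:
  fixes f :: "real \<Rightarrow> 'a::real_normed_vector"
  assumes "continuous_on {0..t} f"
  shows "Zfun (\<lambda>(s, s'). f s' - f s) (mesh t)"
proof (rule ZfunI)
  fix r :: real assume "r > 0"
  have "uniformly_continuous_on {0..t} f"
    using assms by (intro compact_uniformly_continuous) auto
  then obtain d where d: "d > 0"
    "\<And>x x'. x \<in> {0..t} \<Longrightarrow> x' \<in> {0..t} \<Longrightarrow> dist x' x < d \<Longrightarrow> dist (f x') (f x) < r"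
    using \<open>r > 0\<close> unfolding uniformly_continuous_on_def by metis
  show "eventually (\<lambda>x. norm (case x of (s, s') \<Rightarrow> f s' - f s) < r) (mesh t)"
    unfolding eventually_mesh
  proof (intro exI[of _ d] conjI d(1) allI impI)
    fix s s' assume "0 \<le> s \<and> s < s' \<and> s' \<le> t \<and> s' - s < d"
    then show "norm (case (s, s') of (s, s') \<Rightarrow> f s' - f s) < r"
      using d(2)[of s s'] by (simp add: dist_norm)
  qed
qed

lemma
  fixes f :: "real \<Rightarrow> 'a::real_normed_vector"
  assumes "continuous_on {0..t} f"
  shows Bfun_mesh_left: "Bfun (\<lambda>(s, s'). f s) (mesh t)"
    and Bfun_mesh_right: "Bfun (\<lambda>(s, s'). f s') (mesh t)"
proof -
  have "bounded (f ` {0..t})"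
    using assms by (intro compact_imp_bounded compact_continuous_image) auto
  then obtain K where K: "\<And>s. s \<in> {0..t} \<Longrightarrow> norm (f s) \<le> K"
    unfolding bounded_iff by blast
  show "Bfun (\<lambda>(s, s'). f s) (mesh t)" "Bfun (\<lambda>(s, s'). f s') (mesh t)"
    by (rule BfunI[of _ K], rule eventually_meshI, use K in auto)+
qed

text \<open>The mean value inequality, together with uniform continuity of the derivative, makes the
  convergence of difference quotients uniform.\<close>

lemma Zfun_mesh_derivative:
  fixes f :: "real \<Rightarrow> 'a::banach"
  assumes f: "\<And>s. s \<in> {0..t} \<Longrightarrow> (f has_vector_derivative f' s) (at s within {0..t})"
    and f': "continuous_on {0..t} f'"
  shows "Zfun (\<lambda>(s, s'). (1 / (s' - s)) *\<^sub>R (f s' - f s) - f' s) (mesh t)"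
proof (rule ZfunI)
  fix r :: real assume "r > 0"
  have "eventually (\<lambda>(s, s'). norm (f' s' - f' s) < r / 2) (mesh t)"
    using ZfunD[OF Zfun_mesh_increment[OF f'], of "r / 2"] \<open>r > 0\<close> by (simp add: case_prod_unfold)
  then obtain d where d: "d > 0"
    "\<And>s s'. 0 \<le> s \<Longrightarrow> s < s' \<Longrightarrow> s' \<le> t \<Longrightarrow> s' - s < d \<Longrightarrow> norm (f' s' - f' s) < r / 2"
    unfolding eventually_mesh by auto
  show "eventually (\<lambda>x. norm (case x of (s, s') \<Rightarrow> (1 / (s' - s)) *\<^sub>R (f s' - f s) - f' s) < r) (mesh t)"
    unfolding eventually_mesh
  proof (intro exI[of _ d] conjI d(1) allI impI)
    fix s s' assume s: "0 \<le> s \<and> s < s' \<and> s' \<le> t \<and> s' - s < d"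
    have "norm (f s' - f s - (s' - s) *\<^sub>R f' s) \<le> norm (s' - s) * (r / 2)"
    proof (rule vector_differentiable_bound_linearization)
      show "(f has_vector_derivative f' u) (at u within {s..s'})" if "u \<in> {s..s'}" for u
        using that s by (intro has_vector_derivative_within_subset[OF f]) auto
      show "norm (f' u - f' s) \<le> r / 2" if "u \<in> {s..s'}" for u
        using d(2)[of s u] that s \<open>r > 0\<close> by (cases "u = s") auto
    qed (use s in \<open>auto simp: closed_segment_eq_real_ivl\<close>)
    then have "norm ((s' - s) *\<^sub>R ((1 / (s' - s)) *\<^sub>R (f s' - f s) - f' s)) \<le> (s' - s) * (r / 2)"
      using s by (simp add: algebra_simps)
    then have "norm ((1 / (s' - s)) *\<^sub>R (f s' - f s) - f' s) \<le> r / 2"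
      using s by simp
    then show "norm (case (s, s') of (s, s') \<Rightarrow> (1 / (s' - s)) *\<^sub>R (f s' - f s) - f' s) < r"
      using \<open>r > 0\<close> by simp
  qed
qed


text \<open>Equidistant points give all Brownian increments the same variance. Using
  \<open>Suc n\<close> intervals avoids division by zero at the first index.\<close>

lemma partition_sums:
  fixes t :: real
  assumes t: "t > 0"
  defines "\<tau> \<equiv> \<lambda>n k. t * real k / real (Suc n)"
  shows "partition_sequence t Suc \<tau>"
    and "eventually P (mesh t) \<Longrightarrow> eventually (\<lambda>n. \<forall>k<Suc n. P (\<tau> n k, \<tau> n (Suc k))) sequentially"
proof -
  have step: "\<tau> n (Suc k) - \<tau> n k = t / real (Suc n)" for n k
    unfolding \<tau>_def diff_divide_distrib[symmetric] right_diff_distrib[symmetric] by simp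
  have small: "eventually (\<lambda>n. t / real (Suc n) < d) sequentially" if "d > 0" for d
  proof -
    have "(\<lambda>n. t / real (Suc n)) \<longlonglongrightarrow> 0"
      using LIMSEQ_ignore_initial_segment[OF lim_const_over_n[of t], of 1] by simp
    then show ?thesis using that by (rule order_tendstoD)
  qed
  have less: "\<tau> n k < \<tau> n (Suc k)" for n k
    using step[of n k] t by (smt (verit) divide_pos_pos of_nat_0_less_iff zero_less_Suc)
  show "partition_sequence t Suc \<tau>"
    unfolding partition_sequence_def step
  proof (intro conjI allI impI)
    fix \<epsilon> :: real assume "\<epsilon> > 0"
    then show "eventually (\<lambda>n. \<forall>k<Suc n. t / real (Suc n) < \<epsilon>) sequentially"
      using small[of \<epsilon>] by (auto elim: eventually_mono)
  qed (use less in \<open>simp_all add: \<tau>_def less_imp_le del: of_nat_Suc\<close>)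
  assume "eventually P (mesh t)"
  then obtain d where d: "d > 0" "\<And>s s'. 0 \<le> s \<Longrightarrow> s < s' \<Longrightarrow> s' \<le> t \<Longrightarrow> s' - s < d \<Longrightarrow> P (s, s')"
    unfolding eventually_mesh by auto
  show "eventually (\<lambda>n. \<forall>k<Suc n. P (\<tau> n k, \<tau> n (Suc k))) sequentially"
    using small[OF d(1)]
  proof eventually_elim
    case (elim n)
    show ?case
    proof (intro allI impI d(2) less)
      fix k assume "k < Suc n"
      then show "\<tau> n (Suc k) \<le> t" using t by (simp add: \<tau>_def divide_le_eq)
      show "0 \<le> \<tau> n k" using t by (simp add: \<tau>_def)
      show "\<tau> n (Suc k) - \<tau> n k < d" using elim by (simp add: step)
    qed
  qed
qed

text \<open>The increments of \<open>F\<close> telescope, and local errors proportional to the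
  length of the interval add up to a multiple of \<open>t\<close>; hence the choice
  \<open>\<epsilon> / t\<close> for the local error.\<close>

lemma partition_sum_le:
  fixes F :: "real \<Rightarrow> real" and f :: "real \<Rightarrow> real \<Rightarrow> real"
  assumes t: "t > 0" and \<epsilon>: "\<epsilon> > 0"
    and step: "\<And>\<epsilon>. \<epsilon> > 0 \<Longrightarrow> eventually (\<lambda>(s, s'). f s s' \<le> F s' - F s + \<epsilon> * (s' - s)) (mesh t)"
  shows "eventually (\<lambda>n. (\<Sum>k<Suc n. f (t * real k / real (Suc n)) (t * real (Suc k) / real (Suc n)))
    \<le> F t - F 0 + \<epsilon>) sequentially"
proof -
  define \<tau> where "\<tau> = (\<lambda>n k. t * real k / real (Suc n))"
  have "eventually (\<lambda>n. \<forall>k<Suc n. f (\<tau> n k) (\<tau> n (Suc k)) \<le>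
      F (\<tau> n (Suc k)) - F (\<tau> n k) + (\<epsilon> / t) * (\<tau> n (Suc k) - \<tau> n k)) sequentially"
    using partition_sums(2)[OF t step[of "\<epsilon> / t"]] t \<epsilon> by (simp add: \<tau>_def)
  then have "eventually (\<lambda>n. (\<Sum>k<Suc n. f (\<tau> n k) (\<tau> n (Suc k))) \<le> F t - F 0 + \<epsilon>) sequentially"
  proof eventually_elim
    case (elim n)
    have "(\<Sum>k<Suc n. f (\<tau> n k) (\<tau> n (Suc k))) \<le>
        (\<Sum>k<Suc n. (F (\<tau> n (Suc k)) + \<epsilon> / t * \<tau> n (Suc k)) - (F (\<tau> n k) + \<epsilon> / t * \<tau> n k))"
      by (rule sum_mono) (use elim in \<open>auto simp: algebra_simps\<close>)
    also have "\<dots> = F (\<tau> n (Suc n)) + \<epsilon> / t * \<tau> n (Suc n) - (F (\<tau> n 0) + \<epsilon> / t * \<tau> n 0)"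
      by (rule sum_lessThan_telescope)
    also have "\<dots> = F t - F 0 + \<epsilon>"
      using t unfolding \<tau>_def by (simp del: of_nat_Suc)
    finally show ?case .
  qed
  then show ?thesis by (simp only: \<tau>_def)
qed

lemma partition_sum_tendsto:
  fixes F :: "real \<Rightarrow> 'a::real_normed_vector" and f :: "real \<Rightarrow> real \<Rightarrow> 'a"
  assumes t: "t > 0"
    and step: "Zfun (\<lambda>(s, s'). (1 / (s' - s)) *\<^sub>R (F s' - F s - f s s')) (mesh t)"
  shows "(\<lambda>n. \<Sum>k<Suc n. f (t * real k / real (Suc n)) (t * real (Suc k) / real (Suc n)))
    \<longlonglongrightarrow> F t - F 0"
proof (rule tendstoI)
  fix \<epsilon> :: real assume \<epsilon>: "\<epsilon> > 0"
  have ev: "eventually (\<lambda>(s, s'). norm (F s' - F s - f s s') \<le> 0 - 0 + \<epsilon> * (s' - s)) (mesh t)" if "\<epsilon> > 0" for \<epsilon>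
  proof -
    have "eventually (\<lambda>(s, s'). s < s') (mesh t)" by (rule eventually_meshI) simp
    with ZfunD[OF step that] show ?thesis
      by eventually_elim (auto simp: divide_less_eq mult.commute)
  qed
  have "eventually (\<lambda>n. (\<Sum>k<Suc n. norm (F (t * real (Suc k) / real (Suc n)) - F (t * real k / real (Suc n)) -
      f (t * real k / real (Suc n)) (t * real (Suc k) / real (Suc n)))) \<le> 0 - 0 + \<epsilon> / 2) sequentially"
    \<comment> \<open>The norm of the local error is summed, with the zero function in the role of
      \<open>F\<close>.\<close>
    by (rule partition_sum_le[of t "\<epsilon> / 2" "\<lambda>s s'. norm (F s' - F s - f s s')" "\<lambda>_. 0", OF t _ ev]) (use \<epsilon> in auto)
  then show "eventually (\<lambda>n. dist (\<Sum>k<Suc n. f (t * real k / real (Suc n)) (t * real (Suc k) / real (Suc n)))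
      (F t - F 0) < \<epsilon>) sequentially"
  proof eventually_elim
    case (elim n)
    define \<tau> where "\<tau> = (\<lambda>k. t * real k / real (Suc n))"
    have "(\<Sum>k<Suc n. F (\<tau> (Suc k)) - F (\<tau> k)) = F (\<tau> (Suc n)) - F (\<tau> 0)"
      by (rule sum_lessThan_telescope)
    also have "\<dots> = F t - F 0"
      unfolding \<tau>_def by (simp del: of_nat_Suc)
    finally have "F t - F 0 - (\<Sum>k<Suc n. f (\<tau> k) (\<tau> (Suc k))) =
        (\<Sum>k<Suc n. F (\<tau> (Suc k)) - F (\<tau> k) - f (\<tau> k) (\<tau> (Suc k)))"
      unfolding sum_subtractf by (metis (no_types))
    also have "norm \<dots> \<le> \<epsilon> / 2"
      by (rule order_trans[OF norm_sum]) (use elim in \<open>simp only: \<tau>_def diff_0_right add_0\<close>)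
    finally show ?case using \<epsilon> unfolding \<tau>_def by (subst dist_commute) (simp add: dist_norm)
  qed
qed

text \<open>\<open>J\<close> is the primitive of \<open>H dy\<close> obtained by integrating by
  parts. Its increment minus the left-point term \<open>H s *v (y s' - y s)\<close> equals
  \<open>(H s' - H s) *v y s'\<close> minus the integral of \<open>D *v y\<close>, and both are
  \<open>D s *v y s\<close> times the length up to \<open>o(s' - s)\<close>. Continuity of
  \<open>y\<close> is enough, so paths of infinite variation are covered.\<close>

lemma Zfun_mesh_by_parts:
  fixes H :: "real \<Rightarrow> real^'n^'m" and y :: "real \<Rightarrow> real^'n"
  assumes H: "\<And>s. s \<in> {0..t} \<Longrightarrow> (H has_vector_derivative D s) (at s within {0..t})"
    and D: "continuous_on {0..t} D" and y: "continuous_on {0..t} y"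
  defines "J \<equiv> \<lambda>s. H s *v y s - integral {0..s} (\<lambda>r. D r *v y r)"
  shows "Zfun (\<lambda>(s, s'). (1 / (s' - s)) *\<^sub>R (J s' - J s - H s *v (y s' - y s))) (mesh t)"
proof -
  interpret mv: bounded_bilinear "(*v) :: real^'n^'m \<Rightarrow> real^'n \<Rightarrow> real^'m"
    by (rule bounded_bilinear_matrix_vector_mult)
  have Dy: "continuous_on {0..t} (\<lambda>r. D r *v y r)"
    by (intro mv.continuous_on D y)
  have "((\<lambda>s. integral {0..s} (\<lambda>r. D r *v y r)) has_vector_derivative D s *v y s) (at s within {0..t})"
    if "s \<in> {0..t}" for s
    by (rule integral_has_vector_derivative[OF Dy that])
  then have Z1: "Zfun (\<lambda>(s, s'). (1 / (s' - s)) *\<^sub>R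
      (integral {0..s'} (\<lambda>r. D r *v y r) - integral {0..s} (\<lambda>r. D r *v y r)) - D s *v y s) (mesh t)"
    by (intro Zfun_mesh_derivative Dy)
  have Z2: "Zfun (\<lambda>(s, s'). ((1 / (s' - s)) *\<^sub>R (H s' - H s) - D s) *v y s') (mesh t)"
    using mv.Zfun_prod_Bfun[OF Zfun_mesh_derivative[OF H D] Bfun_mesh_right[OF y]]
    by (simp add: case_prod_unfold)
  have Z3: "Zfun (\<lambda>(s, s'). D s *v (y s' - y s)) (mesh t)"
    using mv.Bfun_prod_Zfun[OF Bfun_mesh_left[OF D] Zfun_mesh_increment[OF y]]
    by (simp add: case_prod_unfold)
  have "(1 / (s' - s)) *\<^sub>R (J s' - J s - H s *v (y s' - y s)) =
      ((1 / (s' - s)) *\<^sub>R (H s' - H s) - D s) *v y s' + D s *v (y s' - y s) -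
      ((1 / (s' - s)) *\<^sub>R (integral {0..s'} (\<lambda>r. D r *v y r) - integral {0..s} (\<lambda>r. D r *v y r)) - D s *v y s)"
    for s s'
    by (simp add: J_def mv.diff_left mv.diff_right mv.scaleR_left algebra_simps)
  then show ?thesis
    using Zfun_diff[OF Zfun_add[OF Z2 Z3] Z1] by (simp add: case_prod_unfold)
qed

text \<open>One step of Ito's formula. The remainder \<open>z s' - z s - g s s'\<close> is of the
  order of the step and is approximately \<open>b s\<close> times it. The increment \<open>g\<close>
  is not of that order, so its linear and square terms are kept exactly and everything else goes
  into the drift, controlled by \<open>main\<close>. Subtracting \<open>\<kappa> s\<close> times the
  step centres the square; subtracting \<open>2 * (c s)\<^sup>2 * m s\<close> times the step
  compensates the exponential of the linear term.\<close>

lemma quadratic_step: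
  fixes z b :: "real \<Rightarrow> 'a::euclidean_space" and g :: "real \<Rightarrow> real \<Rightarrow> 'a" and c c' L L' \<kappa> m :: "real \<Rightarrow> real"
  assumes z: "continuous_on {0..t} z" and b: "continuous_on {0..t} b"
    and c: "\<And>s. s \<in> {0..t} \<Longrightarrow> (c has_vector_derivative c' s) (at s within {0..t})"
    and L: "\<And>s. s \<in> {0..t} \<Longrightarrow> (L has_vector_derivative L' s) (at s within {0..t})"
    and c': "continuous_on {0..t} c'" and L': "continuous_on {0..t} L'"
    and g: "Zfun (\<lambda>(s, s'). g s s') (mesh t)"
    and zg: "Zfun (\<lambda>(s, s'). (1 / (s' - s)) *\<^sub>R (z s' - z s - g s s') - b s) (mesh t)"
    and main: "\<And>s. s \<in> {0..t} \<Longrightarrow>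
      c' s * (norm (z s))\<^sup>2 + 2 * c s * (z s \<bullet> b s) + c s * \<kappa> s + 2 * (c s)\<^sup>2 * m s \<le> L' s"
    and \<epsilon>: "\<epsilon> > 0"
  shows "eventually (\<lambda>(s, s'). c s' * (norm (z s'))\<^sup>2 - c s * (norm (z s))\<^sup>2 - (2 * c s * (z s \<bullet> g s s')
      - 2 * (c s)\<^sup>2 * m s * (s' - s)) - c s * ((norm (g s s'))\<^sup>2 - \<kappa> s * (s' - s))
    \<le> L s' - L s + \<epsilon> * (s' - s)) (mesh t)"
proof -
  note mult_BZ = bounded_bilinear.Bfun_prod_Zfun[OF bounded_bilinear_mult]
    and mult_ZB = bounded_bilinear.Zfun_prod_Bfun[OF bounded_bilinear_mult]
    and inner_BZ = bounded_bilinear.Bfun_prod_Zfun[OF bounded_bilinear_inner]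
    and inner_ZB = bounded_bilinear.Zfun_prod_Bfun[OF bounded_bilinear_inner]
  have cc: "continuous_on {0..t} c"
    using c by (meson continuous_on_vector_derivative)
  have nz: "continuous_on {0..t} (\<lambda>s. (norm (z s))\<^sup>2)" by (intro continuous_intros z)
  define q where "q = (\<lambda>x. (1 / (snd x - fst x)) *\<^sub>R (z (snd x) - z (fst x) - g (fst x) (snd x)))"
  have q: "Zfun (\<lambda>x. q x - b (fst x)) (mesh t)"
    using zg by (simp add: q_def case_prod_unfold)
  have Bb: "Bfun (\<lambda>x. b (fst x)) (mesh t)" "Bfun (\<lambda>x. c (fst x)) (mesh t)" "Bfun (\<lambda>x. c' (fst x)) (mesh t)"
      "Bfun (\<lambda>x. z (fst x)) (mesh t)" "Bfun (\<lambda>x. (norm (z (snd x)))\<^sup>2) (mesh t)"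
    using Bfun_mesh_left[OF b] Bfun_mesh_left[OF cc] Bfun_mesh_left[OF c'] Bfun_mesh_left[OF z] Bfun_mesh_right[OF nz]
    by (simp_all add: case_prod_unfold)
  have dz: "Zfun (\<lambda>x. z (snd x) - z (fst x)) (mesh t)"
      and dnz: "Zfun (\<lambda>x. (norm (z (snd x)))\<^sup>2 - (norm (z (fst x)))\<^sup>2) (mesh t)"
      and gZ: "Zfun (\<lambda>x. g (fst x) (snd x)) (mesh t)"
      and dc: "Zfun (\<lambda>x. (1 / (snd x - fst x)) * (c (snd x) - c (fst x)) - c' (fst x)) (mesh t)"
      and dL: "Zfun (\<lambda>x. (1 / (snd x - fst x)) * (L (snd x) - L (fst x)) - L' (fst x)) (mesh t)"
    using Zfun_mesh_increment[OF z] Zfun_mesh_increment[OF nz] g Zfun_mesh_derivative[OF c c'] Zfun_mesh_derivative[OF L L']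
    by (simp_all add: case_prod_unfold)
  have eZ: "Zfun (\<lambda>x. z (snd x) - z (fst x) - g (fst x) (snd x)) (mesh t)"
    by (rule Zfun_diff[OF dz gZ])
  \<comment> \<open>The quotient \<open>q\<close> is bounded only through its limit, hence the split
    into \<open>q - b\<close> and \<open>b\<close>.\<close>
  have inner: "Zfun (\<lambda>x. u x \<bullet> q x) (mesh t)" if u: "Zfun u (mesh t)" for u
  proof -
    have "Zfun (\<lambda>x. u x \<bullet> (q x - b (fst x)) + u x \<bullet> b (fst x)) (mesh t)"
      by (rule Zfun_add[OF bounded_bilinear.Zfun[OF bounded_bilinear_inner u q] inner_ZB[OF u Bb(1)]])
    then show ?thesis by (simp add: inner_diff_right)
  qed
  \<comment> \<open>The whole remainder divided by the step, written as a sum of terms each of which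
    vanishes along the mesh.\<close>
  define R where "R = (\<lambda>x. ((1 / (snd x - fst x)) * (c (snd x) - c (fst x)) - c' (fst x)) * (norm (z (snd x)))\<^sup>2
     + c' (fst x) * ((norm (z (snd x)))\<^sup>2 - (norm (z (fst x)))\<^sup>2)
     + c (fst x) * (2 * (z (fst x) \<bullet> (q x - b (fst x))) + 2 * (g (fst x) (snd x) \<bullet> q x)
          + (z (snd x) - z (fst x) - g (fst x) (snd x)) \<bullet> q x)
     - ((1 / (snd x - fst x)) * (L (snd x) - L (fst x)) - L' (fst x)))"
  have "Zfun R (mesh t)"
    unfolding R_def
    by (intro Zfun_add Zfun_diff mult_ZB[OF dc Bb(5)] mult_BZ[OF Bb(3) dnz] mult_BZ[OF Bb(2)] Zfun_mult_right
        inner_BZ[OF Bb(4) q] inner[OF gZ] inner[OF eZ] dL)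
  then have "eventually (\<lambda>x. norm (R x) < \<epsilon>) (mesh t)" using \<epsilon> by (rule ZfunD)
  moreover have "eventually (\<lambda>(s, s'). 0 \<le> s \<and> s < s' \<and> s' \<le> t) (mesh t)"
    by (rule eventually_meshI) auto
  ultimately show ?thesis
  proof eventually_elim
    case (elim x)
    obtain s s' where x: "x = (s, s')" by (cases x)
    define d where "d = s' - s"
    have d: "d > 0" and s: "s \<in> {0..t}" using elim by (auto simp: x d_def)
    define e where "e = z s' - z s - g s s'"
    have zs': "z s' = z s + (g s s' + e)" by (simp add: e_def)
    have e: "e = d *\<^sub>R q x" using d by (simp add: e_def q_def x d_def)
    have n2: "(norm (z s'))\<^sup>2 = (norm (z s))\<^sup>2 + 2 * (z s \<bullet> g s s') + (norm (g s s'))\<^sup>2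
        + d * (2 * (z s \<bullet> q x) + 2 * (g s s' \<bullet> q x) + e \<bullet> q x)"
    proof -
      have "(norm (z s'))\<^sup>2 = (norm (z s))\<^sup>2 + 2 * (z s \<bullet> g s s') + (norm (g s s'))\<^sup>2
        + (2 * (z s \<bullet> e) + 2 * (g s s' \<bullet> e) + e \<bullet> e)"
        unfolding zs' power2_norm_eq_inner by (simp add: inner_add_left inner_add_right inner_commute algebra_simps)
      also have "2 * (z s \<bullet> e) + 2 * (g s s' \<bullet> e) + e \<bullet> e = d * (2 * (z s \<bullet> q x) + 2 * (g s s' \<bullet> q x) + e \<bullet> q x)"
        by (subst (1 2 4) e) (simp add: algebra_simps)
      finally show ?thesis .
    qed
    have "d * R x = (c s' - c s - d * c' s) * (norm (z s'))\<^sup>2 + d * c' s * ((norm (z s'))\<^sup>2 - (norm (z s))\<^sup>2)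
        + c s * (d * (2 * (z s \<bullet> q x) + 2 * (g s s' \<bullet> q x) + e \<bullet> q x)) - 2 * d * c s * (z s \<bullet> b s)
        - (L s' - L s - d * L' s)"
      using d unfolding R_def x fst_conv snd_conv e_def[symmetric] d_def[symmetric]
      by (simp add: inner_diff_right field_simps)
    also have "c s * (d * (2 * (z s \<bullet> q x) + 2 * (g s s' \<bullet> q x) + e \<bullet> q x)) =
        c s * ((norm (z s'))\<^sup>2 - (norm (z s))\<^sup>2 - 2 * (z s \<bullet> g s s') - (norm (g s s'))\<^sup>2)"
      using n2 by simp
    \<comment> \<open>An exact identity: the drift minus \<open>L' s\<close> forms the factor of
      \<open>d\<close> that \<open>main\<close> makes nonpositive, and the error is exactly
      \<open>d * R x\<close>.\<close>
    finally have "c s' * (norm (z s'))\<^sup>2 - c s * (norm (z s))\<^sup>2 - (2 * c s * (z s \<bullet> g s s')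
        - 2 * (c s)\<^sup>2 * m s * d) - c s * ((norm (g s s'))\<^sup>2 - \<kappa> s * d) =
        d * (c' s * (norm (z s))\<^sup>2 + 2 * c s * (z s \<bullet> b s) + c s * \<kappa> s + 2 * (c s)\<^sup>2 * m s - L' s)
        + (L s' - L s) + d * R x"
      by (simp add: algebra_simps)
    also have "\<dots> \<le> d * 0 + (L s' - L s) + d * \<epsilon>"
      using elim(1) main[OF s] d by (intro add_mono mult_left_mono) auto
    finally show ?case by (simp add: x d_def mult.commute)
  qed
qed

text \<open>
  Ito's formula for \<open>c |z|\<^sup>2\<close> on a partition: when \<open>g\<close> is a Gaussian increment, the first sum is the
  logarithm of an exponential martingale and the second one is the error in the quadratic variation.
\<close>

lemma quadratic_sum:
  fixes z b :: "real \<Rightarrow> 'a::euclidean_space" and g :: "real \<Rightarrow> real \<Rightarrow> 'a" and c c' L L' \<kappa> m :: "real \<Rightarrow> real"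
  assumes "continuous_on {0..t} z" "continuous_on {0..t} b"
    and "\<And>s. s \<in> {0..t} \<Longrightarrow> (c has_vector_derivative c' s) (at s within {0..t})"
    and "\<And>s. s \<in> {0..t} \<Longrightarrow> (L has_vector_derivative L' s) (at s within {0..t})"
    and "continuous_on {0..t} c'" "continuous_on {0..t} L'"
    and "Zfun (\<lambda>(s, s'). g s s') (mesh t)"
    and "Zfun (\<lambda>(s, s'). (1 / (s' - s)) *\<^sub>R (z s' - z s - g s s') - b s) (mesh t)"
    and "\<And>s. s \<in> {0..t} \<Longrightarrow>
      c' s * (norm (z s))\<^sup>2 + 2 * c s * (z s \<bullet> b s) + c s * \<kappa> s + 2 * (c s)\<^sup>2 * m s \<le> L' s"
    and t: "t > 0" and \<epsilon>: "\<epsilon> > 0"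
  defines "\<tau> \<equiv> \<lambda>n k. t * real k / real (Suc n)"
  shows "eventually (\<lambda>n. c t * (norm (z t))\<^sup>2 \<le> c 0 * (norm (z 0))\<^sup>2 + (L t - L 0) + \<epsilon>
    + (\<Sum>k<Suc n. 2 * c (\<tau> n k) * (z (\<tau> n k) \<bullet> g (\<tau> n k) (\<tau> n (Suc k)))
        - 2 * (c (\<tau> n k))\<^sup>2 * m (\<tau> n k) * (t / real (Suc n)))
    + (\<Sum>k<Suc n. c (\<tau> n k) * ((norm (g (\<tau> n k) (\<tau> n (Suc k))))\<^sup>2 - \<kappa> (\<tau> n k) * (t / real (Suc n))))) sequentially"
proof -
  have step: "\<tau> n (Suc k) - \<tau> n k = t / real (Suc n)" for n k
    unfolding \<tau>_def diff_divide_distrib[symmetric] right_diff_distrib[symmetric] by simp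
  define f where "f = (\<lambda>s s'. c s' * (norm (z s'))\<^sup>2 - c s * (norm (z s))\<^sup>2 - (2 * c s * (z s \<bullet> g s s')
      - 2 * (c s)\<^sup>2 * m s * (s' - s)) - c s * ((norm (g s s'))\<^sup>2 - \<kappa> s * (s' - s)))"
  have "eventually (\<lambda>n. (\<Sum>k<Suc n. f (\<tau> n k) (\<tau> n (Suc k))) \<le> L t - L 0 + \<epsilon>) sequentially"
    unfolding \<tau>_def f_def by (rule partition_sum_le[OF t \<epsilon> quadratic_step[OF assms(1-9)]])
  then show ?thesis
  proof (rule eventually_mono)
    fix n
    have tele: "(\<Sum>k<Suc n. c (\<tau> n (Suc k)) * (norm (z (\<tau> n (Suc k))))\<^sup>2 - c (\<tau> n k) * (norm (z (\<tau> n k)))\<^sup>2)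
        = c t * (norm (z t))\<^sup>2 - c 0 * (norm (z 0))\<^sup>2"
      using sum_lessThan_telescope[of "\<lambda>k. c (\<tau> n k) * (norm (z (\<tau> n k)))\<^sup>2" "Suc n"]
      unfolding \<tau>_def by (simp del: of_nat_Suc sum.lessThan_Suc)
    have "(\<Sum>k<Suc n. f (\<tau> n k) (\<tau> n (Suc k))) =
      (\<Sum>k<Suc n. c (\<tau> n (Suc k)) * (norm (z (\<tau> n (Suc k))))\<^sup>2 - c (\<tau> n k) * (norm (z (\<tau> n k)))\<^sup>2)
      - (\<Sum>k<Suc n. 2 * c (\<tau> n k) * (z (\<tau> n k) \<bullet> g (\<tau> n k) (\<tau> n (Suc k)))
          - 2 * (c (\<tau> n k))\<^sup>2 * m (\<tau> n k) * (t / real (Suc n)))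
      - (\<Sum>k<Suc n. c (\<tau> n k) * ((norm (g (\<tau> n k) (\<tau> n (Suc k))))\<^sup>2 - \<kappa> (\<tau> n k) * (t / real (Suc n))))"
      unfolding f_def step sum_subtractf ..
    moreover assume "(\<Sum>k<Suc n. f (\<tau> n k) (\<tau> n (Suc k))) \<le> L t - L 0 + \<epsilon>"
    ultimately show "c t * (norm (z t))\<^sup>2 \<le> c 0 * (norm (z 0))\<^sup>2 + (L t - L 0) + \<epsilon>
      + (\<Sum>k<Suc n. 2 * c (\<tau> n k) * (z (\<tau> n k) \<bullet> g (\<tau> n k) (\<tau> n (Suc k)))
          - 2 * (c (\<tau> n k))\<^sup>2 * m (\<tau> n k) * (t / real (Suc n)))
      + (\<Sum>k<Suc n. c (\<tau> n k) * ((norm (g (\<tau> n k) (\<tau> n (Suc k))))\<^sup>2 - \<kappa> (\<tau> n k) * (t / real (Suc n))))"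
      unfolding tele by linarith
  qed
qed

section \<open>Concentration of dissipative processes\<close>

lemma borel_measurable_matrix_vector_mult [measurable (raw)]:
  fixes K :: "'w \<Rightarrow> real^'n^'m"
  assumes "K \<in> borel_measurable M" "u \<in> borel_measurable M"
  shows "(\<lambda>\<omega>. K \<omega> *v u \<omega>) \<in> borel_measurable M"
  using assms
  by (rule borel_measurable_continuous_Pair)
     (intro bounded_bilinear.continuous_on[OF bounded_bilinear_matrix_vector_mult] continuous_intros)

lemma borel_measurable_vector_matrix_mult [measurable (raw)]:
  fixes K :: "'w \<Rightarrow> real^'n^'m"
  assumes "K \<in> borel_measurable M" "u \<in> borel_measurable M"
  shows "(\<lambda>\<omega>. u \<omega> v* K \<omega>) \<in> borel_measurable M"
proof -
  have "(\<lambda>\<omega>. transpose (K \<omega>)) \<in> borel_measurable M"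
    by (rule borel_measurable_continuous_on[OF _ assms(1)])
       (rule linear_continuous_on[OF bounded_linear_transpose])
  from borel_measurable_matrix_vector_mult[OF this assms(2)] show ?thesis by simp
qed

text \<open>The index from which \<open>P n\<close> holds depends on the path. Dominated convergence
  of the indicators of failure turns this into small exceptional probability at a single large
  \<open>n\<close>.\<close>

lemma (in prob_space) prob_not_eventually_tendsto_0:
  assumes meas: "\<And>n::nat. {\<omega>\<in>space M. P n \<omega>} \<in> events"
    and ev: "AE \<omega> in M. eventually (\<lambda>n. P n \<omega>) sequentially"
  shows "(\<lambda>n. prob {\<omega>\<in>space M. \<not> P n \<omega>}) \<longlonglongrightarrow> 0"
proof -
  define S where "S = (\<lambda>n. {\<omega>\<in>space M. \<not> P n \<omega>})"
  have S: "S n \<in> events" for n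
  proof -
    have "S n = space M - {\<omega>\<in>space M. P n \<omega>}" by (auto simp: S_def)
    then show ?thesis using sets.compl_sets[OF meas] by simp
  qed
  have "(\<lambda>n. integral\<^sup>L M (indicat_real (S n))) \<longlonglongrightarrow> integral\<^sup>L M (\<lambda>_. 0)"
  proof (rule integral_dominated_convergence[where w = "\<lambda>_. 1"])
    show "AE \<omega> in M. (\<lambda>n. indicat_real (S n) \<omega>) \<longlonglongrightarrow> 0"
      using ev
    proof eventually_elim
      case (elim \<omega>)
      then show ?case
        by (intro tendsto_eventually) (auto elim!: eventually_mono simp: S_def)
    qed
  qed (use S in \<open>auto simp: indicator_le_1\<close>)
  then show ?thesis using S sets.sets_into_space[OF S] by (simp add: S_def Int_absorb2)
qed

text \<open>Expands the squared image of a Gaussian vector, minus its mean, into the centred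
  products of coordinates to which the second moment estimate applies.\<close>

lemma gaussian_fluctuation_linear:
  fixes K :: "'b::euclidean_space \<Rightarrow> 'a::real_inner"
  assumes K: "linear K"
  shows "(\<Sum>i\<in>Basis. \<Sum>j\<in>Basis. (K i \<bullet> K j) * ((u \<bullet> i) * (u \<bullet> j) - (if i = j then d else 0)))
    = (norm (K u))\<^sup>2 - (\<Sum>i\<in>Basis. (norm (K i))\<^sup>2) * d"
proof -
  have Ku: "K u = (\<Sum>i\<in>Basis. (u \<bullet> i) *\<^sub>R K i)"
    by (subst euclidean_representation[of u, symmetric], subst linear_sum[OF K]) (simp add: linear_scale[OF K])
  have 1: "(norm (K u))\<^sup>2 = (\<Sum>i\<in>Basis. \<Sum>j\<in>Basis. (K i \<bullet> K j) * ((u \<bullet> i) * (u \<bullet> j)))"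
    unfolding power2_norm_eq_inner Ku inner_sum_left inner_sum_right
    by (intro sum.cong refl) (simp add: mult_ac inner_commute)
  have 2: "(\<Sum>i\<in>Basis. \<Sum>j\<in>Basis. (K i \<bullet> K j) * (if i = j then d else 0)) = (\<Sum>i\<in>Basis. (norm (K i))\<^sup>2) * d"
    by (simp add: sum_distrib_right power2_norm_eq_inner if_distrib[of "\<lambda>x. _ * x"] cong: if_cong)
  show ?thesis unfolding 1 2[symmetric] by (simp add: right_diff_distrib sum_subtractf)
qed

lemma sum_Basis_norm_matrix:
  fixes K :: "real^'n^'m"
  shows "(\<Sum>i\<in>Basis. (norm (K *v i))\<^sup>2) = (norm K)\<^sup>2"
proof -
  have B: "(Basis :: (real^'n) set) = range (\<lambda>j. axis j 1)"
    by (auto simp: Basis_vec_def)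
  have inj: "inj (\<lambda>j::'n. axis j (1::real))" by (auto simp: inj_on_def axis_eq_axis)
  have "(\<Sum>i\<in>Basis. (norm (K *v i))\<^sup>2) = (\<Sum>j\<in>UNIV. (norm (column j K))\<^sup>2)"
    unfolding B by (subst sum.reindex[OF inj]) (simp add: matrix_vector_mult_basis)
  also have "\<dots> = (\<Sum>j\<in>UNIV. \<Sum>i\<in>UNIV. (K $ i $ j)\<^sup>2)"
    unfolding power2_norm_eq_inner by (simp add: inner_vec_def column_def power2_eq_square)
  also have "\<dots> = (\<Sum>i\<in>UNIV. \<Sum>j\<in>UNIV. (K $ i $ j)\<^sup>2)" by (rule sum.swap)
  also have "\<dots> = (norm K)\<^sup>2"
    unfolding power2_norm_eq_inner by (simp add: inner_vec_def power2_eq_square)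
  finally show ?thesis .
qed

text \<open>Treats the pair of Brownian motions as a single one on the product space, on which the
  noise operator sends \<open>(u, v)\<close> to \<open>Q *v u - H *v v\<close>.\<close>

lemma sum_Basis_norm_prod:
  fixes Q :: "real^'m^'l" and H :: "real^'n^'l"
  shows "(\<Sum>i\<in>Basis. (norm (Q *v fst i - H *v snd i))\<^sup>2) = (norm Q)\<^sup>2 + (norm H)\<^sup>2"
proof -
  have "(\<Sum>i\<in>Basis. (norm (Q *v fst i - H *v snd i))\<^sup>2) =
      (\<Sum>i\<in>(\<lambda>u. (u, 0)) ` Basis. (norm (Q *v fst i - H *v snd i))\<^sup>2) +
      (\<Sum>i\<in>(\<lambda>v. (0, v)) ` Basis. (norm (Q *v fst i - H *v snd i))\<^sup>2)"
    unfolding Basis_prod_def by (rule sum.union_disjoint) auto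
  also have "(\<Sum>i\<in>(\<lambda>u. (u, 0)) ` Basis. (norm (Q *v fst i - H *v snd i))\<^sup>2) = (norm Q)\<^sup>2"
    by (subst sum.reindex) (auto simp: inj_on_def sum_Basis_norm_matrix)
  also have "(\<Sum>i\<in>(\<lambda>v. (0, v)) ` Basis. (norm (Q *v fst i - H *v snd i))\<^sup>2) = (norm H)\<^sup>2"
    by (subst sum.reindex) (auto simp: inj_on_def sum_Basis_norm_matrix)
  finally show ?thesis .
qed

section \<open>The exponential estimate\<close>

text \<open>The hypothesis \<open>dyn\<close> expresses the equation for \<open>Z\<close> as a local
  expansion with noise coefficients frozen at the left endpoint, so no stochastic integral occurs.
  Along a partition, \<open>c |Z|^2\<close> is then bounded by the logarithm \<open>E\<close> of an
  exponential martingale, the quadratic variation error \<open>D\<close>, the deterministic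
  increment of \<open>L\<close>, and a small remainder. The slack \<epsilon> is shared among these
  limits.\<close>

lemma dissipative_concentration:
  fixes W :: "real \<Rightarrow> 'w \<Rightarrow> real^'m" and V :: "real \<Rightarrow> 'w \<Rightarrow> real^'n"
    and Z b :: "real \<Rightarrow> 'w \<Rightarrow> real^'l" and H :: "real \<Rightarrow> 'w \<Rightarrow> real^'n^'l" and Q :: "real^'m^'l"
  assumes fps: "filtered_prob_space M F" and bm: "brownian_motion M F (\<lambda>t \<omega>. (W t \<omega>, V t \<omega>))"
    and Z: "continuous_adapted M F Z" and H: "continuous_adapted M F H"
    and Z0: "AE \<omega> in M. Z 0 \<omega> = z0"
    and b: "AE \<omega> in M. continuous_on {0..t} (\<lambda>s. b s \<omega>)"
    and dyn: "AE \<omega> in M. Zfun (\<lambda>(s, s'). (1 / (s' - s)) *\<^sub>R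
        (Z s' \<omega> - Z s \<omega> - (Q *v (W s' \<omega> - W s \<omega>) - H s \<omega> *v (V s' \<omega> - V s \<omega>))) - b s \<omega>) (mesh t)"
    and diss: "AE \<omega> in M. \<forall>s\<in>{0..t}. Z s \<omega> \<bullet> b s \<omega> \<le> - \<mu> * (norm (Z s \<omega>))\<^sup>2"
    and q: "AE \<omega> in M. \<forall>s\<in>{0..t}. (norm Q)\<^sup>2 + (norm (H s \<omega>))\<^sup>2 \<le> q s"
    and contq: "continuous_on {0..t} q"
    and c: "\<And>s. s \<in> {0..t} \<Longrightarrow> (c has_vector_derivative 2 * \<mu> * c s - 2 * (c s)\<^sup>2 * q s) (at s within {0..t})"
    and c0: "\<And>s. s \<in> {0..t} \<Longrightarrow> 0 \<le> c s"
    and L: "\<And>s. s \<in> {0..t} \<Longrightarrow> (L has_vector_derivative c s * q s) (at s within {0..t})"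
    and t: "t > 0" and \<epsilon>: "\<epsilon> > 0"
  shows "measure M {\<omega>\<in>space M. c 0 * (norm z0)\<^sup>2 + (L t - L 0) + \<eta> < c t * (norm (Z t \<omega>))\<^sup>2} \<le> exp (\<epsilon> - \<eta>)"
proof -
  interpret prob_space M using fps by (simp add: filtered_prob_space_def)
  interpret filtration "space M" F using fps by (simp add: filtered_prob_space_def)
  have sub: "subalgebra M (F s)" for s using fps by (simp add: filtered_prob_space_def)
  have toM: "X \<in> borel_measurable (F s) \<Longrightarrow> X \<in> borel_measurable M" for X s
    by (rule measurable_from_subalg[OF sub])
  have ZF[measurable]: "Z s \<in> borel_measurable (F s)" and HF[measurable]: "H s \<in> borel_measurable (F s)" if "s \<ge> 0" for s
    using Z H that by (auto simp: continuous_adapted_def)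
  have WV: "(\<lambda>\<omega>. (W s \<omega>, V s \<omega>)) \<in> borel_measurable (F s)" if "s \<ge> 0" for s
    using bm that by (auto simp: continuous_adapted_def brownian_motion_def)
  have fst_snd: "fst \<in> borel_measurable (borel :: ((real^'m) \<times> (real^'n)) measure)"
      "snd \<in> borel_measurable (borel :: ((real^'m) \<times> (real^'n)) measure)"
    by (intro borel_measurable_continuous_onI continuous_intros)+
  have WM: "W s \<in> borel_measurable M" "V s \<in> borel_measurable M" if "s \<ge> 0" for s
    using measurable_compose[OF toM[OF WV[OF that]] fst_snd(1)]
      measurable_compose[OF toM[OF WV[OF that]] fst_snd(2)] by simp_all
  define \<tau> where "\<tau> = (\<lambda>n k. t * real k / real (Suc n))"
  have \<tau>0: "\<tau> n k \<ge> 0" for n k using t by (simp add: \<tau>_def)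
  have \<tau>t: "k < Suc n \<Longrightarrow> \<tau> n k \<in> {0..t}" for n k
    using t by (simp add: \<tau>_def divide_le_eq)
  have step: "\<tau> n (Suc k) - \<tau> n k = t / real (Suc n)" for n k
    unfolding \<tau>_def diff_divide_distrib[symmetric] right_diff_distrib[symmetric] by simp
  have less: "\<tau> n k < \<tau> n (Suc k)" for n k
    using step[of n k] t by (smt (verit) divide_pos_pos of_nat_0_less_iff zero_less_Suc)
  define g where "g = (\<lambda>s s' \<omega>. Q *v (W s' \<omega> - W s \<omega>) - H s \<omega> *v (V s' \<omega> - V s \<omega>))"
  \<comment> \<open>The covariance form of the noise evaluated at \<open>Z\<close>, that is, the
    squared norm of the adjoint noise operator applied to \<open>Z\<close>; \<kappa> below is the
    trace of the same covariance.\<close>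
  define m where "m = (\<lambda>s \<omega>. (norm (Z s \<omega> v* Q))\<^sup>2 + (norm (Z s \<omega> v* H s \<omega>))\<^sup>2)"
  define \<kappa> where "\<kappa> = (\<lambda>s \<omega>. (norm Q)\<^sup>2 + (norm (H s \<omega>))\<^sup>2)"
  define E where "E = (\<lambda>n \<omega>. \<Sum>k<Suc n. 2 * c (\<tau> n k) * (Z (\<tau> n k) \<omega> \<bullet> g (\<tau> n k) (\<tau> n (Suc k)) \<omega>)
        - 2 * (c (\<tau> n k))\<^sup>2 * m (\<tau> n k) \<omega> * (t / real (Suc n)))"
  define D where "D = (\<lambda>n \<omega>. \<Sum>k<Suc n. c (\<tau> n k) * ((norm (g (\<tau> n k) (\<tau> n (Suc k)) \<omega>))\<^sup>2
        - \<kappa> (\<tau> n k) \<omega> * (t / real (Suc n))))"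
  have gM: "g s s' \<in> borel_measurable M" if "s \<ge> 0" "s' \<ge> 0" for s s'
    unfolding g_def using toM[OF HF[OF that(1)]] WM[OF that(1)] WM[OF that(2)] by measurable
  have mM: "m s \<in> borel_measurable M" and kM: "\<kappa> s \<in> borel_measurable M" if "s \<ge> 0" for s
    unfolding m_def \<kappa>_def using toM[OF HF[OF that]] toM[OF ZF[OF that]] by measurable
  have E_meas: "E n \<in> borel_measurable M" and D_meas: "D n \<in> borel_measurable M" for n
    unfolding E_def D_def using gM mM kM \<tau>0 toM[OF ZF] by measurable
  have cc: "continuous_on {0..t} c" by (rule continuous_on_vector_derivative[OF c])
  have path: "AE \<omega> in M. eventually (\<lambda>n. c t * (norm (Z t \<omega>))\<^sup>2 \<le>
      c 0 * (norm (Z 0 \<omega>))\<^sup>2 + (L t - L 0) + \<epsilon> / 4 + E n \<omega> + D n \<omega>) sequentially"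
    using AE_space b dyn diss q
  proof eventually_elim
    case (elim \<omega>)
    have "continuous_on {0..} (\<lambda>s. (W s \<omega>, V s \<omega>))"
      using bm elim(1) unfolding brownian_motion_def continuous_adapted_def by blast
    from continuous_on_fst[OF this] continuous_on_snd[OF this]
    have WV: "continuous_on {0..} (\<lambda>s. W s \<omega>)" "continuous_on {0..} (\<lambda>s. V s \<omega>)" by simp_all
    have cont: "continuous_on {0..t} (\<lambda>s. Z s \<omega>)" "continuous_on {0..t} (\<lambda>s. H s \<omega>)"
        "continuous_on {0..t} (\<lambda>s. W s \<omega>)" "continuous_on {0..t} (\<lambda>s. V s \<omega>)"
      using Z H WV elim(1) unfolding continuous_adapted_def
      by (blast intro: continuous_on_subset[OF _ Icc_subset_Ici_iff[THEN iffD2, OF disjI2[OF order_refl]]])+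
    show ?case unfolding E_def D_def \<tau>_def
    proof (rule quadratic_sum[where L' = "\<lambda>s. c s * q s" and c' = "\<lambda>s. 2 * \<mu> * c s - 2 * (c s)\<^sup>2 * q s"
          and z = "\<lambda>s. Z s \<omega>" and b = "\<lambda>s. b s \<omega>" and g = "\<lambda>s s'. g s s' \<omega>"
          and m = "\<lambda>s. m s \<omega>" and \<kappa> = "\<lambda>s. \<kappa> s \<omega>" and L = L and c = c])
      show "continuous_on {0..t} (\<lambda>s. 2 * \<mu> * c s - 2 * (c s)\<^sup>2 * q s)" "continuous_on {0..t} (\<lambda>s. c s * q s)"
        by (intro continuous_intros cc contq)+
      have "Zfun (\<lambda>x. Q *v (W (snd x) \<omega> - W (fst x) \<omega>)) (mesh t)"
        using bounded_linear.Zfun[OF matrix_vector_mul_bounded_linear Zfun_mesh_increment[OF cont(3)]]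
        by (simp add: case_prod_unfold)
      moreover have "Zfun (\<lambda>x. H (fst x) \<omega> *v (V (snd x) \<omega> - V (fst x) \<omega>)) (mesh t)"
        using bounded_bilinear.Bfun_prod_Zfun[OF bounded_bilinear_matrix_vector_mult
          Bfun_mesh_left[OF cont(2)] Zfun_mesh_increment[OF cont(4)]]
        by (simp add: case_prod_unfold)
      ultimately show "Zfun (\<lambda>(s, s'). g s s' \<omega>) (mesh t)"
        unfolding g_def case_prod_unfold by (rule Zfun_diff)
      show "Zfun (\<lambda>(s, s'). (1 / (s' - s)) *\<^sub>R (Z s' \<omega> - Z s \<omega> - g s s' \<omega>) - b s \<omega>) (mesh t)"
        using elim(3) by (simp add: g_def)
      fix s assume s: "s \<in> {0..t}"
      define n where "n = (norm (Z s \<omega>))\<^sup>2"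
      have "m s \<omega> \<le> (norm Q * norm (Z s \<omega>))\<^sup>2 + (norm (H s \<omega>) * norm (Z s \<omega>))\<^sup>2"
        unfolding m_def by (intro add_mono power_mono norm_vector_matrix_le) auto
      also have "\<dots> = \<kappa> s \<omega> * n"
        by (simp add: \<kappa>_def n_def power_mult_distrib distrib_right)
      also have "\<dots> \<le> q s * n"
        using elim(5) s by (intro mult_right_mono) (auto simp: \<kappa>_def n_def)
      finally have "2 * (c s)\<^sup>2 * m s \<omega> \<le> 2 * (c s)\<^sup>2 * (q s * n)"
        by (intro mult_left_mono) auto
      moreover have "c s * \<kappa> s \<omega> \<le> c s * q s"
        using elim(5) s c0[OF s] by (intro mult_left_mono) (auto simp: \<kappa>_def)
      moreover have "2 * c s * (Z s \<omega> \<bullet> b s \<omega>) \<le> 2 * c s * (- \<mu> * n)"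
        using elim(4) s c0[OF s] by (intro mult_left_mono) (auto simp: n_def)
      \<comment> \<open>The term with \<mu> cancels against the dissipation and the term with
        \<open>q\<close> against the exponential compensator; the trace term alone remains.\<close>
      ultimately show "(2 * \<mu> * c s - 2 * (c s)\<^sup>2 * q s) * (norm (Z s \<omega>))\<^sup>2 + 2 * c s * (Z s \<omega> \<bullet> b s \<omega>)
          + c s * \<kappa> s \<omega> + 2 * (c s)\<^sup>2 * m s \<omega> \<le> c s * q s"
        unfolding n_def[symmetric] by (simp add: algebra_simps)
    qed (use cont elim(2) c L t \<epsilon> in auto)
  qed
  define P where "P = (\<lambda>n \<omega>. c t * (norm (Z t \<omega>))\<^sup>2 \<le>
      c 0 * (norm z0)\<^sup>2 + (L t - L 0) + \<epsilon> / 4 + E n \<omega> + D n \<omega>)"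
  have [measurable]: "Z t \<in> borel_measurable M" using toM[OF ZF] t by simp
  have P_meas: "{\<omega>\<in>space M. P n \<omega>} \<in> events" for n
    unfolding P_def using E_meas[of n] D_meas[of n] by measurable
  have "AE \<omega> in M. eventually (\<lambda>n. P n \<omega>) sequentially"
    using path Z0 by eventually_elim (simp add: P_def)
  from prob_not_eventually_tendsto_0[OF P_meas this]
  have P0: "(\<lambda>n. prob {\<omega>\<in>space M. \<not> P n \<omega>}) \<longlonglongrightarrow> 0" .
  obtain Cc Cq where Cc: "\<And>s. s \<in> {0..t} \<Longrightarrow> \<bar>c s\<bar> \<le> Cc" and Cq: "\<And>s. s \<in> {0..t} \<Longrightarrow> \<bar>q s\<bar> \<le> Cq"
  proof -
    have "bounded (c ` {0..t})" "bounded (q ` {0..t})"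
      using cc contq by (auto intro!: compact_imp_bounded compact_continuous_image)
    then obtain Cc Cq where "\<forall>s\<in>{0..t}. \<bar>c s\<bar> \<le> Cc" "\<forall>s\<in>{0..t}. \<bar>q s\<bar> \<le> Cq"
      unfolding bounded_iff by auto
    then show ?thesis using that by blast
  qed
  define C where "C = Cc * (2 * Cq)"
  have Cc0: "0 \<le> Cc" and Cq0: "0 \<le> Cq" using Cc[of 0] Cq[of 0] t by auto
  \<comment> \<open>The Chebyshev constant times the number of steps: \<open>Suc n\<close>
    fluctuations, each with \<sigma> to the fourth equal to
    \<open>t\<^sup>2 / (Suc n)\<^sup>2\<close>, leave a bound of \<open>d / Suc n\<close>.\<close>
  define d where "d = real DIM((real^'m) \<times> (real^'n)) ^ 4 * (C\<^sup>2 * (8 * t\<^sup>2)) / (\<epsilon> / 4)\<^sup>2"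
  have ED: "prob {\<omega>\<in>space M. \<eta> - \<epsilon> / 2 \<le> E n \<omega>} \<le> exp (\<epsilon> / 2 - \<eta>)"
    "prob {\<omega>\<in>space M. \<epsilon> / 4 \<le> D n \<omega>} \<le> d / real (Suc n)" for n
  proof -
    define \<sigma> where "\<sigma> = sqrt (t / real (Suc n))"
    have \<sigma>: "\<sigma> > 0" "\<sigma>\<^sup>2 = t / real (Suc n)" using t by (simp_all add: \<sigma>_def)
    define U where "U = (\<lambda>k \<omega>. (W (\<tau> n (Suc k)) \<omega> - W (\<tau> n k) \<omega>, V (\<tau> n (Suc k)) \<omega> - V (\<tau> n k) \<omega>))"
    have U: "U k = (\<lambda>\<omega>. (W (\<tau> n (Suc k)) \<omega>, V (\<tau> n (Suc k)) \<omega>) - (W (\<tau> n k) \<omega>, V (\<tau> n k) \<omega>))" for k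
      by (simp add: U_def)
    interpret gaussian_increments M "\<lambda>k. F (\<tau> n k)" U \<sigma>
    proof
      fix k
      show "subalgebra M (F (\<tau> n k))" by (rule sub)
      show mono: "sets (F (\<tau> n k)) \<subseteq> sets (F (\<tau> n (Suc k)))" by (rule sets_F_mono) (use less in \<open>simp add: less_imp_le\<close>)
      have "(\<lambda>\<omega>. (W (\<tau> n k) \<omega>, V (\<tau> n k) \<omega>)) \<in> borel_measurable (F (\<tau> n (Suc k)))"
        by (rule measurable_from_subalg[OF _ WV[OF \<tau>0]]) (use mono space_F in \<open>auto simp: subalgebra_def\<close>)
      then show "U k \<in> borel_measurable (F (\<tau> n (Suc k)))"
        unfolding U by (intro borel_measurable_diff WV[OF \<tau>0])
      have "distributed M lborel (U k) (\<lambda>x. ennreal (\<Prod>b\<in>Basis. normal_density 0 (sqrt (\<tau> n (Suc k) - \<tau> n k)) (x \<bullet> b))) \<and>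
          indep_set (sets (F (\<tau> n k))) (sets (vimage_algebra (space M) (U k) borel))"
        using bm less[of n k] \<tau>0[of n k] unfolding brownian_motion_def U by blast
      then show "indep_set (sets (F (\<tau> n k))) (sets (vimage_algebra (space M) (U k) borel))"
          "distributed M lborel (U k) (gaussian \<sigma>)"
        unfolding step \<sigma>_def by auto
      show "\<sigma> > 0" by (rule \<sigma>)
    qed
    \<comment> \<open>The adjoint noise operator at \<open>2 c Z\<close>: pairing it with the
      increment gives \<open>2 c <Z, g>\<close>, and its squared norm is
      \<open>4 c^2 m\<close>.\<close>
    define \<theta> where "\<theta> = (\<lambda>k \<omega>. (2 * c (\<tau> n k)) *\<^sub>R (Z (\<tau> n k) \<omega> v* Q, - (Z (\<tau> n k) \<omega> v* H (\<tau> n k) \<omega>)))"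
    have \<theta>: "\<theta> k \<in> borel_measurable (F (\<tau> n k))" for k
      unfolding \<theta>_def using ZF[OF \<tau>0] HF[OF \<tau>0] by measurable
    have "\<theta> k \<omega> \<bullet> U k \<omega> - (norm (\<theta> k \<omega>))\<^sup>2 * \<sigma>\<^sup>2 / 2 =
        2 * c (\<tau> n k) * (Z (\<tau> n k) \<omega> \<bullet> g (\<tau> n k) (\<tau> n (Suc k)) \<omega>)
        - 2 * (c (\<tau> n k))\<^sup>2 * m (\<tau> n k) \<omega> * (t / real (Suc n))" for k \<omega>
    proof -
      have "(norm (\<theta> k \<omega>))\<^sup>2 = 4 * (c (\<tau> n k))\<^sup>2 * m (\<tau> n k) \<omega>"
        by (simp add: \<theta>_def m_def norm_Pair power_mult_distrib distrib_left)
      moreover have "\<theta> k \<omega> \<bullet> U k \<omega> = 2 * c (\<tau> n k) * (Z (\<tau> n k) \<omega> \<bullet> g (\<tau> n k) (\<tau> n (Suc k)) \<omega>)"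
        by (simp add: \<theta>_def U_def g_def inner_diff_right dot_lmul_matrix right_diff_distrib matrix_vector_mult_diff_distrib)
      ultimately show ?thesis unfolding \<sigma>(2)[symmetric] by simp
    qed
    then have "E n = (\<lambda>\<omega>. \<Sum>k<Suc n. \<theta> k \<omega> \<bullet> U k \<omega> - (norm (\<theta> k \<omega>))\<^sup>2 * \<sigma>\<^sup>2 / 2)"
      by (simp add: E_def)
    then show "prob {\<omega>\<in>space M. \<eta> - \<epsilon> / 2 \<le> E n \<omega>} \<le> exp (\<epsilon> / 2 - \<eta>)"
      using prob_exp_sum_ge[OF \<theta>, of "\<eta> - \<epsilon> / 2" "Suc n"] by simp
    define K where "K = (\<lambda>k \<omega> (i :: (real^'m) \<times> (real^'n)). Q *v fst i - H (\<tau> n k) \<omega> *v snd i)"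
    have linK: "linear (K k \<omega>)" for k \<omega>
      unfolding K_def by (intro linearI) (simp_all add: matrix_vector_right_distrib matrix_vector_mult_scaleR algebra_simps)
    \<comment> \<open>Set to zero past the horizon: the uniform bound is demanded for every index,
      but \<open>c\<close> and \<open>q\<close> are controlled only on
      \<open>[0, t]\<close>.\<close>
    define G where "G = (\<lambda>k i j \<omega>. if k < Suc n then c (\<tau> n k) * (K k \<omega> i \<bullet> K k \<omega> j) else 0)"
    have KG: "(\<Sum>i\<in>Basis. \<Sum>j\<in>Basis. G k i j \<omega> * ((U k \<omega> \<bullet> i) * (U k \<omega> \<bullet> j) - (if i = j then \<sigma>\<^sup>2 else 0)))
        = c (\<tau> n k) * ((norm (g (\<tau> n k) (\<tau> n (Suc k)) \<omega>))\<^sup>2 - \<kappa> (\<tau> n k) \<omega> * (t / real (Suc n)))"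
      if "k < Suc n" for k \<omega>
    proof -
      have "K k \<omega> (U k \<omega>) = g (\<tau> n k) (\<tau> n (Suc k)) \<omega>" by (simp add: K_def U_def g_def)
      moreover have "(\<Sum>i\<in>Basis. (norm (K k \<omega> i))\<^sup>2) = \<kappa> (\<tau> n k) \<omega>"
        unfolding K_def \<kappa>_def by (rule sum_Basis_norm_prod)
      ultimately have "c (\<tau> n k) * ((norm (g (\<tau> n k) (\<tau> n (Suc k)) \<omega>))\<^sup>2 - \<kappa> (\<tau> n k) \<omega> * (t / real (Suc n)))
        = c (\<tau> n k) * (\<Sum>i\<in>Basis. \<Sum>j\<in>Basis. (K k \<omega> i \<bullet> K k \<omega> j) *
          ((U k \<omega> \<bullet> i) * (U k \<omega> \<bullet> j) - (if i = j then \<sigma>\<^sup>2 else 0)))"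
        unfolding gaussian_fluctuation_linear[OF linK] \<sigma>(2) by simp
      then show ?thesis using that by (simp only: G_def if_True sum_distrib_left mult.assoc)
    qed
    have D: "D n \<omega> = (\<Sum>k<Suc n. \<Sum>i\<in>Basis. \<Sum>j\<in>Basis.
        G k i j \<omega> * ((U k \<omega> \<bullet> i) * (U k \<omega> \<bullet> j) - (if i = j then \<sigma>\<^sup>2 else 0)))" for \<omega>
      unfolding D_def by (intro sum.cong refl) (use KG in simp)
    have G_meas: "G k i j \<in> borel_measurable (F (\<tau> n k))" for k i j
      unfolding G_def K_def using HF[OF \<tau>0] by measurable
    have G_bound: "AE \<omega> in M. \<bar>G k i j \<omega>\<bar> \<le> C" if "i \<in> Basis" "j \<in> Basis" for k i j
      using q
    proof eventually_elim
      case (elim \<omega>)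
      show ?case
      proof (cases "k < Suc n")
        case True
        have K: "norm (K k \<omega> i) \<le> norm Q + norm (H (\<tau> n k) \<omega>)" if "i \<in> Basis" for i
        proof -
          have "norm (fst i) \<le> 1" "norm (snd i) \<le> 1"
            using norm_fst_le[of "fst i" "snd i"] norm_snd_le[of "snd i" "fst i"] norm_Basis[OF that] by simp_all
          then have "norm (Q *v fst i) \<le> norm Q" "norm (H (\<tau> n k) \<omega> *v snd i) \<le> norm (H (\<tau> n k) \<omega>)"
            using norm_matrix_vector_le[of Q "fst i"] norm_matrix_vector_le[of "H (\<tau> n k) \<omega>" "snd i"]
            by (meson mult_left_le norm_ge_zero order_trans)+
          then show ?thesis unfolding K_def using norm_triangle_ineq4 by (smt (verit))
        qed
        have "\<bar>K k \<omega> i \<bullet> K k \<omega> j\<bar> \<le> norm (K k \<omega> i) * norm (K k \<omega> j)" by (rule Cauchy_Schwarz_ineq2)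
        also have "\<dots> \<le> (norm Q + norm (H (\<tau> n k) \<omega>)) * (norm Q + norm (H (\<tau> n k) \<omega>))"
          by (intro mult_mono K that) auto
        also have "\<dots> \<le> 2 * ((norm Q)\<^sup>2 + (norm (H (\<tau> n k) \<omega>))\<^sup>2)"
          using zero_le_power2[of "norm Q - norm (H (\<tau> n k) \<omega>)"] by (simp add: power2_eq_square algebra_simps)
        also have "\<dots> \<le> 2 * Cq"
          using elim \<tau>t[OF True] Cq[OF \<tau>t[OF True]] by force
        finally have "\<bar>c (\<tau> n k)\<bar> * \<bar>K k \<omega> i \<bullet> K k \<omega> j\<bar> \<le> Cc * (2 * Cq)"
          by (intro mult_mono Cc \<tau>t True Cc0) auto
        then show ?thesis using True by (simp add: G_def C_def abs_mult)
      qed (use Cc0 Cq0 in \<open>simp add: G_def C_def\<close>)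
    qed
    have "prob {\<omega>\<in>space M. \<epsilon> / 4 \<le> D n \<omega>} \<le>
        real DIM((real^'m) \<times> (real^'n)) ^ 4 * real (Suc n) * (C\<^sup>2 * (8 * \<sigma> ^ 4)) / (\<epsilon> / 4)\<^sup>2"
      unfolding D by (rule prob_quadratic_fluctuation_ge[of G C "\<epsilon> / 4" "Suc n", OF G_meas G_bound]) (use \<epsilon> in auto)
    also have "\<sigma> ^ 4 = t\<^sup>2 / (real (Suc n))\<^sup>2"
    proof -
      have "\<sigma> ^ 4 = (\<sigma>\<^sup>2)\<^sup>2" by simp
      then show ?thesis unfolding \<sigma>(2) by (simp add: power_divide)
    qed
    also have "real DIM((real^'m) \<times> (real^'n)) ^ 4 * real (Suc n) * (C\<^sup>2 * (8 * (t\<^sup>2 / (real (Suc n))\<^sup>2))) / (\<epsilon> / 4)\<^sup>2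
        = d / real (Suc n)"
      unfolding d_def by (simp add: power2_eq_square field_simps del: of_nat_Suc)
    finally show "prob {\<omega>\<in>space M. \<epsilon> / 4 \<le> D n \<omega>} \<le> d / real (Suc n)" .
  qed
  define bad where "bad = {\<omega>\<in>space M. c 0 * (norm z0)\<^sup>2 + (L t - L 0) + \<eta> < c t * (norm (Z t \<omega>))\<^sup>2}"
  have le: "prob bad \<le> prob {\<omega>\<in>space M. \<not> P n \<omega>} + (exp (\<epsilon> / 2 - \<eta>) + d / real (Suc n))" for n
  proof -
    have ev: "{\<omega>\<in>space M. \<not> P n \<omega>} \<in> events" "{\<omega>\<in>space M. \<eta> - \<epsilon> / 2 \<le> E n \<omega>} \<in> events" "{\<omega>\<in>space M. \<epsilon> / 4 \<le> D n \<omega>} \<in> events"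
      unfolding P_def using E_meas[of n] D_meas[of n] by measurable
    \<comment> \<open>Off the exceptional set of \<open>P n\<close>, an excess \<eta> must be made
      up by \<open>\<epsilon> / 4\<close> from the remainder together with \<open>E\<close> and
      \<open>D\<close>; if \<open>D\<close> is below \<open>\<epsilon> / 4\<close>, then
      \<open>E\<close> exceeds \<open>\<eta> - \<epsilon> / 2\<close>.\<close>
    have "bad \<subseteq> {\<omega>\<in>space M. \<not> P n \<omega>} \<union> ({\<omega>\<in>space M. \<eta> - \<epsilon> / 2 \<le> E n \<omega>} \<union> {\<omega>\<in>space M. \<epsilon> / 4 \<le> D n \<omega>})"
      by (auto simp: bad_def P_def)
    then have "prob bad \<le> prob ({\<omega>\<in>space M. \<not> P n \<omega>} \<union> ({\<omega>\<in>space M. \<eta> - \<epsilon> / 2 \<le> E n \<omega>} \<union> {\<omega>\<in>space M. \<epsilon> / 4 \<le> D n \<omega>}))"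
      by (rule finite_measure_mono) (use ev in auto)
    also have "\<dots> \<le> prob {\<omega>\<in>space M. \<not> P n \<omega>} + (prob {\<omega>\<in>space M. \<eta> - \<epsilon> / 2 \<le> E n \<omega>} + prob {\<omega>\<in>space M. \<epsilon> / 4 \<le> D n \<omega>})"
      using ev by (intro order_trans[OF measure_Un_le] add_left_mono measure_Un_le) auto
    also have "\<dots> \<le> prob {\<omega>\<in>space M. \<not> P n \<omega>} + (exp (\<epsilon> / 2 - \<eta>) + d / real (Suc n))"
      using ED[of n] by simp
    finally show ?thesis .
  qed
  have "(\<lambda>n. d / real (Suc n)) \<longlonglongrightarrow> 0"
    using LIMSEQ_ignore_initial_segment[OF lim_const_over_n[of d], of 1] by simp
  then have "(\<lambda>n. prob {\<omega>\<in>space M. \<not> P n \<omega>} + (exp (\<epsilon> / 2 - \<eta>) + d / real (Suc n))) \<longlonglongrightarrow> 0 + (exp (\<epsilon> / 2 - \<eta>) + 0)"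
    by (intro tendsto_intros P0)
  then have "prob bad \<le> 0 + (exp (\<epsilon> / 2 - \<eta>) + 0)"
    by (rule LIMSEQ_le_const) (use le in blast)
  also have "\<dots> \<le> exp (\<epsilon> - \<eta>)" using \<epsilon> by simp
  finally show ?thesis by (simp add: bad_def)
qed

text \<open>Optimises the preceding estimate for the given horizon. At time 0 the weight is
  \<open>1 / u\<close>, at time \<open>t\<close> it is at least \<open>1 / (2 * K)\<close>; their
  ratio yields the factor \<open>2 * exp (- 2 * \<mu> * t)\<close> on the initial error. The strict
  hypothesis on \<open>w\<close> pays for both \<epsilon> and the strict conclusion.\<close>

lemma dissipative_tail_bound:
  fixes W :: "real \<Rightarrow> 'w \<Rightarrow> real^'m" and V :: "real \<Rightarrow> 'w \<Rightarrow> real^'n"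
    and Z b :: "real \<Rightarrow> 'w \<Rightarrow> real^'l" and H :: "real \<Rightarrow> 'w \<Rightarrow> real^'n^'l" and Q :: "real^'m^'l"
  assumes fps: "filtered_prob_space M F" and bm: "brownian_motion M F (\<lambda>t \<omega>. (W t \<omega>, V t \<omega>))"
    and Z: "continuous_adapted M F Z" and H: "continuous_adapted M F H"
    and Z0: "AE \<omega> in M. Z 0 \<omega> = z0"
    and b: "AE \<omega> in M. continuous_on {0..t} (\<lambda>s. b s \<omega>)"
    and dyn: "AE \<omega> in M. Zfun (\<lambda>(s, s'). (1 / (s' - s)) *\<^sub>R
        (Z s' \<omega> - Z s \<omega> - (Q *v (W s' \<omega> - W s \<omega>) - H s \<omega> *v (V s' \<omega> - V s \<omega>))) - b s \<omega>) (mesh t)"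
    and diss: "AE \<omega> in M. \<forall>s\<in>{0..t}. Z s \<omega> \<bullet> b s \<omega> \<le> - \<mu> * (norm (Z s \<omega>))\<^sup>2"
    and q: "AE \<omega> in M. \<forall>s\<in>{0..t}. (norm Q)\<^sup>2 + (norm (H s \<omega>))\<^sup>2 \<le> q s"
    and contq: "continuous_on {0..t} q"
    and G: "\<And>s. s \<in> {0..t} \<Longrightarrow> (G has_real_derivative 2 * exp (2 * \<mu> * s) * q s) (at s within {0..t})"
    and G0: "G 0 = 0" and G_nonneg: "\<And>s. s \<in> {0..t} \<Longrightarrow> 0 \<le> G s"
    and Gt: "exp (- 2 * \<mu> * t) * G t \<le> K" and K: "K > 0"
    and w: "\<delta> + ln 2 / 2 < w" and \<delta>: "\<delta> \<ge> 0" and t: "t \<ge> 0"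
  shows "measure M {\<omega>\<in>space M. (norm (Z t \<omega>))\<^sup>2 \<le> 2 * exp (- 2 * \<mu> * t) * (norm z0)\<^sup>2 + 2 * K * w} > 1 - exp (- \<delta>)"
proof -
  interpret prob_space M using fps by (simp add: filtered_prob_space_def)
  have Zt[measurable]: "Z t \<in> borel_measurable M"
    using Z fps t measurable_from_subalg unfolding continuous_adapted_def filtered_prob_space_def by blast
  have w_pos: "w > 0" using w \<delta> ln_gt_zero[of "2::real"] by linarith
  show ?thesis
  proof (cases "t = 0")
    \<comment> \<open>Partitions need a positive horizon; at time 0 the bound already holds almost
      surely because \<open>K * w\<close> is positive.\<close>
    case True
    have "AE \<omega> in M. \<omega> \<in> {\<omega>\<in>space M. (norm (Z t \<omega>))\<^sup>2 \<le> 2 * exp (- 2 * \<mu> * t) * (norm z0)\<^sup>2 + 2 * K * w}"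
      using Z0 AE_space
    proof eventually_elim
      case (elim \<omega>)
      have "0 \<le> (norm z0)\<^sup>2 + 2 * K * w" using K w_pos by simp
      then show ?case using elim True by simp
    qed
    then have "prob {\<omega>\<in>space M. (norm (Z t \<omega>))\<^sup>2 \<le> 2 * exp (- 2 * \<mu> * t) * (norm z0)\<^sup>2 + 2 * K * w} = 1"
      by (intro prob_eq_1[THEN iffD2]) auto
    then show ?thesis by simp
  next
    case False
    then have t: "t > 0" using t by simp
    \<comment> \<open>The free initial value of \<open>1 / c\<close>, taken as large as the bound on
      \<open>G t\<close>, so that the denominator at most doubles on \<open>[0, t]\<close>.\<close>
    define u where "u = K * exp (2 * \<mu> * t)"
    have u: "u > 0" using K by (simp add: u_def)
    have uG: "u + G s > 0" if "s \<in> {0..t}" for s using u G_nonneg[OF that] by linarith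
    \<comment> \<open>The required equation is of Bernoulli type: \<open>1 / c\<close> solves the
      linear equation \<open>y' = - 2 \<mu> y + 2 q\<close>, solved by variation of
      constants.\<close>
    define c where "c = (\<lambda>s. exp (2 * \<mu> * s) / (u + G s))"
    define L where "L = (\<lambda>s. ln (u + G s) / 2)"
    have c: "(c has_vector_derivative 2 * \<mu> * c s - 2 * (c s)\<^sup>2 * q s) (at s within {0..t})" if s: "s \<in> {0..t}" for s
    proof -
      have "(c has_real_derivative ((exp (2 * \<mu> * s) * (2 * \<mu>)) * (u + G s) -
          exp (2 * \<mu> * s) * (2 * exp (2 * \<mu> * s) * q s)) / ((u + G s) * (u + G s))) (at s within {0..t})"
        unfolding c_def using uG[OF s] by (auto intro!: derivative_eq_intros G[OF s])
      also have "((exp (2 * \<mu> * s) * (2 * \<mu>)) * (u + G s) - exp (2 * \<mu> * s) * (2 * exp (2 * \<mu> * s) * q s))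
          / ((u + G s) * (u + G s)) = 2 * \<mu> * c s - 2 * (c s)\<^sup>2 * q s"
      proof -
        have "((e * (2 * \<mu>)) * g - e * (2 * e * x)) / (g * g) = 2 * \<mu> * (e / g) - 2 * (e / g)\<^sup>2 * x"
          if "g \<noteq> 0" for e g x :: real
          using that by (simp add: diff_divide_distrib power2_eq_square mult_ac)
        from this[of "u + G s"] show ?thesis using uG[OF s] by (simp add: c_def)
      qed
      finally show ?thesis by (simp add: has_real_derivative_iff_has_vector_derivative)
    qed
    have L: "(L has_vector_derivative c s * q s) (at s within {0..t})" if s: "s \<in> {0..t}" for s
    proof -
      have "(L has_real_derivative (1 / (u + G s) * (2 * exp (2 * \<mu> * s) * q s)) / 2) (at s within {0..t})"
      proof -
        have "((\<lambda>s. u + G s) has_real_derivative 2 * exp (2 * \<mu> * s) * q s) (at s within {0..t})"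
          by (auto intro!: derivative_eq_intros G[OF s])
        from DERIV_cdivide[OF DERIV_chain2[OF DERIV_ln_divide[OF uG[OF s]] this], of 2] show ?thesis
          using uG[OF s] by (simp add: L_def)
      qed
      also have "(1 / (u + G s) * (2 * exp (2 * \<mu> * s) * q s)) / 2 = c s * q s"
      proof -
        have "(1 / g * (2 * e * x)) / 2 = e / g * x" for e g x :: real by simp
        then show ?thesis by (simp only: c_def)
      qed
      finally show ?thesis by (simp add: has_real_derivative_iff_has_vector_derivative)
    qed
    have c_nonneg: "0 \<le> c s" if "s \<in> {0..t}" for s using uG[OF that] by (simp add: c_def)
    \<comment> \<open>\<eta> is what remains of \<open>w\<close> after the cost of \<open>L\<close>;
      half of its excess over \<delta> is spent on \<epsilon>, which keeps the exponent strictly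
      below \<open>- \<delta>\<close>.\<close>
    define \<eta> \<epsilon> where "\<eta> = w - ln 2 / 2" and "\<epsilon> = (\<eta> - \<delta>) / 2"
    have \<epsilon>: "\<epsilon> > 0" "\<epsilon> - \<eta> < - \<delta>" using w by (simp_all add: \<epsilon>_def \<eta>_def field_simps)
    have Gu: "G t \<le> u"
    proof -
      have "exp (2 * \<mu> * t) * (exp (- 2 * \<mu> * t) * G t) \<le> exp (2 * \<mu> * t) * K" using Gt by (intro mult_left_mono) auto
      moreover have "exp (2 * \<mu> * t) * (exp (- 2 * \<mu> * t) * G t) = G t"
        by (simp add: mult.assoc[symmetric] flip: exp_add)
      ultimately show ?thesis unfolding u_def mult.commute[of K] by linarith
    qed
    have Ldiff: "L t - L 0 \<le> ln 2 / 2"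
    proof -
      have "ln (u + G t) \<le> ln (2 * u)" using Gu u uG[of t] t by simp
      then show ?thesis using u by (simp add: L_def G0 ln_mult)
    qed
    have ct: "1 / (2 * K) \<le> c t"
    proof -
      have "exp (2 * \<mu> * t) / (2 * u) \<le> exp (2 * \<mu> * t) / (u + G t)"
        using Gu u uG[of t] t by (intro divide_left_mono) auto
      then show ?thesis using K by (simp add: c_def u_def)
    qed
    define S where "S = {\<omega>\<in>space M. (norm (Z t \<omega>))\<^sup>2 \<le> 2 * exp (- 2 * \<mu> * t) * (norm z0)\<^sup>2 + 2 * K * w}"
    have S: "S \<in> events" unfolding S_def by measurable
    have "space M - S \<subseteq> {\<omega>\<in>space M. c 0 * (norm z0)\<^sup>2 + (L t - L 0) + \<eta> < c t * (norm (Z t \<omega>))\<^sup>2}"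
    proof safe
      fix \<omega> assume \<omega>: "\<omega> \<in> space M" "\<omega> \<notin> S"
      then have "2 * exp (- 2 * \<mu> * t) * (norm z0)\<^sup>2 + 2 * K * w < (norm (Z t \<omega>))\<^sup>2" by (simp add: S_def)
      then have "1 / (2 * K) * (2 * exp (- 2 * \<mu> * t) * (norm z0)\<^sup>2 + 2 * K * w) < 1 / (2 * K) * (norm (Z t \<omega>))\<^sup>2"
        using K by (intro mult_strict_left_mono) auto
      also have "\<dots> \<le> c t * (norm (Z t \<omega>))\<^sup>2" using ct by (intro mult_right_mono) auto
      also have "1 / (2 * K) * (2 * exp (- 2 * \<mu> * t) * (norm z0)\<^sup>2 + 2 * K * w) = c 0 * (norm z0)\<^sup>2 + w"
        using K by (simp add: c_def u_def G0 exp_minus field_simps)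
      finally show "c 0 * (norm z0)\<^sup>2 + (L t - L 0) + \<eta> < c t * (norm (Z t \<omega>))\<^sup>2"
        using Ldiff by (simp add: \<eta>_def)
    qed
    then have "prob (space M - S) \<le> prob {\<omega>\<in>space M. c 0 * (norm z0)\<^sup>2 + (L t - L 0) + \<eta> < c t * (norm (Z t \<omega>))\<^sup>2}"
      by (rule finite_measure_mono) measurable
    also have "\<dots> \<le> exp (\<epsilon> - \<eta>)"
      by (rule dissipative_concentration[OF fps bm Z H Z0 b dyn diss q contq c c_nonneg L t \<epsilon>(1)])
    also have "\<dots> < exp (- \<delta>)" using \<epsilon>(2) by simp
    finally show ?thesis using prob_compl[OF S] by (simp add: S_def)
  qed
qed

section \<open>The Riccati equation\<close>

text \<open>The product of \<open>f\<close> with \<open>exp (- K * s)\<close> does not increase. The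
  rate \<open>K\<close> may be negative, as the decay of the trace requires.\<close>

lemma gronwall_exp:
  fixes f f' :: "real \<Rightarrow> real"
  assumes T: "T \<ge> 0"
    and f: "\<And>s. s \<in> {0..T} \<Longrightarrow> (f has_vector_derivative f' s) (at s within {0..T})"
    and le: "\<And>s. s \<in> {0..T} \<Longrightarrow> f' s \<le> K * f s"
  shows "f T \<le> exp (K * T) * f 0"
proof -
  have D: "((\<lambda>s. exp (- K * s) * f s) has_derivative (\<lambda>h. h * (exp (- K * s) * (f' s - K * f s)))) (at s within {0..T})"
    if "s \<in> {0..T}" for s
    using f[OF that, unfolded has_vector_derivative_def]
    by (auto intro!: derivative_eq_intros simp: algebra_simps)
  obtain s where s: "s \<in> {0..T}"
    "exp (- K * T) * f T - exp (- K * 0) * f 0 = (T - 0) * (exp (- K * s) * (f' s - K * f s))"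
    using mvt_very_simple[OF T, of "\<lambda>s. exp (- K * s) * f s" "\<lambda>s h. h * (exp (- K * s) * (f' s - K * f s))"] D
    by auto
  note s(2)
  also have "\<dots> \<le> 0" using T le[OF s(1)] by (simp add: mult_le_0_iff)
  finally have "exp (- K * T) * f T \<le> f 0" by simp
  then have "exp (K * T) * (exp (- K * T) * f T) \<le> exp (K * T) * f 0"
    by (intro mult_left_mono) auto
  then show ?thesis by (simp add: mult.assoc[symmetric] flip: exp_add)
qed

lemma has_vector_derivative_on_Icc:
  fixes f :: "real \<Rightarrow> 'a::real_normed_vector"
  assumes "\<And>s. s \<ge> 0 \<Longrightarrow> (f has_vector_derivative f' s) (at s within {0..})" "s \<in> {0..T}"
  shows "(f has_vector_derivative f' s) (at s within {0..T})"
  using assms by (intro has_vector_derivative_within_subset[OF assms(1)]) auto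

section \<open>Symmetry, positivity and trace of Riccati solutions\<close>

context
  fixes P a :: "real \<Rightarrow> real^'m^'m" and R :: "real^'m^'m" and r :: real
  assumes a: "continuous_on {0..} a"
    and riccati: "\<And>s. s \<ge> 0 \<Longrightarrow> (P has_vector_derivative
      (a s ** P s + P s ** transpose (a s) + R - P s ** (r *\<^sub>R mat 1) ** P s)) (at s within {0..})"
    and R: "covariance_matrix R" and P0: "covariance_matrix (P 0)" and r: "r \<ge> 0"
begin

lemma riccati_continuous: "continuous_on {0..} P"
  by (rule continuous_on_vector_derivative) (use riccati in auto)

lemma riccati_bounded:
  assumes "T \<ge> 0"
  obtains K where "\<And>s. s \<in> {0..T} \<Longrightarrow> 2 * norm (a s) + r * norm (P s) \<le> K"
proof -
  have "continuous_on {0..T} (\<lambda>s. 2 * norm (a s) + r * norm (P s))"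
    by (intro continuous_intros continuous_on_subset[OF a] continuous_on_subset[OF riccati_continuous]) auto
  then have "bounded ((\<lambda>s. 2 * norm (a s) + r * norm (P s)) ` {0..T})"
    by (intro compact_imp_bounded compact_continuous_image) auto
  then obtain K where K: "\<forall>s\<in>{0..T}. \<bar>2 * norm (a s) + r * norm (P s)\<bar> \<le> K"
    unfolding bounded_iff by auto
  show thesis by (rule that[of K]) (use K in force)
qed

text \<open>Transposition maps solutions to solutions, so the difference \<open>E\<close> of the two
  solves a linear homogeneous equation with zero initial value, and Gronwall applies to its squared
  norm. Symmetry comes first because the positivity argument needs null vectors of symmetric
  forms.\<close>

lemma riccati_symmetric:
  assumes T: "T \<ge> 0"
  shows "transpose (P T) = P T"
proof -
  define E where "E = (\<lambda>s. P s - transpose (P s))"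
  \<comment> \<open>The difference of the quadratic terms is linear in \<open>E\<close>, since
    \<open>P P - P^T P^T = P (P - P^T) + (P - P^T) P^T\<close>.\<close>
  define E' where "E' = (\<lambda>s. a s ** E s + E s ** transpose (a s) - r *\<^sub>R (P s ** E s + E s ** transpose (P s)))"
  have E: "(E has_vector_derivative E' s) (at s within {0..T})" if "s \<in> {0..T}" for s
  proof -
    note d = has_vector_derivative_on_Icc[OF riccati that]
    have "(E has_vector_derivative (a s ** P s + P s ** transpose (a s) + R - P s ** (r *\<^sub>R mat 1) ** P s)
      - transpose (a s ** P s + P s ** transpose (a s) + R - P s ** (r *\<^sub>R mat 1) ** P s)) (at s within {0..T})"
      unfolding E_def
      by (intro has_vector_derivative_diff bounded_linear.has_vector_derivative[OF bounded_linear_transpose] d) auto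
    moreover have "transpose R = R" using R by (simp add: covariance_matrix_def symmetric_matrix_def)
    ultimately show ?thesis
      by (simp add: E_def E'_def linear_add[OF bounded_linear.linear[OF bounded_linear_transpose]]
          linear_diff[OF bounded_linear.linear[OF bounded_linear_transpose]] matrix_transpose_mul transpose_scalar
          mm.diff_left mm.diff_right mm.scaleR_left mm.scaleR_right algebra_simps)
  qed
  obtain K where K: "\<And>s. s \<in> {0..T} \<Longrightarrow> 2 * norm (a s) + r * norm (P s) \<le> K"
    using riccati_bounded[OF T] by blast
  have "(norm (E T))\<^sup>2 \<le> exp ((4 * K) * T) * (norm (E 0))\<^sup>2"
  proof (rule gronwall_exp[OF T])
    fix s assume s: "s \<in> {0..T}"
    show "((\<lambda>s. (norm (E s))\<^sup>2) has_vector_derivative 2 * (E s \<bullet> E' s)) (at s within {0..T})"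
      unfolding power2_norm_eq_inner
      using bounded_bilinear.has_vector_derivative[OF bounded_bilinear_inner E[OF s] E[OF s]]
      by (simp add: inner_commute)
    have "norm (E' s) \<le> norm (a s ** E s) + norm (E s ** transpose (a s)) + norm (r *\<^sub>R (P s ** E s + E s ** transpose (P s)))"
      unfolding E'_def by (rule order_trans[OF norm_triangle_ineq4 add_right_mono[OF norm_triangle_ineq]])
    also have "norm (a s ** E s) \<le> norm (a s) * norm (E s)" by (rule norm_matrix_mult_le)
    also have "norm (E s ** transpose (a s)) \<le> norm (E s) * norm (a s)"
      using norm_matrix_mult_le[of "E s" "transpose (a s)"] by simp
    also have "norm (r *\<^sub>R (P s ** E s + E s ** transpose (P s))) \<le> r * (norm (P s) * norm (E s) + norm (E s) * norm (P s))"
    proof -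
      have "norm (P s ** E s + E s ** transpose (P s)) \<le> norm (P s) * norm (E s) + norm (E s) * norm (P s)"
        using norm_matrix_mult_le[of "E s" "transpose (P s)"]
        by (intro norm_triangle_mono norm_matrix_mult_le) simp
      then show ?thesis using r by (simp add: mult_left_mono del: distrib_left)
    qed
    finally have "norm (E' s) \<le> 2 * (norm (a s) + r * norm (P s)) * norm (E s)"
      by (simp add: algebra_simps)
    also have "\<dots> \<le> (2 * K) * norm (E s)"
      using K[OF s] r by (intro mult_right_mono mult_left_mono) (auto intro: order_trans[rotated])
    finally have "norm (E s) * norm (E' s) \<le> norm (E s) * ((2 * K) * norm (E s))" by (intro mult_left_mono) auto
    then show "2 * (E s \<bullet> E' s) \<le> (4 * K) * (norm (E s))\<^sup>2"
      using norm_cauchy_schwarz[of "E s" "E' s"] by (simp add: power2_eq_square algebra_simps)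
  qed
  moreover have "E 0 = 0" using P0 by (simp add: E_def covariance_matrix_def symmetric_matrix_def)
  ultimately have "norm (E T) = 0" by simp
  then show ?thesis by (simp add: E_def)
qed

text \<open>
  At the first time where \<open>P + \<epsilon> e\<^sup>\<kappa>\<^sup>s Id\<close> has a null vector \<open>v\<close>, the quadratic form at \<open>v\<close> would have a
  positive derivative, although it decreases to zero.
\<close>

lemma riccati_perturbed_pos:
  assumes T: "T \<ge> 0" and \<epsilon>: "\<epsilon> > 0" and K: "\<And>s. s \<in> {0..T} \<Longrightarrow> 2 * norm (a s) + r * norm (P s) \<le> K"
    and v: "norm v = 1" and s: "s \<in> {0..T}"
  shows "0 < v \<bullet> (P s *v v) + \<epsilon> * exp ((K + 1) * s)"
proof (rule ccontr)
  define h where "h = (\<lambda>s v. v \<bullet> (P s *v v) + \<epsilon> * exp ((K + 1) * s) * (v \<bullet> v))"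
  \<comment> \<open>Times paired with unit directions in which the perturbed form fails to be
    positive. Compactness yields an earliest such time together with a direction.\<close>
  define B where "B = {x \<in> {0..T} \<times> sphere 0 1. h (fst x) (snd x) \<le> 0}"
  assume "\<not> 0 < v \<bullet> (P s *v v) + \<epsilon> * exp ((K + 1) * s)"
  then have "(s, v) \<in> B" using v s by (simp add: B_def h_def norm_eq_1)
  have cont: "continuous_on ({0..T} \<times> sphere 0 1) (\<lambda>x. h (fst x) (snd x))"
    unfolding h_def
    by (intro continuous_intros bounded_bilinear.continuous_on[OF bounded_bilinear_matrix_vector_mult]
        continuous_on_compose2[OF riccati_continuous]) auto
  have "compact ({0..T} \<times> sphere (0 :: real^'m) 1)" by (intro compact_Times) auto
  moreover have "closed B"
    unfolding B_def
    by (intro continuous_on_closed_Collect_le cont continuous_intros closed_Times) auto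
  ultimately have "compact B"
    using compact_Int_closed[of "{0..T} \<times> sphere 0 1" B] by (simp add: B_def Int_absorb1 Collect_restrict)
  then obtain x where x: "x \<in> B" and x_min: "\<And>y. y \<in> B \<Longrightarrow> fst x \<le> fst y"
    using continuous_attains_inf[of B fst] \<open>(s, v) \<in> B\<close> continuous_on_fst[OF continuous_on_id] by blast
  obtain s0 w where sw: "x = (s0, w)" by (cases x)
  have s0: "s0 \<in> {0..T}" and w: "norm w = 1" and h0: "h s0 w \<le> 0"
    using x by (auto simp: B_def sw)
  have pos: "0 < h s v" if "0 \<le> s" "s < s0" "norm v = 1" for s v
  proof (rule ccontr)
    assume "\<not> 0 < h s v"
    then have "(s, v) \<in> B" using that s0 by (simp add: B_def)
    then show False using x_min that by (fastforce simp: sw)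
  qed
  have "h 0 w > 0"
    using P0 w \<epsilon> by (simp add: h_def covariance_matrix_def norm_eq_1 add_nonneg_pos)
  then have s0_pos: "s0 > 0" using h0 s0 by (cases "s0 = 0") auto
  have h_cont: "continuous_on {0..T} (\<lambda>s. h s v)" for v
    unfolding h_def
    by (intro continuous_intros bounded_bilinear.continuous_on[OF bounded_bilinear_matrix_vector_mult]
        continuous_on_subset[OF riccati_continuous]) auto
  define N where "N = P s0 + (\<epsilon> * exp ((K + 1) * s0)) *\<^sub>R mat 1"
  have Nv: "N *v v = P s0 *v v + (\<epsilon> * exp ((K + 1) * s0)) *\<^sub>R v" for v
    by (simp add: N_def matrix_vector_mult_add_rdistrib flip: scaleR_matrix_vector_assoc)
  have hN: "h s0 v = v \<bullet> (N *v v)" for v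
    by (simp add: h_def Nv inner_add_right)
  \<comment> \<open>A left limit of positive values, in every direction; hence the perturbed matrix
    \<open>N\<close> is still semidefinite at \<open>s0\<close> and its isotropic direction
    \<open>w\<close> is a null vector.\<close>
  have nonneg1: "0 \<le> h s0 v" if "norm v = 1" for v
  proof (rule tendsto_lowerbound[where F = "at_left s0"])
    have "continuous (at s0 within {0..s0}) (\<lambda>s. h s v)"
    proof (rule continuous_within_subset)
      show "continuous (at s0 within {0..T}) (\<lambda>s. h s v)"
        using h_cont[of v] s0 by (auto simp: continuous_on_eq_continuous_within)
    qed (use s0 in auto)
    then show "((\<lambda>s. h s v) \<longlongrightarrow> h s0 v) (at_left s0)"
      using s0_pos by (simp add: continuous_within at_within_Icc_at_left)
    show "\<forall>\<^sub>F s in at_left s0. 0 \<le> h s v"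
      unfolding eventually_at_left_field
      by (rule exI[of _ 0]) (use s0_pos pos that in \<open>auto intro: less_imp_le\<close>)
  qed simp
  have "0 \<le> v \<bullet> (N *v v)" for v
  proof (cases "v = 0")
    case False
    then have "0 \<le> h s0 ((1 / norm v) *\<^sub>R v)" by (intro nonneg1) simp
    also have "\<dots> = (1 / norm v)\<^sup>2 * (v \<bullet> (N *v v))"
      by (simp add: hN matrix_vector_mult_scaleR power2_eq_square)
    finally show ?thesis using False by (simp add: zero_le_mult_iff)
  qed simp
  then have N: "covariance_matrix N"
    unfolding covariance_matrix_def symmetric_matrix_def
    using riccati_symmetric[of s0] s0
    by (simp add: N_def linear_add[OF bounded_linear.linear[OF bounded_linear_transpose]] transpose_scalar)
  have hw: "h s0 w = 0" using h0 nonneg1[OF w] by simp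
  then have Nw: "N *v w = 0" by (intro covariance_matrix_kernel N) (simp add: hN)
  define l where "l = w \<bullet> ((a s0 ** P s0 + P s0 ** transpose (a s0) + R - P s0 ** (r *\<^sub>R mat 1) ** P s0) *v w)
    + \<epsilon> * ((K + 1) * exp ((K + 1) * s0)) * (w \<bullet> w)"
  have "((\<lambda>s. P s *v w) has_vector_derivative
      (a s0 ** P s0 + P s0 ** transpose (a s0) + R - P s0 ** (r *\<^sub>R mat 1) ** P s0) *v w) (at s0 within {0..T})"
    by (rule bounded_linear.has_vector_derivative[OF
          bounded_bilinear.bounded_linear_left[OF bounded_bilinear_matrix_vector_mult]
          has_vector_derivative_on_Icc[OF riccati s0]]) auto
  then have "((\<lambda>s. w \<bullet> (P s *v w)) has_vector_derivative
      w \<bullet> ((a s0 ** P s0 + P s0 ** transpose (a s0) + R - P s0 ** (r *\<^sub>R mat 1) ** P s0) *v w)) (at s0 within {0..T})"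
    by (rule bounded_linear.has_vector_derivative[OF bounded_linear_inner_right])
  then have "((\<lambda>s. h s w) has_real_derivative l) (at s0 within {0..T})"
    unfolding h_def l_def has_real_derivative_iff_has_vector_derivative[symmetric]
    by (auto intro!: derivative_eq_intros)
  moreover have "l > 0"
  proof -
    define e where "e = \<epsilon> * exp ((K + 1) * s0)"
    have e: "e > 0" using \<epsilon> by (simp add: e_def)
    \<comment> \<open>Every term of the derivative except the one with \<open>R\<close> now becomes
      a multiple of \<open>e\<close>.\<close>
    have Pw: "P s0 *v w = - (e *\<^sub>R w)"
      using Nw by (simp add: Nv e_def eq_neg_iff_add_eq_0)
    have sym: "transpose (P s0) = P s0" using riccati_symmetric[of s0] s0 by simp
    have "l = w \<bullet> (a s0 *v (P s0 *v w)) + w \<bullet> (P s0 *v (transpose (a s0) *v w)) + w \<bullet> (R *v w)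
        - r * (w \<bullet> (P s0 *v (P s0 *v w))) + e * (K + 1)"
      using w by (simp add: l_def e_def norm_eq_1 matrix_vector_mult_add_rdistrib matrix_vector_mult_diff_rdistrib
          mm.scaleR_left mm.scaleR_right inner_add_right inner_diff_right matrix_vector_mul_assoc
          del: transpose_matrix_vector flip: scaleR_matrix_vector_assoc)
    also have "w \<bullet> (P s0 *v (transpose (a s0) *v w)) = (P s0 *v w) \<bullet> (transpose (a s0) *v w)"
      using inner_matrix_transpose[of w "P s0"] sym by (simp del: transpose_matrix_vector)
    also have "w \<bullet> (P s0 *v (P s0 *v w)) = (P s0 *v w) \<bullet> (P s0 *v w)"
      using inner_matrix_transpose[of w "P s0"] sym by (simp del: transpose_matrix_vector)
    also have "(P s0 *v w) \<bullet> (transpose (a s0) *v w) = - e * (w \<bullet> (a s0 *v w))"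
      unfolding Pw by (simp add: dot_lmul_matrix inner_commute[of w "w v* a s0"])
    also have "w \<bullet> (a s0 *v (P s0 *v w)) = - e * (w \<bullet> (a s0 *v w))"
      unfolding Pw by (simp add: matrix_vector_mult_scaleR linear_neg[OF matrix_vector_mul_linear])
    also have "(P s0 *v w) \<bullet> (P s0 *v w) = e * norm (P s0 *v w)"
      using e w by (simp add: Pw norm_eq_1)
    \<comment> \<open>\<open>K\<close> absorbs the coefficient and the quadratic term; the
      additional 1 in the exponent \<open>K + 1\<close> makes the derivative strictly
      positive.\<close>
    finally have l: "l = e * (1 + (K - 2 * (w \<bullet> (a s0 *v w)) - r * norm (P s0 *v w))) + w \<bullet> (R *v w)"
      by (simp add: algebra_simps)
    have "w \<bullet> (a s0 *v w) \<le> norm (a s0)"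
      using norm_cauchy_schwarz[of w "a s0 *v w"] norm_matrix_vector_le[of "a s0" w] w by simp
    moreover have "norm (P s0 *v w) \<le> norm (P s0)"
      using norm_matrix_vector_le[of "P s0" w] w by simp
    then have "r * norm (P s0 *v w) \<le> r * norm (P s0)" using r by (intro mult_left_mono)
    ultimately have "0 \<le> K - 2 * (w \<bullet> (a s0 *v w)) - r * norm (P s0 *v w)"
      using K[OF s0] by linarith
    then have "0 < e * (1 + (K - 2 * (w \<bullet> (a s0 *v w)) - r * norm (P s0 *v w)))"
      using e by (intro mult_pos_pos) auto
    then show ?thesis unfolding l using R by (simp add: covariance_matrix_def add_pos_nonneg)
  qed
  ultimately obtain d where d: "d > 0" "\<And>k. k > 0 \<Longrightarrow> s0 - k \<in> {0..T} \<Longrightarrow> k < d \<Longrightarrow> h (s0 - k) w < h s0 w"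
    by (metis has_real_derivative_pos_inc_left)
  define k where "k = min (d / 2) s0"
  have "h (s0 - k) w < h s0 w"
    using d(1) s0_pos s0 by (intro d(2)) (auto simp: k_def)
  moreover have "0 < h (s0 - k) w"
    using d(1) s0_pos w by (intro pos) (auto simp: k_def)
  ultimately show False using hw by simp
qed

text \<open>The perturbation tends to zero: its size is chosen so that at time \<open>T\<close> it
  amounts to an arbitrary \<open>e\<close>.\<close>

lemma riccati_covariance:
  assumes T: "T \<ge> 0"
  shows "covariance_matrix (P T)"
proof -
  obtain K where K: "\<And>s. s \<in> {0..T} \<Longrightarrow> 2 * norm (a s) + r * norm (P s) \<le> K"
    using riccati_bounded[OF T] by blast
  have 1: "0 \<le> v \<bullet> (P T *v v)" if v: "norm v = 1" for v
  proof (rule field_le_epsilon)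
    fix e :: real assume e: "e > 0"
    have "0 < v \<bullet> (P T *v v) + (e * exp (- ((K + 1) * T))) * exp ((K + 1) * T)"
      by (rule riccati_perturbed_pos[OF T _ K v]) (use e T in auto)
    also have "(e * exp (- ((K + 1) * T))) * exp ((K + 1) * T) = e"
      by (simp add: exp_minus)
    finally show "0 \<le> v \<bullet> (P T *v v) + e" by simp
  qed
  have "0 \<le> v \<bullet> (P T *v v)" for v
  proof (cases "v = 0")
    case False
    then have "0 \<le> ((1 / norm v) *\<^sub>R v) \<bullet> (P T *v ((1 / norm v) *\<^sub>R v))" by (intro 1) simp
    also have "\<dots> = (1 / norm v)\<^sup>2 * (v \<bullet> (P T *v v))"
      by (simp add: matrix_vector_mult_scaleR power2_eq_square)
    finally show ?thesis using False by (simp add: zero_le_mult_iff)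
  qed simp
  then show ?thesis
    using riccati_symmetric[OF T] by (simp add: covariance_matrix_def symmetric_matrix_def)
qed

lemma riccati_trace_le:
  assumes T: "T \<ge> 0" and l: "l > 0"
    and neg: "\<And>s v. s \<ge> 0 \<Longrightarrow> v \<bullet> ((a s + transpose (a s)) *v v) \<le> - l * (norm v)\<^sup>2"
  shows "trace (P T) \<le> exp (- l * T) * trace (P 0) + trace R / l"
proof -
  define P' where "P' = (\<lambda>s. a s ** P s + P s ** transpose (a s) + R - P s ** (r *\<^sub>R mat 1) ** P s)"
  have "trace (P T) - trace R / l \<le> exp (- l * T) * (trace (P 0) - trace R / l)"
  proof (rule gronwall_exp[OF T])
    fix s assume s: "s \<in> {0..T}"
    have "((\<lambda>s. trace (P s)) has_vector_derivative trace (P' s)) (at s within {0..T})"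
      unfolding P'_def
      by (rule bounded_linear.has_vector_derivative[OF bounded_linear_trace
            has_vector_derivative_on_Icc[OF riccati s]]) auto
    then show "((\<lambda>s. trace (P s) - trace R / l) has_vector_derivative trace (P' s)) (at s within {0..T})"
      by (auto intro!: derivative_eq_intros)
    have cov: "covariance_matrix (P s)" using riccati_covariance s by simp
    have tr: "trace (K + L) = trace K + trace L" "trace (K - L) = trace K - trace L" "trace (c *\<^sub>R K) = c * trace K"
      for K L :: "real^'m^'m" and c
      by (simp_all add: trace_def sum.distrib sum_subtractf sum_distrib_left)
    have sym: "transpose (P s) = P s" using cov by (simp add: covariance_matrix_def symmetric_matrix_def)
    have comm: "trace (P s ** transpose (a s)) = trace (transpose (a s) ** P s)" by (rule trace_mul_sym)
    \<comment> \<open>Only the symmetric part of \<open>a\<close> is controlled, so the two linear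
      terms are combined by cyclicity before testing against the semidefinite
      \<open>P s\<close>.\<close>
    have "0 \<le> trace ((- l *\<^sub>R mat 1 - (a s + transpose (a s))) ** P s)"
    proof (rule trace_mult_covariance_nonneg[OF _ cov])
      fix v
      show "0 \<le> v \<bullet> ((- l *\<^sub>R mat 1 - (a s + transpose (a s))) *v v)"
        using neg[of s v] s
        by (simp add: matrix_vector_mult_diff_rdistrib inner_diff_right power2_norm_eq_inner
            bounded_bilinear.minus_left[OF bounded_bilinear_matrix_vector_mult]
            del: transpose_matrix_vector flip: scaleR_matrix_vector_assoc)
    qed
    also have "\<dots> = - l * trace (P s) - (trace (a s ** P s) + trace (P s ** transpose (a s)))"
      unfolding comm by (simp add: mm.diff_left mm.add_left mm.scaleR_left mm.minus_left tr flip: scaleR_minus_left)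
    finally have 1: "trace (a s ** P s) + trace (P s ** transpose (a s)) \<le> - l * trace (P s)" by simp
    have "trace (P s ** (r *\<^sub>R mat 1) ** P s) = r * (norm (P s))\<^sup>2"
      unfolding norm_matrix_eq_trace sym by (simp add: mm.scaleR_left mm.scaleR_right tr)
    then have "trace (P' s) \<le> - l * trace (P s) + trace R"
      unfolding P'_def tr using 1 mult_nonneg_nonneg[OF r zero_le_power2[of "norm (P s)"]] by linarith
    then show "trace (P' s) \<le> - l * (trace (P s) - trace R / l)"
      using l by (simp add: algebra_simps)
  qed
  moreover have "0 \<le> exp (- l * T) * (trace R / l)"
    using covariance_matrix_trace_nonneg[OF R] l by simp
  ultimately show ?thesis by (simp add: algebra_simps)
qed

end

section \<open>The filter\<close>

text \<open>Where the limits differ, some gap \<open>1 / Suc j\<close> persists for all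
  \<open>n\<close> beyond some \<open>N\<close>. That event lies inside single deviation events of
  vanishing probability, and there are only countably many pairs \<open>N\<close>,
  \<open>j\<close>.\<close>

lemma (in prob_space) converges_in_probability_unique:
  assumes X: "converges_in_probability M X L" and J: "AE \<omega> in M. (\<lambda>n. X n \<omega>) \<longlonglongrightarrow> J \<omega>"
  shows "AE \<omega> in M. L \<omega> = J \<omega>"
proof -
  have [measurable]: "X n \<in> borel_measurable M" "L \<in> borel_measurable M" for n
    using X by (auto simp: converges_in_probability_def)
  have "AE \<omega> in M. \<not> (\<forall>n\<ge>N. norm (X n \<omega> - L \<omega>) > 1 / real (Suc j))" for N j :: nat
  proof -
    define S where "S = {\<omega>\<in>space M. \<forall>n\<ge>N. norm (X n \<omega> - L \<omega>) > 1 / real (Suc j)}"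
    have S: "S \<in> events" unfolding S_def by measurable
    have "(\<lambda>n. prob {\<omega>\<in>space M. norm (X n \<omega> - L \<omega>) > 1 / real (Suc j)}) \<longlonglongrightarrow> 0"
      using X by (simp add: converges_in_probability_def)
    then have "prob S \<le> 0"
    proof (rule LIMSEQ_le_const)
      have "prob S \<le> prob {\<omega>\<in>space M. norm (X n \<omega> - L \<omega>) > 1 / real (Suc j)}" if "n \<ge> N" for n
        by (rule finite_measure_mono) (use that in \<open>auto simp: S_def\<close>)
      then show "\<exists>N. \<forall>n\<ge>N. prob S \<le> prob {\<omega>\<in>space M. norm (X n \<omega> - L \<omega>) > 1 / real (Suc j)}" by blast
    qed
    then have "AE \<omega> in M. \<omega> \<notin> S" using S prob_eq_0[OF S] measure_nonneg[of M S] by auto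
    then show ?thesis using AE_space by eventually_elim (simp add: S_def)
  qed
  then have "AE \<omega> in M. \<forall>N j. \<not> (\<forall>n\<ge>N. norm (X n \<omega> - L \<omega>) > 1 / real (Suc j))"
    by (simp add: AE_all_countable)
  then show ?thesis using J
  proof eventually_elim
    case (elim \<omega>)
    show ?case
    proof (rule ccontr)
      assume "L \<omega> \<noteq> J \<omega>"
      then obtain j where j: "1 / real (Suc j) < norm (J \<omega> - L \<omega>)"
        using nat_approx_posE[of "norm (J \<omega> - L \<omega>)"] by auto
      have "(\<lambda>n. norm (X n \<omega> - L \<omega>)) \<longlonglongrightarrow> norm (J \<omega> - L \<omega>)"
        by (intro tendsto_intros elim(2))
      then have "eventually (\<lambda>n. 1 / real (Suc j) < norm (X n \<omega> - L \<omega>)) sequentially"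
        using j by (rule order_tendstoD)
      then show False using elim(1) unfolding eventually_sequentially by blast
    qed
  qed
qed

text \<open>For an integrand of finite variation the Ito integral is pathwise: integrate by parts.\<close>

lemma ito_integral_by_parts:
  fixes H :: "real \<Rightarrow> 'w \<Rightarrow> real^'n^'m"
  assumes M: "prob_space M" and I: "has_ito_integral M F H y I"
    and D: "AE \<omega> in M. (\<forall>s\<ge>0. ((\<lambda>s. H s \<omega>) has_vector_derivative D s \<omega>) (at s within {0..})) \<and>
        continuous_on {0..} (\<lambda>s. D s \<omega>)"
  shows "AE \<omega> in M. \<forall>s\<ge>0. I s \<omega> = H s \<omega> *v y s \<omega> - integral {0..s} (\<lambda>r. D r \<omega> *v y r \<omega>) - H 0 \<omega> *v y 0 \<omega>"
proof -
  interpret prob_space M by fact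
  define J where "J = (\<lambda>s \<omega>. H s \<omega> *v y s \<omega> - integral {0..s} (\<lambda>r. D r \<omega> *v y r \<omega>))"
  \<comment> \<open>At each fixed time the identity holds only up to a null set depending on that
    time; it is collected over a countable dense set and extended by continuity of both
    sides.\<close>
  define S where "S = (\<rat> \<inter> {0<..} :: real set)"
  have cy: "continuous_on {0..} (\<lambda>s. y s \<omega>)" and cI: "continuous_on {0..} (\<lambda>s. I s \<omega>)"
      and cH: "continuous_on {0..} (\<lambda>s. H s \<omega>)" if "\<omega> \<in> space M" for \<omega>
    using I that by (auto simp: has_ito_integral_def continuous_adapted_def)
  have rat: "AE \<omega> in M. I s \<omega> = J s \<omega> - J 0 \<omega>" if s: "s > 0" for s
  proof (rule converges_in_probability_unique)
    show "converges_in_probability M (\<lambda>n \<omega>. \<Sum>k<Suc n. H (s * real k / real (Suc n)) \<omega> *v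
        (y (s * real (Suc k) / real (Suc n)) \<omega> - y (s * real k / real (Suc n)) \<omega>)) (I s)"
    proof -
      have "\<forall>N \<tau>. partition_sequence s N \<tau> \<longrightarrow> converges_in_probability M
          (\<lambda>n \<omega>. \<Sum>k<N n. H (\<tau> n k) \<omega> *v (y (\<tau> n (Suc k)) \<omega> - y (\<tau> n k) \<omega>)) (I s)"
        using I s unfolding has_ito_integral_def by simp
      from this[rule_format, OF partition_sums(1)[OF s]] show ?thesis .
    qed
    show "AE \<omega> in M. (\<lambda>n. \<Sum>k<Suc n. H (s * real k / real (Suc n)) \<omega> *v
        (y (s * real (Suc k) / real (Suc n)) \<omega> - y (s * real k / real (Suc n)) \<omega>)) \<longlonglongrightarrow> J s \<omega> - J 0 \<omega>"
      using D AE_space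
    proof eventually_elim
      case (elim \<omega>)
      have "continuous_on {0..s} (\<lambda>s. y s \<omega>)" "continuous_on {0..s} (\<lambda>s. D s \<omega>)"
        using elim cy[of \<omega>] by (auto intro: continuous_on_subset[where s = "{0..}"])
      moreover have "((\<lambda>s. H s \<omega>) has_vector_derivative D r \<omega>) (at r within {0..s})" if "r \<in> {0..s}" for r
        using has_vector_derivative_on_Icc[of "\<lambda>s. H s \<omega>" "\<lambda>s. D s \<omega>", OF _ that] elim(1) by blast
      ultimately show ?case unfolding J_def
        by (intro partition_sum_tendsto[OF s] Zfun_mesh_by_parts)
    qed
  qed
  have "AE \<omega> in M. \<forall>s\<in>S. I s \<omega> = J s \<omega> - J 0 \<omega>"
    by (rule AE_ball_countable[THEN iffD2]) (use rat countable_rat in \<open>auto simp: S_def\<close>)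
  then show ?thesis using D AE_space
  proof eventually_elim
    case (elim \<omega>)
    have "closure S \<subseteq> {0..}" by (rule closure_minimal) (auto simp: S_def)
    moreover have "{0..} \<subseteq> closure S"
    proof
      fix s :: real assume "s \<in> {0..}"
      show "s \<in> closure S"
        unfolding closure_approachable
      proof (intro allI impI)
        fix e :: real assume "e > 0"
        then obtain r where "r \<in> \<rat>" "s < r" "r < s + e" using Rats_dense_in_real[of s "s + e"] by auto
        then show "\<exists>y\<in>S. dist y s < e" using \<open>s \<in> {0..}\<close> by (intro bexI[of _ r]) (auto simp: S_def dist_real_def)
      qed
    qed
    ultimately have clS: "closure S = {0..}" by blast
    have Dy: "continuous_on {0..} (\<lambda>r. D r \<omega> *v y r \<omega>)"
      using elim cy by (intro bounded_bilinear.continuous_on[OF bounded_bilinear_matrix_vector_mult]) auto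
    have "continuous_on {0..} (\<lambda>s. integral {0..s} (\<lambda>r. D r \<omega> *v y r \<omega>))"
    proof (rule continuous_on_vector_derivative)
      fix s :: real assume s: "s \<in> {0..}"
      have *: "((\<lambda>s. integral {0..s} (\<lambda>r. D r \<omega> *v y r \<omega>)) has_vector_derivative D s \<omega> *v y s \<omega>) (at s within {0..s + 1})"
        using s by (intro integral_has_vector_derivative continuous_on_subset[OF Dy]) auto
      show "((\<lambda>s. integral {0..s} (\<lambda>r. D r \<omega> *v y r \<omega>)) has_vector_derivative D s \<omega> *v y s \<omega>) (at s within {0..})"
      proof -
        have "at s within {0..s + 1} = at s within {0..}"
          by (rule at_within_nhd[of s "{..<s + 1}"]) auto
        then show ?thesis using * by simp
      qed
    qed
    then have "continuous_on (closure S) (\<lambda>s. I s \<omega> - (J s \<omega> - J 0 \<omega>))"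
      unfolding clS J_def using elim cI cy cH
      by (intro continuous_intros bounded_bilinear.continuous_on[OF bounded_bilinear_matrix_vector_mult]) auto
    then have "I s \<omega> - (J s \<omega> - J 0 \<omega>) = 0" if "s \<in> closure S" for s
      by (rule continuous_constant_on_closure) (use elim that in auto)
    then show ?case unfolding clS by (simp add: J_def)
  qed
qed

section \<open>The constants of the two bounds\<close>

text \<open>With \<open>exp 2 \<ge> 5\<close> and \<open>sqrt 2 \<le> 3 / 2\<close>, half of
  \<open>varpi \<delta>\<close> is at least \<open>5 / 6 + 5 / 3 * \<delta>\<close>, whereas
  \<open>ln 2 / 2\<close> is at most \<open>1 / 2\<close>.\<close>

lemma varpi_gt:
  assumes "\<delta> \<ge> 0"
  shows "\<delta> + ln 2 / 2 < varpi \<delta> / 2" "varpi \<delta> > 0"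
proof -
  have "5 \<le> exp (2::real)" using exp_lower_Taylor_quadratic[of 2] by simp
  moreover have "sqrt 2 \<le> 3 / (2::real)" by (rule real_le_lsqrt) (auto simp: power2_eq_square)
  ultimately have "5 / (3 / 2) \<le> exp 2 / sqrt (2::real)" by (intro frac_le) auto
  then have "5 / (3 / 2) * (1 / 2 + \<delta>) \<le> varpi \<delta>"
    unfolding varpi_def using assms by (intro mult_mono) auto
  moreover have "ln 2 \<le> (1::real)" using ln_add_one_self_le_self[of 1] by simp
  ultimately show "\<delta> + ln 2 / 2 < varpi \<delta> / 2" "varpi \<delta> > 0" using assms by auto
qed

text \<open>\<open>growth_kernel a b s\<close> is the integral of \<open>exp (2 (a - b) r)\<close> over \<open>0 \<le> r \<le> s\<close>.\<close>

definition growth_kernel :: "real \<Rightarrow> real \<Rightarrow> real \<Rightarrow> real" where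
  "growth_kernel a b s = (if a = b then s else (exp (2 * (a - b) * s) - 1) / (2 * (a - b)))"

lemma growth_kernel_derivative:
  "(growth_kernel a b has_real_derivative exp (2 * (a - b) * s)) (at s within X)"
proof (cases "a = b")
  case True
  then show ?thesis unfolding growth_kernel_def[abs_def] by (auto intro!: derivative_eq_intros)
next
  case False
  then show ?thesis unfolding growth_kernel_def[abs_def] by (auto intro!: derivative_eq_intros)
qed

lemma growth_kernel_nonneg:
  assumes "s \<ge> 0"
  shows "0 \<le> growth_kernel a b s"
proof (cases "a < b")
  case True
  then have "exp (2 * (a - b) * s) \<le> 1" using assms by (simp add: mult_nonpos_nonneg)
  then show ?thesis using True by (simp add: growth_kernel_def divide_nonpos_neg)
next
  case False
  then have "1 \<le> exp (2 * (a - b) * s)" using assms by simp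
  then show ?thesis using False assms by (simp add: growth_kernel_def)
qed

text \<open>A difference of squares: with \<open>x\<close> and \<open>y\<close> the two decaying
  exponentials, the left side is at most the quotient for \<open>x\<close> and \<open>y\<close>
  times their mean \<open>(x + y) / 2\<close>, which does not exceed 1.\<close>

lemma growth_kernel_le_exp_quotient:
  assumes a: "a \<ge> 0" and b: "b \<ge> 0" and t: "t \<ge> 0"
  shows "exp (- 2 * a * t) * growth_kernel a b t \<le> exp_quotient a b t"
proof (cases "a = b")
  case True
  have "exp (- 2 * a * t) \<le> exp (- a * t)" using a t by (simp add: mult_nonneg_nonneg)
  then show ?thesis using True t by (simp add: growth_kernel_def exp_quotient_def mult.commute mult_left_mono)
next
  case False
  define x y where "x = exp (- a * t)" and "y = exp (- b * t)"
  have xy: "0 < x" "x \<le> 1" "0 < y" "y \<le> 1" using a b t by (simp_all add: x_def y_def)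
  have "exp (- 2 * a * t) * growth_kernel a b t = (y\<^sup>2 - x\<^sup>2) / (2 * (a - b))"
  proof -
    have "exp (- 2 * a * t) = x\<^sup>2" by (simp add: x_def flip: exp_double)
    moreover have "exp (- 2 * a * t) * exp (2 * (a - b) * t) = y\<^sup>2"
      by (simp add: y_def algebra_simps flip: exp_add exp_double)
    ultimately show ?thesis using False by (simp add: growth_kernel_def right_diff_distrib)
  qed
  also have "\<dots> \<le> \<bar>(y\<^sup>2 - x\<^sup>2) / (2 * (a - b))\<bar>" by (rule abs_ge_self)
  also have "\<dots> = \<bar>x - y\<bar> / \<bar>a - b\<bar> * ((x + y) / 2)"
  proof -
    have "\<bar>y\<^sup>2 - x\<^sup>2\<bar> = \<bar>x - y\<bar> * (x + y)"
      using xy by (simp add: power2_eq_square square_diff_square_factored abs_mult abs_minus_commute mult.commute add.commute)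
    then show ?thesis by (simp add: abs_mult del: right_diff_distrib_numeral)
  qed
  also have "\<dots> \<le> \<bar>x - y\<bar> / \<bar>a - b\<bar> * 1" using xy by (intro mult_left_mono) auto
  finally show ?thesis using False by (simp add: exp_quotient_def x_def y_def)
qed

lemma Zfun_mesh_integral:
  fixes f :: "real \<Rightarrow> 'a::euclidean_space"
  assumes "continuous_on {0..t} f"
  shows "Zfun (\<lambda>(s, s'). (1 / (s' - s)) *\<^sub>R (integral {0..s'} f - integral {0..s} f) - f s) (mesh t)"
  by (intro Zfun_mesh_derivative integral_has_vector_derivative assms)

lemma continuous_adapted_compose:
  assumes "continuous_adapted M F X" and g: "continuous_on UNIV g"
  shows "continuous_adapted M F (\<lambda>t \<omega>. g (X t \<omega>))"
  using assms unfolding continuous_adapted_def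
  by (auto intro: borel_measurable_continuous_on[OF g] continuous_on_compose2[OF g])

lemma continuous_adapted_diff:
  fixes X Y :: "real \<Rightarrow> 'w \<Rightarrow> 'b::euclidean_space"
  assumes "continuous_adapted M F X" "continuous_adapted M F Y"
  shows "continuous_adapted M F (\<lambda>t \<omega>. X t \<omega> - Y t \<omega>)"
  using assms unfolding continuous_adapted_def by (auto intro!: continuous_intros borel_measurable_diff)

text \<open>The innovation \<open>y\<close> satisfies
  \<open>dy = B (\<phi> - \<Phi>) dt + Q2 dV\<close>. Fed back through the gain \<open>H\<close>, it
  turns the filter correction into the drift \<open>- H B (\<phi> - \<Phi>)\<close> and the noise
  \<open>- H Q2 dV\<close> of the error. The whole statement is about a single path.\<close>

lemma ekf_error_dynamics:
  fixes \<phi> \<Phi> f\<^sub>1 f\<^sub>2 I W :: "real \<Rightarrow> real^'m" and y V Y :: "real \<Rightarrow> real^'n"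
    and H D :: "real \<Rightarrow> real^'n^'m" and B :: "real^'m^'n"
  assumes f: "continuous_on {0..t} f\<^sub>1" "continuous_on {0..t} f\<^sub>2"
    and cont: "continuous_on {0..t} \<phi>" "continuous_on {0..t} \<Phi>" "continuous_on {0..t} y"
    and H: "\<And>s. s \<in> {0..t} \<Longrightarrow> (H has_vector_derivative D s) (at s within {0..t})" "continuous_on {0..t} D"
    and \<phi>: "\<And>s. s \<in> {0..t} \<Longrightarrow> \<phi> s = x + integral {0..s} f\<^sub>1 + Q1 *v W s"
    and \<Phi>: "\<And>s. s \<in> {0..t} \<Longrightarrow> \<Phi> s = xh + integral {0..s} f\<^sub>2 + I s"
    and y: "\<And>s. s \<in> {0..t} \<Longrightarrow>
      y s = integral {0..s} (\<lambda>s. B *v \<phi> s) + Q2 *v V s - integral {0..s} (\<lambda>s. B *v \<Phi> s)"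
    and I: "\<And>s. s \<in> {0..t} \<Longrightarrow> I s = H s *v y s - integral {0..s} (\<lambda>r. D r *v y r) - H 0 *v y 0"
  shows "Zfun (\<lambda>(s, s'). (1 / (s' - s)) *\<^sub>R ((\<phi> s' - \<Phi> s') - (\<phi> s - \<Phi> s)
      - (Q1 *v (W s' - W s) - (H s ** Q2) *v (V s' - V s)))
      - (f\<^sub>1 s - f\<^sub>2 s - (H s ** B) *v (\<phi> s - \<Phi> s))) (mesh t)"
proof -
  interpret mv: bounded_bilinear "(*v) :: real^'n^'m \<Rightarrow> real^'n \<Rightarrow> real^'m"
    by (rule bounded_bilinear_matrix_vector_mult)
  define q where "q = (\<lambda>f (s, s'). (1 / (s' - s)) *\<^sub>R (integral {0..s'} f - integral {0..s} f :: real^'m))"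
  define p where "p = (\<lambda>f (s, s'). (1 / (s' - s)) *\<^sub>R (integral {0..s'} f - integral {0..s} f :: real^'n))"
  define J where "J = (\<lambda>s. H s *v y s - integral {0..s} (\<lambda>r. D r *v y r))"
  have B: "continuous_on {0..t} (\<lambda>s. B *v \<phi> s)" "continuous_on {0..t} (\<lambda>s. B *v \<Phi> s)"
    by (intro bounded_linear.continuous_on[OF matrix_vector_mul_bounded_linear] cont)+
  have cH: "continuous_on {0..t} H" by (rule continuous_on_vector_derivative[OF H(1)])
  have Z1: "Zfun (\<lambda>x. q f\<^sub>1 x - f\<^sub>1 (fst x)) (mesh t)" and Z2: "Zfun (\<lambda>x. q f\<^sub>2 x - f\<^sub>2 (fst x)) (mesh t)"
    using Zfun_mesh_integral[OF f(1)] Zfun_mesh_integral[OF f(2)] by (simp_all add: q_def case_prod_unfold)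
  have "Zfun (\<lambda>x. p (\<lambda>s. B *v \<phi> s) x - B *v \<phi> (fst x)) (mesh t)" "Zfun (\<lambda>x. p (\<lambda>s. B *v \<Phi> s) x - B *v \<Phi> (fst x)) (mesh t)"
    using Zfun_mesh_integral[OF B(1)] Zfun_mesh_integral[OF B(2)] by (simp_all add: p_def case_prod_unfold)
  then have "Zfun (\<lambda>x. (p (\<lambda>s. B *v \<phi> s) x - B *v \<phi> (fst x)) - (p (\<lambda>s. B *v \<Phi> s) x - B *v \<Phi> (fst x))) (mesh t)"
    by (rule Zfun_diff)
  moreover have "Bfun (\<lambda>x. H (fst x)) (mesh t)"
    using Bfun_mesh_left[OF cH] by (simp add: case_prod_unfold)
  ultimately have Z3: "Zfun (\<lambda>x. H (fst x) *v ((p (\<lambda>s. B *v \<phi> s) x - B *v \<phi> (fst x)) -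
      (p (\<lambda>s. B *v \<Phi> s) x - B *v \<Phi> (fst x)))) (mesh t)"
    by (intro mv.Bfun_prod_Zfun)
  have Z4: "Zfun (\<lambda>(s, s'). (1 / (s' - s)) *\<^sub>R (J s' - J s - H s *v (y s' - y s))) (mesh t)"
    unfolding J_def by (rule Zfun_mesh_by_parts[OF H cont(3)])
  have "Zfun (\<lambda>x. (q f\<^sub>1 x - f\<^sub>1 (fst x)) - (q f\<^sub>2 x - f\<^sub>2 (fst x))
      - (case x of (s, s') \<Rightarrow> (1 / (s' - s)) *\<^sub>R (J s' - J s - H s *v (y s' - y s)))
      - H (fst x) *v ((p (\<lambda>s. B *v \<phi> s) x - B *v \<phi> (fst x)) -
      (p (\<lambda>s. B *v \<Phi> s) x - B *v \<Phi> (fst x)))) (mesh t)"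
    by (intro Zfun_diff Z1 Z2 Z3 Z4)
  then show ?thesis
  proof (rule Zfun_ssubst[rotated], intro eventually_meshI)
    fix s s' :: real assume s: "0 \<le> s" "s < s'" "s' \<le> t"
    define c where "c = 1 / (s' - s)"
    have mem: "s \<in> {0..t}" "s' \<in> {0..t}" using s by auto
    have I': "I s' - I s = J s' - J s" by (simp add: I[OF mem(1)] I[OF mem(2)] J_def)
    \<comment> \<open>The observation noise is expressed through the innovation, whose left-point
      increments against \<open>H\<close> are known to match those of \<open>J\<close>.\<close>
    have y': "Q2 *v (V s' - V s) = (y s' - y s) - (integral {0..s'} (\<lambda>s. B *v \<phi> s) - integral {0..s} (\<lambda>s. B *v \<phi> s))
        + (integral {0..s'} (\<lambda>s. B *v \<Phi> s) - integral {0..s} (\<lambda>s. B *v \<Phi> s))"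
      by (simp add: y[OF mem(1)] y[OF mem(2)] matrix_vector_mult_diff_distrib)
    have "(\<phi> s' - \<Phi> s') - (\<phi> s - \<Phi> s) - (Q1 *v (W s' - W s) - (H s ** Q2) *v (V s' - V s)) =
        (integral {0..s'} f\<^sub>1 - integral {0..s} f\<^sub>1) - (integral {0..s'} f\<^sub>2 - integral {0..s} f\<^sub>2)
        - (I s' - I s) + H s *v (Q2 *v (V s' - V s))"
      by (simp add: \<phi>[OF mem(1)] \<phi>[OF mem(2)] \<Phi>[OF mem(1)] \<Phi>[OF mem(2)] matrix_vector_mult_diff_distrib
          matrix_vector_mul_assoc)
    then show "(case (s, s') of (s, s') \<Rightarrow> (1 / (s' - s)) *\<^sub>R ((\<phi> s' - \<Phi> s') - (\<phi> s - \<Phi> s)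
      - (Q1 *v (W s' - W s) - (H s ** Q2) *v (V s' - V s)))
      - (f\<^sub>1 s - f\<^sub>2 s - (H s ** B) *v (\<phi> s - \<Phi> s))) =
      (q f\<^sub>1 (s, s') - f\<^sub>1 (fst (s, s'))) - (q f\<^sub>2 (s, s') - f\<^sub>2 (fst (s, s')))
      - (case (s, s') of (s, s') \<Rightarrow> (1 / (s' - s)) *\<^sub>R (J s' - J s - H s *v (y s' - y s)))
      - H (fst (s, s')) *v ((p (\<lambda>s. B *v \<phi> s) (s, s') - B *v \<phi> (fst (s, s'))) -
      (p (\<lambda>s. B *v \<Phi> s) (s, s') - B *v \<Phi> (fst (s, s'))))"
      unfolding I' y' q_def p_def case_prod_conv fst_conv c_def[symmetric]
      by (simp add: mv.diff_right mv.add_right mv.scaleR_right scaleR_diff_right scaleR_add_right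
          matrix_vector_mult_diff_distrib flip: matrix_vector_mul_assoc)
  qed
qed

section \<open>The signal and the filter error\<close>

theorem theorem1p1:
  fixes M :: "'w measure" and F :: "real \<Rightarrow> 'w measure"
    and W :: "real \<Rightarrow> 'w \<Rightarrow> real^'m" and V :: "real \<Rightarrow> 'w \<Rightarrow> real^'n"
    and A :: "real^'m \<Rightarrow> real^'m" and dA :: "real^'m \<Rightarrow> real^'m^'m"
    and B :: "real^'m^'n"
    and R1 Q1 :: "real^'m^'m" and R2 Q2 :: "real^'n^'n"
    and S :: "real^'m^'m"
    and lambda_dA lambda_A kappa :: real
    and x xh :: "real^'m" and p :: "real^'m^'m"
    and \<phi> \<Phi> :: "real \<Rightarrow> 'w \<Rightarrow> real^'m" and \<psi> :: "real \<Rightarrow> real^'m"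
    and Y :: "real \<Rightarrow> 'w \<Rightarrow> real^'n" and P :: "real \<Rightarrow> 'w \<Rightarrow> real^'m^'m"
    and t \<delta> :: real
  assumes "filtered_prob_space M F"
    and "brownian_motion M F (\<lambda>t \<omega>. (W t \<omega>, V t \<omega>))"
    and "symmetric_matrix Q1" and "invertible Q1" and "R1 = Q1 ** Q1"
    and "symmetric_matrix Q2" and "invertible Q2" and "R2 = Q2 ** Q2"
    and "S = obs_information B R2"
    and "\<And>z. (A has_derivative (\<lambda>h. dA z *v h)) (at z)"
    \<comment> \<open>assumption (i)\<close>
    and "bdd_above (range (\<lambda>z. max_eigenvalue (dA z + transpose (dA z))))"
    and "- lambda_dA = (SUP z. max_eigenvalue (dA z + transpose (dA z)))"
    and "- lambda_dA < 0"
    and "\<And>y z. op_norm (dA y - dA z) \<le> kappa * norm (y - z)"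
    \<comment> \<open>assumption (ii)\<close>
    and "lambda_A \<ge> lambda_dA / 2"
    and "\<And>y z. (y - z) \<bullet> (A y - A z) \<le> - lambda_A * (norm (y - z))\<^sup>2"
    \<comment> \<open>assumption (iii)\<close>
    and "S = max_eigenvalue S *\<^sub>R mat 1" and "max_eigenvalue S > 0"
    \<comment> \<open>the flows: signal, noise-free signal, and Extended Kalman-Bucy filter\<close>
    and "signal_solution M F A Q1 W x \<phi>"
    and "ode_solution A x \<psi>"
    and "observation_process M F B Q2 V \<phi> Y"
    and "covariance_matrix p"
    and "ekf_solution M F A dA B R1 R2 Y xh p \<Phi> P"
    and "t \<ge> 0" and "\<delta> \<ge> 0"
  shows "measure M {\<omega>\<in>space M.
             (norm (\<phi> t \<omega> - \<psi> t))\<^sup>2 \<le> varpi \<delta> * (trace R1 / lambda_A)}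
           > 1 - exp (- \<delta>)
       \<and> measure M {\<omega>\<in>space M.
             (norm (\<phi> t \<omega> - \<Phi> t \<omega>))\<^sup>2
               \<le> 4 * varpi \<delta> * (trace R1 / lambda_A) * sigma2_const S R1 lambda_dA
                 + 2 * exp (- lambda_dA * t) * (norm (x - xh))\<^sup>2
                 + 8 * varpi \<delta> * exp_quotient lambda_A lambda_dA t
                     * max_eigenvalue S * (trace p)\<^sup>2}
           > 1 - exp (- \<delta>)"
proof
  note fps = assms(1) and bm = assms(2) and Q1 = assms(3,4) and R1 = assms(5) and Q2 = assms(6,7) and R2 = assms(8)
    and S = assms(9) and A' = assms(10) and diss = assms(16) and S_id = assms(17) and \<rho> = assms(18)
    and sig = assms(19) and ode = assms(20) and obs = assms(21) and p = assms(22) and ekf = assms(23)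
    and t = assms(24) and \<delta> = assms(25)
  interpret prob_space M using fps by (simp add: filtered_prob_space_def)
  define r where "r = max_eigenvalue S"
  have l: "lambda_dA > 0" and \<mu>: "lambda_A > 0" and \<mu>l: "2 * lambda_A \<ge> lambda_dA"
    using assms(13,15) by linarith+
  have r: "r > 0" using \<rho> by (simp add: r_def)
  have R1_cov: "covariance_matrix R1"
    unfolding covariance_matrix_def symmetric_matrix_def
  proof
    show "transpose R1 = R1"
      using Q1(1) by (simp add: R1 matrix_transpose_mul symmetric_matrix_def)
    have "v \<bullet> (R1 *v v) = (Q1 *v v) \<bullet> (Q1 *v v)" for v
      using Q1(1) inner_matrix_transpose[of v Q1 "Q1 *v v"]
      by (simp add: R1 symmetric_matrix_def del: transpose_matrix_vector flip: matrix_vector_mul_assoc)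
    then show "\<forall>v. 0 \<le> v \<bullet> (R1 *v v)" by simp
  qed
  have trR1: "(norm Q1)\<^sup>2 = trace R1"
    using Q1(1) by (simp add: norm_matrix_eq_trace R1 symmetric_matrix_def)
  \<comment> \<open>Invertibility makes \<open>trace R1\<close> strictly positive, and with it the
    constant \<open>K\<close> of the tail bound.\<close>
  have "Q1 \<noteq> 0"
  proof
    assume "Q1 = 0"
    then have "(mat 1 :: real^'m^'m) = 0" using matrix_mult_matrix_inv[OF Q1(2)] by (simp add: mm.zero_left)
    then have "(mat 1 :: real^'m^'m) $ undefined $ undefined = 0" by simp
    then show False by (simp add: mat_def)
  qed
  then have trR1_pos: "trace R1 > 0" using trR1 by (metis zero_less_norm_iff zero_less_power)
  have contA: "continuous_on UNIV A"
    by (intro continuous_at_imp_continuous_on ballI has_derivative_continuous[OF A'])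
  have contdA: "continuous_on UNIV dA"
    by (rule continuous_on_op_norm_lipschitz[OF assms(14)])
  have neg: "v \<bullet> ((dA z + transpose (dA z)) *v v) \<le> - lambda_dA * (norm v)\<^sup>2" for z v
  proof -
    have "symmetric_matrix (dA z + transpose (dA z))"
      by (simp add: symmetric_matrix_def linear_add[OF bounded_linear.linear[OF bounded_linear_transpose]] add.commute)
    then have "v \<bullet> ((dA z + transpose (dA z)) *v v) \<le> max_eigenvalue (dA z + transpose (dA z)) * (norm v)\<^sup>2"
      by (rule inner_symmetric_le_max_eigenvalue)
    also have "max_eigenvalue (dA z + transpose (dA z)) \<le> - lambda_dA"
      unfolding assms(12) by (rule cSUP_upper[OF UNIV_I assms(11)])
    finally show ?thesis by (simp add: mult_right_mono)
  qed
  have ca_\<phi>: "continuous_adapted M F \<phi>" using sig by (simp add: signal_solution_def)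
  have ca_\<Phi>: "continuous_adapted M F \<Phi>" and ca_P: "continuous_adapted M F P"
    using ekf by (simp_all add: ekf_solution_def)
  have cont: "continuous_on {0..} (\<lambda>s. \<phi> s \<omega>)" "continuous_on {0..} (\<lambda>s. \<Phi> s \<omega>)" "continuous_on {0..} (\<lambda>s. P s \<omega>)"
    if "\<omega> \<in> space M" for \<omega>
    using ca_\<phi> ca_\<Phi> ca_P that by (auto simp: continuous_adapted_def)
  have contA': "continuous_on {0..} (\<lambda>s. A (\<phi> s \<omega>))" "continuous_on {0..} (\<lambda>s. A (\<Phi> s \<omega>))" if "\<omega> \<in> space M" for \<omega>
    using cont[OF that] by (auto intro: continuous_on_compose2[OF contA])
  have sub: "continuous_on {0..t} f" if "continuous_on {0..} f" for f :: "real \<Rightarrow> 'b::topological_space"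
    using that by (rule continuous_on_subset) auto
  have WV0: "AE \<omega> in M. W 0 \<omega> = 0 \<and> V 0 \<omega> = 0"
    using bm by (auto simp: brownian_motion_def zero_prod_def)
  have \<phi>_eq: "AE \<omega> in M. \<forall>s\<ge>0. \<phi> s \<omega> = x + integral {0..s} (\<lambda>s. A (\<phi> s \<omega>)) + Q1 *v W s \<omega>"
    using sig by (simp add: signal_solution_def)

  show "measure M {\<omega>\<in>space M. (norm (\<phi> t \<omega> - \<psi> t))\<^sup>2 \<le> varpi \<delta> * (trace R1 / lambda_A)} > 1 - exp (- \<delta>)"
  proof -
    have \<psi>': "(\<psi> has_vector_derivative A (\<psi> s)) (at s within {0..})" if "s \<ge> 0" for s
      using ode that by (simp add: ode_solution_def)
    have cont\<psi>: "continuous_on {0..} \<psi>"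
      by (rule continuous_on_vector_derivative) (use \<psi>' in auto)
    have cA\<psi>: "continuous_on {0..} (\<lambda>s. A (\<psi> s))"
      by (rule continuous_on_compose2[OF contA cont\<psi>]) auto
    have \<psi>_eq: "\<psi> s = x + integral {0..s} (\<lambda>s. A (\<psi> s))" if "s \<ge> 0" for s
    proof -
      have "((\<lambda>s. A (\<psi> s)) has_integral \<psi> s - \<psi> 0) {0..s}"
        by (rule fundamental_theorem_of_calculus[OF that]) (rule has_vector_derivative_on_Icc[OF \<psi>'])
      then show ?thesis using ode by (simp add: integral_unique ode_solution_def)
    qed
    \<comment> \<open>Both flows start at \<open>x\<close>, so the initial error is zero; the noise
      enters through \<open>Q1\<close> alone. The choice \<open>w = varpi \<delta> / 2\<close>
      absorbs the factor 2 of the tail bound.\<close>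
    have "measure M {\<omega>\<in>space M. (norm (\<phi> t \<omega> - \<psi> t))\<^sup>2 \<le>
        2 * exp (- 2 * lambda_A * t) * (norm (0 :: real^'m))\<^sup>2 + 2 * (trace R1 / lambda_A) * (varpi \<delta> / 2)} > 1 - exp (- \<delta>)"
    proof (rule dissipative_tail_bound[where F = F and W = W and V = V and Q = Q1 and H = "\<lambda>_ _. 0" and \<mu> = lambda_A
          and b = "\<lambda>s \<omega>. A (\<phi> s \<omega>) - A (\<psi> s)" and Z = "\<lambda>s \<omega>. \<phi> s \<omega> - \<psi> s" and \<delta> = \<delta>
          and q = "\<lambda>_. trace R1" and G = "\<lambda>s. trace R1 * (exp (2 * lambda_A * s) - 1) / lambda_A", OF fps bm])
      show "continuous_adapted M F (\<lambda>s \<omega>. \<phi> s \<omega> - \<psi> s)"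
        by (rule continuous_adapted_diff[OF ca_\<phi>]) (use cont\<psi> in \<open>auto simp: continuous_adapted_def\<close>)
      show "continuous_adapted M F (\<lambda>_ _. 0 :: real^'n^'m)" by (simp add: continuous_adapted_def)
      show "AE \<omega> in M. \<phi> 0 \<omega> - \<psi> 0 = 0"
        using \<phi>_eq WV0
      proof eventually_elim
        case (elim \<omega>)
        then show ?case using \<psi>_eq[of 0] elim(1)[rule_format, of 0] by simp
      qed
      show "AE \<omega> in M. continuous_on {0..t} (\<lambda>s. A (\<phi> s \<omega>) - A (\<psi> s))"
        by (rule AE_I2) (intro continuous_intros sub contA' cA\<psi>)
      show "AE \<omega> in M. Zfun (\<lambda>(s, s'). (1 / (s' - s)) *\<^sub>R (\<phi> s' \<omega> - \<psi> s' - (\<phi> s \<omega> - \<psi> s) -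
          (Q1 *v (W s' \<omega> - W s \<omega>) - 0 *v (V s' \<omega> - V s \<omega>))) - (A (\<phi> s \<omega>) - A (\<psi> s))) (mesh t)"
        using \<phi>_eq AE_space
      proof eventually_elim
        case (elim \<omega>)
        have "Zfun (\<lambda>x. (case x of (s, s') \<Rightarrow> (1 / (s' - s)) *\<^sub>R
            (integral {0..s'} (\<lambda>s. A (\<phi> s \<omega>)) - integral {0..s} (\<lambda>s. A (\<phi> s \<omega>))) - A (\<phi> s \<omega>)) -
          (case x of (s, s') \<Rightarrow> (1 / (s' - s)) *\<^sub>R
            (integral {0..s'} (\<lambda>s. A (\<psi> s)) - integral {0..s} (\<lambda>s. A (\<psi> s))) - A (\<psi> s))) (mesh t)"
          by (intro Zfun_diff Zfun_mesh_integral sub contA' cA\<psi> elim)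
        then show ?case
        proof (rule Zfun_ssubst[rotated], intro eventually_meshI)
          fix s s' :: real assume s: "0 \<le> s" "s < s'" "s' \<le> t"
          show "(case (s, s') of (s, s') \<Rightarrow> (1 / (s' - s)) *\<^sub>R (\<phi> s' \<omega> - \<psi> s' - (\<phi> s \<omega> - \<psi> s) -
            (Q1 *v (W s' \<omega> - W s \<omega>) - 0 *v (V s' \<omega> - V s \<omega>))) - (A (\<phi> s \<omega>) - A (\<psi> s))) =
            (case (s, s') of (s, s') \<Rightarrow> (1 / (s' - s)) *\<^sub>R
            (integral {0..s'} (\<lambda>s. A (\<phi> s \<omega>)) - integral {0..s} (\<lambda>s. A (\<phi> s \<omega>))) - A (\<phi> s \<omega>)) -
            (case (s, s') of (s, s') \<Rightarrow> (1 / (s' - s)) *\<^sub>R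
            (integral {0..s'} (\<lambda>s. A (\<psi> s)) - integral {0..s} (\<lambda>s. A (\<psi> s))) - A (\<psi> s))"
            using s elim(1)[rule_format, of s] elim(1)[rule_format, of s'] \<psi>_eq[of s] \<psi>_eq[of s']
            by (simp add: matrix_vector_mult_diff_distrib scaleR_diff_right scaleR_add_right)
        qed
      qed
      show "AE \<omega> in M. \<forall>s\<in>{0..t}. (\<phi> s \<omega> - \<psi> s) \<bullet> (A (\<phi> s \<omega>) - A (\<psi> s)) \<le> - lambda_A * (norm (\<phi> s \<omega> - \<psi> s))\<^sup>2"
        using diss by blast
      show "((\<lambda>s. trace R1 * (exp (2 * lambda_A * s) - 1) / lambda_A) has_real_derivative
          2 * exp (2 * lambda_A * s) * trace R1) (at s within {0..t})" for s
        using \<mu> by (auto intro!: derivative_eq_intros)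
      show "0 \<le> trace R1 * (exp (2 * lambda_A * s) - 1) / lambda_A" if "s \<in> {0..t}" for s
        using that \<mu> trR1_pos by auto
      show "exp (- 2 * lambda_A * t) * (trace R1 * (exp (2 * lambda_A * t) - 1) / lambda_A) \<le> trace R1 / lambda_A"
        using \<mu> trR1_pos by (simp add: exp_minus field_simps)
    qed (use trR1 trR1_pos \<mu> varpi_gt[OF \<delta>] t \<delta> in auto)
    then show ?thesis by (simp add: mult.commute)
  qed

  show "measure M {\<omega>\<in>space M. (norm (\<phi> t \<omega> - \<Phi> t \<omega>))\<^sup>2
               \<le> 4 * varpi \<delta> * (trace R1 / lambda_A) * sigma2_const S R1 lambda_dA
                 + 2 * exp (- lambda_dA * t) * (norm (x - xh))\<^sup>2
                 + 8 * varpi \<delta> * exp_quotient lambda_A lambda_dA t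
                     * max_eigenvalue S * (trace p)\<^sup>2} > 1 - exp (- \<delta>)"
  proof -
    define N where "N = matrix_inv R2"
    define C where "C = transpose B ** N ** Q2"
    define H where "H = (\<lambda>s \<omega>. P s \<omega> ** transpose B ** N)"
    have R2': "invertible R2" "symmetric_matrix R2"
      using Q2 by (simp_all add: R2 invertible_mult symmetric_matrix_def matrix_transpose_mul)
    have N: "transpose N = N" "N ** R2 = mat 1"
      unfolding N_def using transpose_matrix_inv_symmetric[OF R2'] matrix_inv_mult_matrix[OF R2'(1)] by auto
    have S': "S = transpose B ** N ** B" by (simp add: S obs_information_def N_def)
    \<comment> \<open>Reduces the squared norm of the observation noise coefficient
      \<open>P C\<close> to the trace of \<open>P S P\<close>, which is \<open>r\<close> times the
      squared norm of \<open>P\<close>.\<close>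
    have CC: "C ** transpose C = S"
    proof -
      have "C ** transpose C = transpose B ** (N ** (Q2 ** Q2)) ** N ** B"
        using Q2(1) N(1) by (simp add: C_def symmetric_matrix_def matrix_transpose_mul matrix_mul_assoc)
      then show ?thesis using N(2) by (simp add: R2[symmetric] S')
    qed
    have HQ: "H s \<omega> ** Q2 = P s \<omega> ** C" and HB: "H s \<omega> ** B = P s \<omega> ** S" for s \<omega>
      by (simp_all add: H_def C_def S' matrix_mul_assoc)
    have S_r: "S = r *\<^sub>R mat 1" using S_id by (simp add: r_def)
    define P' where "P' = (\<lambda>s \<omega>. dA (\<Phi> s \<omega>) ** P s \<omega> + P s \<omega> ** transpose (dA (\<Phi> s \<omega>)) + R1
        - P s \<omega> ** (r *\<^sub>R mat 1) ** P s \<omega>)"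
    have ric: "AE \<omega> in M. P 0 \<omega> = p \<and> (\<forall>s\<ge>0. ((\<lambda>s. P s \<omega>) has_vector_derivative P' s \<omega>) (at s within {0..}))"
      using ekf unfolding ekf_solution_def S[symmetric] P'_def S_r[symmetric] by blast
    have contP': "continuous_on {0..} (\<lambda>s. P' s \<omega>)" if "\<omega> \<in> space M" for \<omega>
      unfolding P'_def using cont[OF that]
      by (intro continuous_intros mm.continuous_on bounded_linear.continuous_on[OF bounded_linear_transpose]
          continuous_on_compose2[OF contdA]) auto
    have Pbound: "AE \<omega> in M. \<forall>s\<ge>0. covariance_matrix (P s \<omega>) \<and>
        trace (P s \<omega>) \<le> exp (- lambda_dA * s) * trace p + trace R1 / lambda_dA"
      using ric AE_space
    proof eventually_elim
      case (elim \<omega>)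
      have a: "continuous_on {0..} (\<lambda>s. dA (\<Phi> s \<omega>))"
        using cont[OF elim(2)] by (auto intro: continuous_on_compose2[OF contdA])
      have d: "((\<lambda>s. P s \<omega>) has_vector_derivative dA (\<Phi> s \<omega>) ** P s \<omega> + P s \<omega> ** transpose (dA (\<Phi> s \<omega>)) + R1
        - P s \<omega> ** (r *\<^sub>R mat 1) ** P s \<omega>) (at s within {0..})" if "s \<ge> 0" for s
        using elim(1) that by (simp add: P'_def)
      have p0: "covariance_matrix (P 0 \<omega>)" using p elim(1) by simp
      show ?case
        using riccati_covariance[OF a d R1_cov p0] riccati_trace_le[OF a d R1_cov p0 _ _ l neg] r elim(1) by auto
    qed
    obtain I where I: "has_ito_integral M F H (\<lambda>t \<omega>. Y t \<omega> - integral {0..t} (\<lambda>s. B *v \<Phi> s \<omega>)) I"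
      and \<Phi>_eq: "AE \<omega> in M. \<forall>s\<ge>0. \<Phi> s \<omega> = xh + integral {0..s} (\<lambda>s. A (\<Phi> s \<omega>)) + I s \<omega>"
      using ekf unfolding ekf_solution_def H_def N_def by blast
    define y where "y = (\<lambda>t \<omega>. Y t \<omega> - integral {0..t} (\<lambda>s. B *v \<Phi> s \<omega>))"
    define D where "D = (\<lambda>s \<omega>. P' s \<omega> ** transpose B ** N)"
    have linN: "bounded_linear (\<lambda>K :: real^'m^'m. K ** transpose B ** N)"
      by (intro bounded_linear_compose[OF mm.bounded_linear_left mm.bounded_linear_left])
    \<comment> \<open>The gain is a fixed linear image of \<open>P\<close>, so it inherits the
      continuous derivative that integration by parts requires.\<close>
    have HD: "AE \<omega> in M. (\<forall>s\<ge>0. ((\<lambda>s. H s \<omega>) has_vector_derivative D s \<omega>) (at s within {0..})) \<and>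
        continuous_on {0..} (\<lambda>s. D s \<omega>)"
      using ric AE_space
    proof eventually_elim
      case (elim \<omega>)
      then show ?case unfolding H_def D_def
        by (auto intro!: bounded_linear.has_vector_derivative[OF linN] bounded_linear.continuous_on[OF linN] contP')
    qed
    have I_eq: "AE \<omega> in M. \<forall>s\<ge>0. I s \<omega> = H s \<omega> *v y s \<omega> - integral {0..s} (\<lambda>r. D r \<omega> *v y r \<omega>) - H 0 \<omega> *v y 0 \<omega>"
      by (rule ito_integral_by_parts[OF prob_space_axioms I[folded y_def] HD])
    have Y_eq: "AE \<omega> in M. \<forall>s\<ge>0. Y s \<omega> = integral {0..s} (\<lambda>s. B *v \<phi> s \<omega>) + Q2 *v V s \<omega>"
      using obs by (simp add: observation_process_def)
    have cont_y: "continuous_on {0..} (\<lambda>s. y s \<omega>)" if "\<omega> \<in> space M" for \<omega>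
      using I that unfolding y_def has_ito_integral_def continuous_adapted_def by blast
    \<comment> \<open>The noise rate is at most \<open>trace R1\<close> plus \<open>r\<close> times
      the squared trace bound for \<open>P\<close>. Splitting that square by
      \<open>(a + b)^2 \<le> 2 a^2 + 2 b^2\<close> gives a stationary part \<alpha>, the origin of
      the factor \<open>sigma2_const\<close>, and a part with coefficient \<beta> decaying like
      \<open>exp (- 2 * lambda_dA * s)\<close>.\<close>
    define \<alpha> \<beta> where "\<alpha> = trace R1 * sigma2_const S R1 lambda_dA" and "\<beta> = 2 * r * (trace p)\<^sup>2"
    have \<alpha>_eq: "\<alpha> = trace R1 + 2 * r * (trace R1 / lambda_dA)\<^sup>2"
      by (simp add: \<alpha>_def sigma2_const_def pi_const_def r_def power2_eq_square algebra_simps)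
    have \<alpha>: "\<alpha> > 0" unfolding \<alpha>_eq using trR1_pos r by (simp add: add_pos_nonneg)
    have \<beta>: "\<beta> \<ge> 0" using r by (simp add: \<beta>_def)
    define \<Theta> where "\<Theta> = exp_quotient lambda_A lambda_dA t"
    \<comment> \<open>Bounds the discounted integral of the noise rate: the stationary part
      contributes \<open>\<alpha> / lambda_A\<close>, the transient one the growth kernel, which
      \<Theta> dominates.\<close>
    define K where "K = \<alpha> / lambda_A + 2 * \<beta> * \<Theta>"
    have \<Theta>: "\<Theta> \<ge> 0" using t by (simp add: \<Theta>_def exp_quotient_def)
    have K: "K > 0" using \<alpha> \<mu> \<beta> \<Theta> by (simp add: K_def add_pos_nonneg)
    have bound: "measure M {\<omega>\<in>space M. (norm (\<phi> t \<omega> - \<Phi> t \<omega>))\<^sup>2 \<le>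
        2 * exp (- 2 * lambda_A * t) * (norm (x - xh))\<^sup>2 + 2 * K * varpi \<delta>} > 1 - exp (- \<delta>)"
    proof (rule dissipative_tail_bound[where F = F and W = W and V = V and Q = Q1 and H = "\<lambda>s \<omega>. H s \<omega> ** Q2" and \<mu> = lambda_A
          and b = "\<lambda>s \<omega>. A (\<phi> s \<omega>) - A (\<Phi> s \<omega>) - (H s \<omega> ** B) *v (\<phi> s \<omega> - \<Phi> s \<omega>)"
          and Z = "\<lambda>s \<omega>. \<phi> s \<omega> - \<Phi> s \<omega>" and \<delta> = \<delta>
          and q = "\<lambda>s. \<alpha> + \<beta> * exp (- 2 * lambda_dA * s)"
          and G = "\<lambda>s. \<alpha> * (exp (2 * lambda_A * s) - 1) / lambda_A + 2 * \<beta> * growth_kernel lambda_A lambda_dA s", OF fps bm])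
      show "continuous_adapted M F (\<lambda>s \<omega>. \<phi> s \<omega> - \<Phi> s \<omega>)"
        by (rule continuous_adapted_diff[OF ca_\<phi> ca_\<Phi>])
      show "continuous_adapted M F (\<lambda>s \<omega>. H s \<omega> ** Q2)"
        unfolding H_def
        by (intro continuous_adapted_compose[OF ca_P] mm.continuous_on continuous_intros)
      show "AE \<omega> in M. \<phi> 0 \<omega> - \<Phi> 0 \<omega> = x - xh"
        using \<phi>_eq \<Phi>_eq I_eq WV0
      proof eventually_elim
        case (elim \<omega>)
        then show ?case
          using elim(1)[rule_format, of 0] elim(2)[rule_format, of 0] elim(3)[rule_format, of 0] by simp
      qed
      show "AE \<omega> in M. continuous_on {0..t} (\<lambda>s. A (\<phi> s \<omega>) - A (\<Phi> s \<omega>) - (H s \<omega> ** B) *v (\<phi> s \<omega> - \<Phi> s \<omega>))"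
        unfolding H_def
        by (rule AE_I2) (intro continuous_intros sub contA' cont mm.continuous_on
            bounded_bilinear.continuous_on[OF bounded_bilinear_matrix_vector_mult])
      show "AE \<omega> in M. Zfun (\<lambda>(s, s'). (1 / (s' - s)) *\<^sub>R (\<phi> s' \<omega> - \<Phi> s' \<omega> - (\<phi> s \<omega> - \<Phi> s \<omega>) -
          (Q1 *v (W s' \<omega> - W s \<omega>) - (H s \<omega> ** Q2) *v (V s' \<omega> - V s \<omega>))) -
          (A (\<phi> s \<omega>) - A (\<Phi> s \<omega>) - (H s \<omega> ** B) *v (\<phi> s \<omega> - \<Phi> s \<omega>))) (mesh t)"
        using \<phi>_eq \<Phi>_eq I_eq Y_eq HD AE_space
      proof eventually_elim
        case (elim \<omega>)
        note cont' = cont[OF elim(6)] contA'[OF elim(6)] cont_y[OF elim(6)]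
        show ?case
          by (rule ekf_error_dynamics[where D = "\<lambda>s. D s \<omega>" and y = "\<lambda>s. y s \<omega>" and I = "\<lambda>s. I s \<omega>"
                and x = x and xh = xh and \<Phi> = "\<lambda>s. \<Phi> s \<omega>" and \<phi> = "\<lambda>s. \<phi> s \<omega>"])
            (use elim cont' has_vector_derivative_on_Icc[of "\<lambda>s. H s \<omega>" "\<lambda>s. D s \<omega>"]
              in \<open>auto simp: y_def intro!: sub\<close>)
      qed
      show "AE \<omega> in M. \<forall>s\<in>{0..t}. (\<phi> s \<omega> - \<Phi> s \<omega>) \<bullet> (A (\<phi> s \<omega>) - A (\<Phi> s \<omega>) - (H s \<omega> ** B) *v (\<phi> s \<omega> - \<Phi> s \<omega>))
          \<le> - lambda_A * (norm (\<phi> s \<omega> - \<Phi> s \<omega>))\<^sup>2"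
        using Pbound
      proof eventually_elim
        case (elim \<omega>)
        \<comment> \<open>Assumption (iii) is decisive here: for \<open>S\<close> a multiple of the
          identity, \<open>P S\<close> is a nonnegative multiple of \<open>P\<close>, so the filter
          feedback can only help the dissipation.\<close>
        have "0 \<le> (\<phi> s \<omega> - \<Phi> s \<omega>) \<bullet> ((H s \<omega> ** B) *v (\<phi> s \<omega> - \<Phi> s \<omega>))" if "s \<ge> 0" for s
        proof -
          have "H s \<omega> ** B = r *\<^sub>R P s \<omega>" unfolding HB by (simp add: S_r mm.scaleR_right)
          then show ?thesis using elim that r by (simp add: covariance_matrix_def flip: scaleR_matrix_vector_assoc)
        qed
        then show ?case
          using diss[of "\<phi> s \<omega>" "\<Phi> s \<omega>" for s] by (smt (verit) atLeastAtMost_iff inner_diff_right)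
      qed
      show "AE \<omega> in M. \<forall>s\<in>{0..t}. (norm Q1)\<^sup>2 + (norm (H s \<omega> ** Q2))\<^sup>2 \<le> \<alpha> + \<beta> * exp (- 2 * lambda_dA * s)"
        using Pbound
      proof eventually_elim
        case (elim \<omega>)
        show ?case
        proof
          fix s assume "s \<in> {0..t}"
          then have cov: "covariance_matrix (P s \<omega>)"
            and tr: "trace (P s \<omega>) \<le> exp (- lambda_dA * s) * trace p + trace R1 / lambda_dA"
            using elim by auto
          have "(norm (H s \<omega> ** Q2))\<^sup>2 = trace (P s \<omega> ** (C ** transpose C) ** transpose (P s \<omega>))"
            unfolding HQ norm_matrix_eq_trace by (simp add: matrix_transpose_mul matrix_mul_assoc)
          also have "\<dots> = r * (norm (P s \<omega>))\<^sup>2"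
            unfolding CC S_r norm_matrix_eq_trace
            by (simp add: mm.scaleR_left mm.scaleR_right linear_scale[OF bounded_linear.linear[OF bounded_linear_trace]])
          also have "\<dots> \<le> r * (trace (P s \<omega>))\<^sup>2"
            using r covariance_matrix_norm_le_trace[OF cov] by (intro mult_left_mono power_mono) auto
          also have "\<dots> \<le> r * (exp (- lambda_dA * s) * trace p + trace R1 / lambda_dA)\<^sup>2"
            using r tr covariance_matrix_trace_nonneg[OF cov] by (intro mult_left_mono power_mono) auto
          also have "\<dots> \<le> r * (2 * (exp (- lambda_dA * s) * trace p)\<^sup>2 + 2 * (trace R1 / lambda_dA)\<^sup>2)"
          proof -
            have "(a + b)\<^sup>2 \<le> 2 * a\<^sup>2 + 2 * b\<^sup>2" for a b :: real
              using zero_le_power2[of "a - b"] by (simp add: power2_eq_square algebra_simps)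
            then show ?thesis using r by (intro mult_left_mono) auto
          qed
          also have "(exp (- lambda_dA * s) * trace p)\<^sup>2 = exp (- 2 * lambda_dA * s) * (trace p)\<^sup>2"
            by (simp add: power_mult_distrib flip: exp_double)
          finally show "(norm Q1)\<^sup>2 + (norm (H s \<omega> ** Q2))\<^sup>2 \<le> \<alpha> + \<beta> * exp (- 2 * lambda_dA * s)"
            unfolding trR1 \<alpha>_eq \<beta>_def by (simp add: algebra_simps)
        qed
      qed
      show "continuous_on {0..t} (\<lambda>s. \<alpha> + \<beta> * exp (- 2 * lambda_dA * s))" by (intro continuous_intros)
      show "((\<lambda>s. \<alpha> * (exp (2 * lambda_A * s) - 1) / lambda_A + 2 * \<beta> * growth_kernel lambda_A lambda_dA s) has_real_derivative
          2 * exp (2 * lambda_A * s) * (\<alpha> + \<beta> * exp (- 2 * lambda_dA * s))) (at s within {0..t})" for s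
      proof -
        have "2 * \<alpha> * exp (2 * lambda_A * s) + 2 * \<beta> * exp (2 * (lambda_A - lambda_dA) * s) =
            2 * exp (2 * lambda_A * s) * (\<alpha> + \<beta> * exp (- 2 * lambda_dA * s))"
          by (simp add: algebra_simps flip: exp_add)
        moreover have d: "((\<lambda>s. \<alpha> * (exp (2 * lambda_A * s) - 1) / lambda_A) has_real_derivative
            2 * \<alpha> * exp (2 * lambda_A * s)) (at s within {0..t})"
          using \<mu> by (auto intro!: derivative_eq_intros)
        ultimately show ?thesis
          using DERIV_add[OF d DERIV_cmult[OF growth_kernel_derivative[of lambda_A lambda_dA s "{0..t}"], of "2 * \<beta>"]]
          by (simp only: mult.assoc)
      qed
      show "\<alpha> * (exp (2 * lambda_A * 0) - 1) / lambda_A + 2 * \<beta> * growth_kernel lambda_A lambda_dA 0 = 0"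
        by (simp add: growth_kernel_def)
      show "0 \<le> \<alpha> * (exp (2 * lambda_A * s) - 1) / lambda_A + 2 * \<beta> * growth_kernel lambda_A lambda_dA s"
        if "s \<in> {0..t}" for s
        using that \<mu> \<alpha> \<beta> growth_kernel_nonneg[of s] by (intro add_nonneg_nonneg) auto
      show "exp (- 2 * lambda_A * t) * (\<alpha> * (exp (2 * lambda_A * t) - 1) / lambda_A + 2 * \<beta> * growth_kernel lambda_A lambda_dA t) \<le> K"
      proof -
        have "exp (- 2 * lambda_A * t) * (\<alpha> * (exp (2 * lambda_A * t) - 1) / lambda_A) \<le> \<alpha> / lambda_A"
          using \<mu> \<alpha> by (simp add: exp_minus field_simps)
        moreover have "2 * \<beta> * (exp (- 2 * lambda_A * t) * growth_kernel lambda_A lambda_dA t) \<le> 2 * \<beta> * \<Theta>"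
          unfolding \<Theta>_def using \<mu> l t \<beta> by (intro mult_left_mono growth_kernel_le_exp_quotient) auto
        ultimately show ?thesis unfolding K_def by (simp only: distrib_left mult.left_commute)
      qed
      \<comment> \<open>Taking \<open>w = varpi \<delta>\<close> gives the term with
        \<open>trace p\<close> exactly its factor 8 and leaves a factor 2 to spare in the stationary
        term.\<close>
      show "\<delta> + ln 2 / 2 < varpi \<delta>" using varpi_gt[OF \<delta>] by linarith
    qed (use K t \<delta> in auto)
    also have "measure M {\<omega>\<in>space M. (norm (\<phi> t \<omega> - \<Phi> t \<omega>))\<^sup>2 \<le>
        2 * exp (- 2 * lambda_A * t) * (norm (x - xh))\<^sup>2 + 2 * K * varpi \<delta>} \<le>
      measure M {\<omega>\<in>space M. (norm (\<phi> t \<omega> - \<Phi> t \<omega>))\<^sup>2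
               \<le> 4 * varpi \<delta> * (trace R1 / lambda_A) * sigma2_const S R1 lambda_dA
                 + 2 * exp (- lambda_dA * t) * (norm (x - xh))\<^sup>2
                 + 8 * varpi \<delta> * exp_quotient lambda_A lambda_dA t
                     * max_eigenvalue S * (trace p)\<^sup>2}"
    proof (rule finite_measure_mono)
      \<comment> \<open>The initial error decays at rate \<open>2 * lambda_A\<close>, which by
        assumption (ii) is no slower than the claimed \<open>lambda_dA\<close>.\<close>
      have "2 * lambda_A * t \<ge> lambda_dA * t" using \<mu>l t by (intro mult_right_mono)
      then have "2 * exp (- 2 * lambda_A * t) * (norm (x - xh))\<^sup>2 \<le> 2 * exp (- lambda_dA * t) * (norm (x - xh))\<^sup>2"
        by (intro mult_right_mono) auto
      moreover have "2 * K * varpi \<delta> = 2 * varpi \<delta> * (trace R1 / lambda_A) * sigma2_const S R1 lambda_dA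
          + 8 * varpi \<delta> * exp_quotient lambda_A lambda_dA t * max_eigenvalue S * (trace p)\<^sup>2"
        by (simp add: K_def \<alpha>_def \<beta>_def \<Theta>_def r_def algebra_simps)
      moreover have "0 \<le> varpi \<delta> * (\<alpha> / lambda_A)"
        using varpi_gt(2)[OF \<delta>] \<alpha> \<mu> by simp
      then have "0 \<le> varpi \<delta> * (trace R1 / lambda_A) * sigma2_const S R1 lambda_dA"
        by (simp add: \<alpha>_def mult_ac)
      ultimately have "2 * exp (- 2 * lambda_A * t) * (norm (x - xh))\<^sup>2 + 2 * K * varpi \<delta> \<le>
          4 * varpi \<delta> * (trace R1 / lambda_A) * sigma2_const S R1 lambda_dA
          + 2 * exp (- lambda_dA * t) * (norm (x - xh))\<^sup>2
          + 8 * varpi \<delta> * exp_quotient lambda_A lambda_dA t * max_eigenvalue S * (trace p)\<^sup>2"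
        by linarith
      then show "{\<omega>\<in>space M. (norm (\<phi> t \<omega> - \<Phi> t \<omega>))\<^sup>2 \<le>
        2 * exp (- 2 * lambda_A * t) * (norm (x - xh))\<^sup>2 + 2 * K * varpi \<delta>} \<subseteq>
        {\<omega>\<in>space M. (norm (\<phi> t \<omega> - \<Phi> t \<omega>))\<^sup>2
               \<le> 4 * varpi \<delta> * (trace R1 / lambda_A) * sigma2_const S R1 lambda_dA
                 + 2 * exp (- lambda_dA * t) * (norm (x - xh))\<^sup>2
                 + 8 * varpi \<delta> * exp_quotient lambda_A lambda_dA t
                     * max_eigenvalue S * (trace p)\<^sup>2}"
        by auto
      have [measurable]: "\<phi> t \<in> borel_measurable M" "\<Phi> t \<in> borel_measurable M"
        using ca_\<phi> ca_\<Phi> fps t measurable_from_subalg unfolding continuous_adapted_def filtered_prob_space_def by blast+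
      show "{\<omega>\<in>space M. (norm (\<phi> t \<omega> - \<Phi> t \<omega>))\<^sup>2
               \<le> 4 * varpi \<delta> * (trace R1 / lambda_A) * sigma2_const S R1 lambda_dA
                 + 2 * exp (- lambda_dA * t) * (norm (x - xh))\<^sup>2
                 + 8 * varpi \<delta> * exp_quotient lambda_A lambda_dA t
                     * max_eigenvalue S * (trace p)\<^sup>2} \<in> events"
        by measurable
    qed
    finally show ?thesis .
  qed
qed

end
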